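(* Let $N\ge 5$ and $\alpha,l\in\mathbb{R}$, put $N'=N+\alpha$ and $\tau=l-\alpha$, and assume $2N>N'>4$, $\tau>-4$ and $\alpha\ge\frac{N-4}{4}\tau$. Let $p_s=\frac{N'+4+2\tau}{N'-4}$. Let $\Omega\subset\mathbb{R}^N$ be a bounded domain of class $C^2$, not a ball, with $0\in\Omega$. Then the embedding $$D^{2,\alpha}_0(\Omega)\hookrightarrow L^q_l(\Omega)$$ is continuous for every $q\in[1,p_s+1]$ and compact for every $q\in[1,p_s+1)$.
   Context: $D^{2,\alpha}_0(\Omega)$ is the completion of $C_c^\infty(\Omega\setminus\{0\})$ with respect to the norm $\|\phi\|_{2,\alpha}=\left(\int_\Omega|x|^\alpha|\Delta\phi|^2\,dx\right)^{1/2}$. For $q\ge1$, $L^q_l(\Omega)$ is the space of functions $\phi$ with $|x|^{l/q}|\phi|\in L^q(\Omega)$, with norm $\|\phi\|_{L^q_l(\Omega)}=\left(\int_\Omega|x|^l|\phi|^q\,dx\right)^{1/q}$. *)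

theory Defs
  imports "HOL-Analysis.Analysis"
begin

definition partial_deriv :: "'n::finite \<Rightarrow> (real^'n \<Rightarrow> real) \<Rightarrow> real^'n \<Rightarrow> real" where
  "partial_deriv i f x = frechet_derivative f (at x) (axis i 1)"

fun C_k :: "nat \<Rightarrow> (real^'n::finite \<Rightarrow> real) \<Rightarrow> bool" where
  "C_k 0 f \<longleftrightarrow> continuous_on UNIV f"
| "C_k (Suc k) f \<longleftrightarrow> (\<forall>x. f differentiable (at x)) \<and> (\<forall>i. C_k k (partial_deriv i f))"

definition laplacian :: "(real^'n::finite \<Rightarrow> real) \<Rightarrow> real^'n \<Rightarrow> real" where
  "laplacian f x = (\<Sum>i\<in>UNIV. partial_deriv i (partial_deriv i f) x)"

(* The boundary is locally a C^2 graph after relabelling (choice of i) and reorienting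
   (choice of s) the axes; the function g of the remaining N-1 coordinates is encoded as
   a function on the whole space that does not depend on the i-th coordinate. *)
definition C2_boundary :: "(real^'n::finite) set \<Rightarrow> bool" where
  "C2_boundary \<Omega> \<longleftrightarrow>
    (\<forall>x0\<in>frontier \<Omega>. \<exists>r>0. \<exists>i. \<exists>s\<in>{1, - 1::real}. \<exists>g.
       C_k 2 g \<and> (\<forall>x y. (\<forall>j. j \<noteq> i \<longrightarrow> x $ j = y $ j) \<longrightarrow> g x = g y) \<and>
       \<Omega> \<inter> ball x0 r = {x \<in> ball x0 r. s * x $ i > g x})"

definition bounded_C2_domain :: "(real^'n::finite) set \<Rightarrow> bool" where
  "bounded_C2_domain \<Omega> \<longleftrightarrow>
     open \<Omega> \<and> connected \<Omega> \<and> \<Omega> \<noteq> {} \<and> bounded \<Omega> \<and> C2_boundary \<Omega>"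

(* Test functions are regarded as defined on the whole space, vanishing off their support. *)
definition test_functions :: "(real^'n::finite) set \<Rightarrow> (real^'n \<Rightarrow> real) set" where
  "test_functions U =
     {\<phi>. (\<forall>k. C_k k \<phi>) \<and> compact (closure {x. \<phi> x \<noteq> 0}) \<and> closure {x. \<phi> x \<noteq> 0} \<subseteq> U}"

definition norm2 :: "real \<Rightarrow> (real^'n::finite) set \<Rightarrow> (real^'n \<Rightarrow> real) \<Rightarrow> real" where
  "norm2 \<alpha> \<Omega> \<phi> = sqrt (LINT x|lebesgue_on \<Omega>. norm x powr \<alpha> * \<bar>laplacian \<phi> x\<bar>\<^sup>2)"


(* The completion: Cauchy sequences of test functions modulo null sequences. *)

definition D2_cauchy ::
  "real \<Rightarrow> (real^'n::finite) set \<Rightarrow> (nat \<Rightarrow> real^'n \<Rightarrow> real) set" where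
  "D2_cauchy \<alpha> \<Omega> =
     {s. (\<forall>n. s n \<in> test_functions (\<Omega> - {0})) \<and>
         (\<forall>e>0. \<exists>M. \<forall>m\<ge>M. \<forall>n\<ge>M. norm2 \<alpha> \<Omega> (\<lambda>x. s m x - s n x) < e)}"

definition D2_rel ::
  "real \<Rightarrow> (real^'n::finite) set \<Rightarrow> (nat \<Rightarrow> real^'n \<Rightarrow> real) rel" where
  "D2_rel \<alpha> \<Omega> =
     {(s, t). s \<in> D2_cauchy \<alpha> \<Omega> \<and> t \<in> D2_cauchy \<alpha> \<Omega> \<and>
              (\<lambda>n. norm2 \<alpha> \<Omega> (\<lambda>x. s n x - t n x)) \<longlonglongrightarrow> 0}"

type_synonym 'n D2_elem = "(nat \<Rightarrow> real^'n \<Rightarrow> real) set"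

definition D2 :: "real \<Rightarrow> (real^'n::finite) set \<Rightarrow> 'n D2_elem set" where
  "D2 \<alpha> \<Omega> = D2_cauchy \<alpha> \<Omega> // D2_rel \<alpha> \<Omega>"

definition D2_of :: "real \<Rightarrow> (real^'n::finite) set \<Rightarrow> (real^'n \<Rightarrow> real) \<Rightarrow> 'n D2_elem" where
  "D2_of \<alpha> \<Omega> \<phi> = D2_rel \<alpha> \<Omega> `` {\<lambda>_. \<phi>}"

definition D2_add ::
  "real \<Rightarrow> (real^'n::finite) set \<Rightarrow> 'n D2_elem \<Rightarrow> 'n D2_elem \<Rightarrow> 'n D2_elem" where
  "D2_add \<alpha> \<Omega> u v = (\<Union>s\<in>u. \<Union>t\<in>v. D2_rel \<alpha> \<Omega> `` {\<lambda>n x. s n x + t n x})"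

definition D2_scale ::
  "real \<Rightarrow> (real^'n::finite) set \<Rightarrow> real \<Rightarrow> 'n D2_elem \<Rightarrow> 'n D2_elem" where
  "D2_scale \<alpha> \<Omega> c u = (\<Union>s\<in>u. D2_rel \<alpha> \<Omega> `` {\<lambda>n x. c * s n x})"

definition D2_norm :: "real \<Rightarrow> (real^'n::finite) set \<Rightarrow> 'n D2_elem \<Rightarrow> real" where
  "D2_norm \<alpha> \<Omega> u = (THE r. \<forall>s\<in>u. (\<lambda>n. norm2 \<alpha> \<Omega> (s n)) \<longlonglongrightarrow> r)"


(* Elements of the weighted Lebesgue space are handled through representatives; functions
   that agree almost everywhere on \<Omega> are to be identified. *)

definition Lw :: "real \<Rightarrow> real \<Rightarrow> (real^'n::finite) set \<Rightarrow> (real^'n \<Rightarrow> real) set" where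
  "Lw q l \<Omega> = {f \<in> borel_measurable (lebesgue_on \<Omega>).
     integrable (lebesgue_on \<Omega>) (\<lambda>x. (norm x powr (l / q) * \<bar>f x\<bar>) powr q)}"

definition Lw_norm :: "real \<Rightarrow> real \<Rightarrow> (real^'n::finite) set \<Rightarrow> (real^'n \<Rightarrow> real) \<Rightarrow> real" where
  "Lw_norm q l \<Omega> f = (LINT x|lebesgue_on \<Omega>. norm x powr l * \<bar>f x\<bar> powr q) powr (1 / q)"

(* The element-wise linear injection of the completion into the weighted Lebesgue space that
   extends the inclusion of the test functions (unique, up to null sets, once continuous). *)
definition D2_embedding ::
  "real \<Rightarrow> real \<Rightarrow> real \<Rightarrow> (real^'n::finite) set \<Rightarrow> ('n D2_elem \<Rightarrow> real^'n \<Rightarrow> real) \<Rightarrow> bool" where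
  "D2_embedding \<alpha> q l \<Omega> \<iota> \<longleftrightarrow>
     (\<forall>u\<in>D2 \<alpha> \<Omega>. \<iota> u \<in> Lw q l \<Omega>) \<and>
     (\<forall>\<phi>\<in>test_functions (\<Omega> - {0}). AE x in lebesgue_on \<Omega>. \<iota> (D2_of \<alpha> \<Omega> \<phi>) x = \<phi> x) \<and>
     (\<forall>u\<in>D2 \<alpha> \<Omega>. \<forall>v\<in>D2 \<alpha> \<Omega>. AE x in lebesgue_on \<Omega>. \<iota> (D2_add \<alpha> \<Omega> u v) x = \<iota> u x + \<iota> v x) \<and>
     (\<forall>c. \<forall>u\<in>D2 \<alpha> \<Omega>. AE x in lebesgue_on \<Omega>. \<iota> (D2_scale \<alpha> \<Omega> c u) x = c * \<iota> u x) \<and>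
     (\<forall>u\<in>D2 \<alpha> \<Omega>. \<forall>v\<in>D2 \<alpha> \<Omega>. (AE x in lebesgue_on \<Omega>. \<iota> u x = \<iota> v x) \<longrightarrow> u = v)"

definition continuous_embedding ::
  "real \<Rightarrow> real \<Rightarrow> real \<Rightarrow> (real^'n::finite) set \<Rightarrow> ('n D2_elem \<Rightarrow> real^'n \<Rightarrow> real) \<Rightarrow> bool" where
  "continuous_embedding \<alpha> q l \<Omega> \<iota> \<longleftrightarrow>
     D2_embedding \<alpha> q l \<Omega> \<iota> \<and>
     (\<exists>C. \<forall>u\<in>D2 \<alpha> \<Omega>. Lw_norm q l \<Omega> (\<iota> u) \<le> C * D2_norm \<alpha> \<Omega> u)"

definition compact_embedding ::
  "real \<Rightarrow> real \<Rightarrow> real \<Rightarrow> (real^'n::finite) set \<Rightarrow> ('n D2_elem \<Rightarrow> real^'n \<Rightarrow> real) \<Rightarrow> bool" where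
  "compact_embedding \<alpha> q l \<Omega> \<iota> \<longleftrightarrow>
     continuous_embedding \<alpha> q l \<Omega> \<iota> \<and>
     (\<forall>u. (\<forall>n. u n \<in> D2 \<alpha> \<Omega>) \<and> (\<exists>B. \<forall>n. D2_norm \<alpha> \<Omega> (u n) \<le> B) \<longrightarrow>
        (\<exists>r f. strict_mono (r :: nat \<Rightarrow> nat) \<and> f \<in> Lw q l \<Omega> \<and>
               (\<lambda>n. Lw_norm q l \<Omega> (\<lambda>x. \<iota> (u (r n)) x - f x)) \<longlonglongrightarrow> 0))"

end

theory Submission
  imports Defs "HOL-Complex_Analysis.Great_Picard" "HOL-Library.Diagonal_Subsequence"
begin

text \<open>
  Write \<open>N\<close> for the dimension. The proof inverts the Laplacian: a test function satisfies
  \<open>c \<phi>(x) = - \<integral> |x - y|^(2-N) \<Delta>\<phi>(y) dy\<close> with a constant \<open>c > 0\<close> (\<open>potential_representation\<close>), so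
  \<open>c |\<phi>|\<close> is at most \<open>T |\<Delta>\<phi>|\<close>, where \<open>T f (x) = \<integral> |x - y|^(2-N) f(y) dy\<close> is a positive operator. All
  estimates then concern \<open>T\<close>, for which no cancellation has to be tracked.

  The number \<open>p = p\<^sub>s + 1\<close> equals \<open>2 (N + l) / (N + \<alpha> - 4)\<close>, the exponent that scaling dictates, and the
  critical embedding is the Stein-Weiss inequality: \<open>\<integral> |x|^l (T f)^p\<close> is bounded as soon as
  \<open>\<integral> |x|^\<alpha> f^2 \<le> 1\<close> (\<open>stein_weiss_riesz2\<close>). Three facts give it. Schur's test with a power as
  auxiliary function yields the weighted Rellich inequality \<open>\<integral> |x|^(\<alpha>-4) (T f)^2 \<le> C \<integral> |x|^\<alpha> f^2\<close>; an
  admissible power exists exactly because \<open>4 - N < \<alpha> < N\<close>. The part of \<open>T f (x)\<close> coming from those \<open>y\<close>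
  whose norm is not comparable with \<open>|x|\<close> is at most a constant times \<open>|x|^((4-N-\<alpha>)/2)\<close>, by
  Cauchy-Schwarz; where it dominates, this pointwise bound reduces the power \<open>p\<close> to the power 2 of
  Rellich's inequality. Where the remaining part dominates, the weight \<open>|y|^(\<alpha>/2)\<close> may be
  replaced by \<open>|x|^(\<alpha>/2)\<close>, so the unweighted Hardy-Littlewood-Sobolev inequality from \<open>L^2\<close> to
  \<open>L^(2N/(N-4))\<close> applies, and interpolating it with Rellich's inequality reaches every exponent between
  2 and \<open>2N/(N-4)\<close>. That \<open>p\<close> lies in this range is what the hypotheses \<open>\<tau> > -4\<close> and
  \<open>\<alpha> \<ge> (N-4) \<tau> / 4\<close> say.

  For the completion, note that \<open>\<alpha> < N\<close> makes \<open>\<integral> |\<Delta>\<phi>|\<close> over the bounded set \<open>\<Omega>\<close> a quantity controlled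
  by the norm; hence so is \<open>\<integral> |\<phi>|\<close>. Every Cauchy sequence of test functions therefore converges in
  \<open>L^1(\<Omega>)\<close>, and sending a class to this limit is the embedding, the same one for all exponents. Fatou's lemma
  carries the estimates from test functions to limits. The map is injective because the norm is closable
  (\<open>norm2_closable\<close>): \<open>|x|^\<alpha> \<Delta>\<phi>\<close> is smooth with compact support away from the origin, so in the inner product
  of \<open>\<phi>\<close> with a sequence tending to 0 in \<open>L^1\<close> both derivatives can be moved off the sequence.

  For compactness, a sequence bounded in norm has Laplacians bounded in \<open>L^1\<close>. Smoothing the kernel of \<open>T\<close> gives
  operators that map such sequences to equicontinuous ones and that approximate \<open>T\<close> in the \<open>L^1\<close>
  operator norm, so the Arzela-Ascoli theorem and a diagonal argument yield a subsequence converging in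
  \<open>L^1\<close> (\<open>L1_compactness\<close>). Almost everywhere convergence of a further subsequence together with the bound at the
  critical exponent gives convergence at every smaller exponent (\<open>weighted_Lq_convergence\<close>).
\<close>

section \<open>Smooth functions on open sets\<close>

text \<open>The predicate \<open>C_k\<close> speaks of functions that are smooth on the whole space, which excludes the weight
  \<open>|x|^\<alpha>\<close>. This local version lets the weight be treated on the complement of the origin.\<close>

fun C_k_on :: "nat \<Rightarrow> (real^'n::finite) set \<Rightarrow> (real^'n \<Rightarrow> real) \<Rightarrow> bool" where
  "C_k_on 0 S f \<longleftrightarrow> continuous_on S f"
| "C_k_on (Suc k) S f \<longleftrightarrow>
     (\<forall>x\<in>S. f differentiable (at x)) \<and> (\<forall>i. C_k_on k S (partial_deriv i f))"

lemma C_k_on_UNIV: "C_k_on k UNIV f \<longleftrightarrow> C_k k f"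
  by (induction k arbitrary: f) auto

lemma partial_deriv_eqI:
  assumes "(f has_derivative f') (at x)" shows "partial_deriv i f x = f' (axis i 1)"
  using frechet_derivative_at[OF assms] by (simp add: partial_deriv_def)

lemma partial_deriv_cong:
  assumes "open S" "x \<in> S" "\<And>y. y \<in> S \<Longrightarrow> f y = g y"
  shows "partial_deriv i f x = partial_deriv i g x"
proof -
  have "(f has_derivative D) (at x) \<longleftrightarrow> (g has_derivative D) (at x)" for D
    using assms has_derivative_transform_within_open[of _ D x UNIV S] by (metis (no_types, lifting))
  then show ?thesis by (simp add: partial_deriv_def frechet_derivative_def)
qed

lemma differentiable_cong_open:
  assumes "open S" "x \<in> S" "\<And>y. y \<in> S \<Longrightarrow> f y = g y" "f differentiable (at x)"
  shows "g differentiable (at x)"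
  using assms has_derivative_transform_within_open[of f _ x UNIV S g]
  unfolding differentiable_def by blast

lemma C_k_on_cong:
  assumes "open S" "\<And>x. x \<in> S \<Longrightarrow> f x = g x" "C_k_on k S f"
  shows "C_k_on k S g"
  using assms(2,3)
proof (induction k arbitrary: f g)
  case 0
  then show ?case using continuous_on_cong[of S S f g] by simp
next
  case (Suc k)
  have "C_k_on k S (partial_deriv i g)" for i
  proof (rule Suc.IH[of "partial_deriv i f"])
    show "partial_deriv i f x = partial_deriv i g x" if "x \<in> S" for x
      using partial_deriv_cong[OF assms(1) that Suc.prems(1)] .
    show "C_k_on k S (partial_deriv i f)" using Suc.prems by simp
  qed
  then show ?case
    using Suc.prems differentiable_cong_open[OF assms(1) _ Suc.prems(1)] by auto
qed

lemma C_k_on_continuous: "C_k_on k S f \<Longrightarrow> open S \<Longrightarrow> continuous_on S f"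
  by (cases k) (auto intro!: continuous_at_imp_continuous_on differentiable_imp_continuous_within)

lemma C_k_on_Suc: "C_k_on (Suc k) S f \<Longrightarrow> open S \<Longrightarrow> C_k_on k S f"
proof (induction k arbitrary: f)
  case 0
  then show ?case using C_k_on_continuous by (auto simp del: C_k_on.simps(2))
next
  case (Suc k)
  then show ?case by simp
qed

lemma C_k_on_subset: "C_k_on k S f \<Longrightarrow> T \<subseteq> S \<Longrightarrow> C_k_on k T f"
  by (induction k arbitrary: f) (auto intro: continuous_on_subset)

text \<open>Smoothness is local; this glues the two descriptions of \<open>|x|^\<alpha> \<Delta>\<phi>\<close>, a product away from the origin
  and zero off the support of \<open>\<phi>\<close>.\<close>

lemma C_k_on_Un:
  "open S \<Longrightarrow> open T \<Longrightarrow> C_k_on k S f \<Longrightarrow> C_k_on k T f \<Longrightarrow> C_k_on k (S \<union> T) f"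
  by (induction k arbitrary: f) (auto intro: continuous_on_open_Un)

lemma partial_deriv_const: "partial_deriv i (\<lambda>_. c) = (\<lambda>_. 0)"
  by (rule ext, subst partial_deriv_eqI[where f'="\<lambda>_. 0"]) auto

lemma partial_deriv_coord: "partial_deriv i (\<lambda>x. x $ j - c) = (\<lambda>_. if i = j then 1 else 0)"
  by (rule ext, subst partial_deriv_eqI[where f'="\<lambda>h. h $ j"])
     (auto intro!: derivative_eq_intros simp: axis_def bounded_linear.has_derivative[OF bounded_linear_vec_nth])

lemma partial_deriv_add:
  assumes "f differentiable (at x)" "g differentiable (at x)"
  shows "partial_deriv i (\<lambda>x. f x + g x) x = partial_deriv i f x + partial_deriv i g x"
proof -
  obtain f' g' where *: "(f has_derivative f') (at x)" "(g has_derivative g') (at x)"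
    using assms unfolding differentiable_def by auto
  then have "((\<lambda>x. f x + g x) has_derivative (\<lambda>h. f' h + g' h)) (at x)"
    by (rule has_derivative_add)
  from partial_deriv_eqI[OF this] partial_deriv_eqI[OF *(1)] partial_deriv_eqI[OF *(2)]
  show ?thesis by simp
qed

lemma partial_deriv_mult:
  assumes "f differentiable (at x)" "g differentiable (at x)"
  shows "partial_deriv i (\<lambda>x. f x * g x) x = f x * partial_deriv i g x + partial_deriv i f x * g x"
proof -
  obtain f' g' where *: "(f has_derivative f') (at x)" "(g has_derivative g') (at x)"
    using assms unfolding differentiable_def by auto
  then have "((\<lambda>x. f x * g x) has_derivative (\<lambda>h. f x * g' h + f' h * g x)) (at x)"
    by (rule has_derivative_mult)
  from partial_deriv_eqI[OF this] partial_deriv_eqI[OF *(1)] partial_deriv_eqI[OF *(2)]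
  show ?thesis by simp
qed

lemma C_k_on_const: "C_k_on k S (\<lambda>_. c)"
  by (induction k arbitrary: c) (auto simp: partial_deriv_const)

lemma differentiable_coord: "(\<lambda>x::real^'n::finite. x $ j - c) differentiable (at x)"
  by (intro differentiable_diff differentiable_const linear_imp_differentiable
      bounded_linear.linear bounded_linear_vec_nth)

lemma C_k_on_coord: "C_k_on k S (\<lambda>x. x $ j - c)"
  by (cases k) (auto simp: partial_deriv_coord C_k_on_const differentiable_coord intro!: continuous_intros)

lemma C_k_on_add:
  assumes "open S" "C_k_on k S f" "C_k_on k S g"
  shows "C_k_on k S (\<lambda>x. f x + g x)"
  using assms(2,3)
proof (induction k arbitrary: f g)
  case 0
  then show ?case by (auto intro: continuous_on_add)
next
  case (Suc k)
  have "C_k_on k S (partial_deriv i (\<lambda>x. f x + g x))" for i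
    by (rule C_k_on_cong[OF assms(1), of "\<lambda>x. partial_deriv i f x + partial_deriv i g x"])
       (use Suc in \<open>auto simp: partial_deriv_add\<close>)
  then show ?case using Suc.prems by auto
qed

lemma C_k_on_mult:
  assumes "open S" "C_k_on k S f" "C_k_on k S g"
  shows "C_k_on k S (\<lambda>x. f x * g x)"
  using assms(2,3)
proof (induction k arbitrary: f g)
  case 0
  then show ?case by (auto intro: continuous_on_mult)
next
  case (Suc k)
  have "C_k_on k S (partial_deriv i (\<lambda>x. f x * g x))" for i
  proof (rule C_k_on_cong[OF assms(1), of "\<lambda>x. f x * partial_deriv i g x + partial_deriv i f x * g x"])
    show "f x * partial_deriv i g x + partial_deriv i f x * g x = partial_deriv i (\<lambda>x. f x * g x) x"
      if "x \<in> S" for x using Suc.prems that by (subst partial_deriv_mult) auto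
    have "C_k_on k S f" "C_k_on k S g" using Suc.prems C_k_on_Suc assms(1) by blast+
    then show "C_k_on k S (\<lambda>x. f x * partial_deriv i g x + partial_deriv i f x * g x)"
      using Suc.prems by (intro C_k_on_add assms Suc.IH) auto
  qed
  then show ?case using Suc.prems by auto
qed

lemma has_derivative_shifted_square:
  "((\<lambda>x. (x - a) \<bullet> (x - a) + d) has_derivative (\<lambda>h. 2 * ((x - a) \<bullet> h))) (at (x::real^'n::finite))"
  by (auto intro!: derivative_eq_intros simp: inner_commute)

lemma has_derivative_regularised_power:
  fixes x :: "real^'n::finite"
  assumes "0 < (x - a) \<bullet> (x - a) + d"
  shows "((\<lambda>x. ((x - a) \<bullet> (x - a) + d) powr b) has_derivative
     (\<lambda>h. 2 * ((x - a) \<bullet> h) * (b * ((x - a) \<bullet> (x - a) + d) powr (b - 1)))) (at x)"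
  using DERIV_compose_FDERIV[OF has_real_derivative_powr[OF assms] has_derivative_shifted_square]
  by simp

lemma partial_deriv_regularised_power:
  fixes x :: "real^'n::finite"
  assumes "0 < (x - a) \<bullet> (x - a) + d"
  shows "partial_deriv i (\<lambda>x. ((x - a) \<bullet> (x - a) + d) powr b) x
    = 2 * b * ((x $ i - a $ i) * ((x - a) \<bullet> (x - a) + d) powr (b - 1))"
  using partial_deriv_eqI[OF has_derivative_regularised_power[OF assms, of b], of i]
  by (simp add: inner_axis)

lemma open_regularised: "open {x::real^'n::finite. 0 < (x - a) \<bullet> (x - a) + d}"
  by (intro open_Collect_less continuous_intros)

text \<open>The case \<open>d = 0\<close> is the weight \<open>|x - a|^(2b)\<close> off the point \<open>a\<close>, the case \<open>d > 0\<close> a regularised Newtonian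
  kernel, smooth everywhere. The induction works because a partial derivative of such a power is a coordinate times a
  power of the same kind.\<close>

lemma C_k_on_regularised_power:
  fixes a :: "real^'n::finite"
  shows "C_k_on k {x. 0 < (x - a) \<bullet> (x - a) + d} (\<lambda>x. ((x - a) \<bullet> (x - a) + d) powr b)"
proof (induction k arbitrary: b)
  case 0
  show ?case by (auto intro!: continuous_intros)
next
  case (Suc k)
  let ?S = "{x. 0 < (x - a) \<bullet> (x - a) + d}"
  have "C_k_on k ?S (partial_deriv i (\<lambda>x. ((x - a) \<bullet> (x - a) + d) powr b))" for i
    by (rule C_k_on_cong[OF open_regularised,
          of _ _ "\<lambda>x. (2 * b) * ((x $ i - a $ i) * ((x - a) \<bullet> (x - a) + d) powr (b - 1))"])
       (auto simp: partial_deriv_regularised_power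
             intro!: C_k_on_mult C_k_on_const C_k_on_coord open_regularised Suc.IH)
  then show ?case using has_derivative_regularised_power[of _ a d b] unfolding C_k_on.simps differentiable_def by blast
qed

text \<open>For \<open>d = 0\<close> the function would be harmonic off \<open>a\<close>. With \<open>d > 0\<close> the Laplacian is, up to the sign, a positive bump
  which concentrates at \<open>a\<close> as \<open>d\<close> tends to 0 while its integral stays constant.\<close>

lemma laplacian_regularised_power:
  fixes x :: "real^'n::finite"
  assumes d: "0 < d" and b: "b = (2 - real CARD('n)) / 2"
  shows "laplacian (\<lambda>x. ((x - a) \<bullet> (x - a) + d) powr b) x
    = - real CARD('n) * (real CARD('n) - 2) * d * ((x - a) \<bullet> (x - a) + d) powr (b - 2)"
proof -
  let ?Q = "\<lambda>x::real^'n. (x - a) \<bullet> (x - a) + d"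
  have pos: "0 < ?Q x" for x using d by (simp add: add_nonneg_pos)
  have 1: "partial_deriv i (\<lambda>x. ?Q x powr b) = (\<lambda>x. 2 * b * ((x $ i - a $ i) * ?Q x powr (b - 1)))" for i
    by (rule ext) (rule partial_deriv_regularised_power[OF pos])
  have diff: "(\<lambda>x. ?Q x powr c) differentiable (at x)" for c x
    using has_derivative_regularised_power[OF pos] by (auto simp: differentiable_def)
  have coord: "(\<lambda>x::real^'n. x $ i - a $ i) differentiable (at x)" for i x
    by (rule differentiable_coord)
  have 2: "partial_deriv i (partial_deriv i (\<lambda>x. ?Q x powr b)) x
    = 2 * b * ?Q x powr (b - 1) + 4 * b * (b - 1) * (x $ i - a $ i)\<^sup>2 * ?Q x powr (b - 2)" for i x
  proof -
    have "partial_deriv i (\<lambda>x. 2 * b * ((x $ i - a $ i) * ?Q x powr (b - 1))) x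
      = 2 * b * partial_deriv i (\<lambda>x. (x $ i - a $ i) * ?Q x powr (b - 1)) x"
      using coord diff by (subst partial_deriv_mult) (auto simp: partial_deriv_const intro!: differentiable_mult)
    also have "partial_deriv i (\<lambda>x. (x $ i - a $ i) * ?Q x powr (b - 1)) x
       = (x $ i - a $ i) * (2 * (b - 1) * ((x $ i - a $ i) * ?Q x powr (b - 2))) + ?Q x powr (b - 1)"
      using partial_deriv_regularised_power[OF pos, where i=i and b="b - 1" and x=x] coord diff
      by (subst partial_deriv_mult) (auto simp: partial_deriv_coord)
    finally show ?thesis unfolding 1 by (simp add: power2_eq_square algebra_simps)
  qed
  have "laplacian (\<lambda>x. ?Q x powr b) x = real CARD('n) * (2 * b * ?Q x powr (b - 1))
     + 4 * b * (b - 1) * (\<Sum>i\<in>UNIV. (x $ i - a $ i)\<^sup>2) * ?Q x powr (b - 2)"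
    unfolding laplacian_def 2 by (simp add: sum.distrib sum_distrib_left sum_distrib_right)
  also have "(\<Sum>i\<in>UNIV. (x $ i - a $ i)\<^sup>2) = ?Q x - d"
    by (simp add: inner_vec_def power2_eq_square)
  also have "?Q x powr (b - 1) = ?Q x * ?Q x powr (b - 2)"
    using pos[of x] powr_add[of "?Q x" 1 "b - 2"] by simp
  finally have lap: "laplacian (\<lambda>x. ?Q x powr b) x = real CARD('n) * (2 * b * (?Q x * ?Q x powr (b - 2)))
     + 4 * b * (b - 1) * (?Q x - d) * ?Q x powr (b - 2)" .
  have *: "n * (2 * b * (q * w)) + 4 * b * (b - 1) * (q - d) * w = - n * (n - 2) * d * w"
    if "b = (2 - n) / 2" for n q w :: real
    unfolding that by (simp add: field_split_simps)
  show ?thesis unfolding lap by (rule *[OF b])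
qed

section \<open>Integration by parts and Green's identity\<close>

lemma vanishing_partial_deriv:
  assumes "compact (K :: (real^'n::finite) set)" "\<And>x. x \<notin> K \<Longrightarrow> f x = 0" "x \<notin> K"
  shows "partial_deriv i f x = 0"
  using partial_deriv_cong[of "- K" x f "\<lambda>_. 0" i] assms
  by (simp add: partial_deriv_const open_Compl compact_imp_closed)

lemma compactly_supported_integrable:
  assumes "compact (K :: (real^'n::finite) set)" "\<And>x. x \<notin> K \<Longrightarrow> f x = 0" "continuous_on UNIV f"
  shows "integrable lborel (f :: _ \<Rightarrow> real)"
proof -
  have "integrable lborel (\<lambda>x. indicator K x *\<^sub>R f x)"
    by (rule borel_integrable_compact[OF assms(1) continuous_on_subset[OF assms(3) subset_UNIV]])
  also have "(\<lambda>x. indicator K x *\<^sub>R f x) = f" using assms by (auto simp: indicator_def fun_eq_iff)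
  finally show ?thesis .
qed

lemma compactly_supported_bounded:
  assumes "compact (K :: (real^'n::finite) set)" "\<And>x. x \<notin> K \<Longrightarrow> f x = 0" "continuous_on UNIV f"
  obtains B where "B > 0" "\<And>x. \<bar>f x :: real\<bar> \<le> B"
proof -
  have "bounded (f ` K)"
    using assms by (intro compact_imp_bounded compact_continuous_image) (auto intro: continuous_on_subset)
  then obtain B where "B > 0" "\<And>x. x \<in> K \<Longrightarrow> \<bar>f x\<bar> \<le> B"
    by (auto simp: bounded_pos)
  then have "\<bar>f x\<bar> \<le> B" for x using assms(2)[of x] by (cases "x \<in> K") auto
  with \<open>B > 0\<close> show ?thesis by (rule that)
qed

lemma has_real_derivative_along_axis:
  assumes "F differentiable (at (x + t *\<^sub>R axis i 1))"
  shows "((\<lambda>t. F (x + t *\<^sub>R axis i 1)) has_real_derivative partial_deriv i F (x + t *\<^sub>R axis i 1)) (at t)"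
proof -
  let ?F' = "frechet_derivative F (at (x + t *\<^sub>R axis i 1))"
  have F: "(F has_derivative ?F') (at (x + t *\<^sub>R axis i 1))"
    using assms by (simp add: frechet_derivative_works)
  have g: "((\<lambda>t. x + t *\<^sub>R axis i 1) has_derivative (\<lambda>h. h *\<^sub>R axis i 1)) (at t)"
    by (auto intro!: derivative_eq_intros)
  have "?F' (h *\<^sub>R axis i 1) = h * partial_deriv i F (x + t *\<^sub>R axis i 1)" for h
    using linear_scale[OF has_derivative_linear[OF F]] by (simp add: partial_deriv_def)
  then show ?thesis
    using has_derivative_compose[OF g F] by (simp add: has_field_derivative_def mult_commute_abs)
qed


lemma nn_integral_lborel_affine:
  fixes t :: "'a::euclidean_space"
  assumes [measurable]: "f \<in> borel_measurable borel" and c: "c \<noteq> 0"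
  shows "(\<integral>\<^sup>+x. f x \<partial>lborel) = ennreal (\<bar>c\<bar> ^ DIM('a)) * (\<integral>\<^sup>+x. f (t + c *\<^sub>R x) \<partial>lborel)"
  by (subst lborel_affine[OF c, of t])
     (simp add: nn_integral_density nn_integral_distr nn_integral_cmult)

lemma integral_lborel_affine:
  fixes t :: "'a::euclidean_space" and f :: "'a \<Rightarrow> real"
  assumes [measurable]: "f \<in> borel_measurable borel" and c: "c \<noteq> 0"
  shows "(\<integral>x. f x \<partial>lborel) = \<bar>c\<bar> ^ DIM('a) * (\<integral>x. f (t + c *\<^sub>R x) \<partial>lborel)"
  by (subst lborel_affine[OF c, of t])
     (simp add: integral_density integral_distr)

lemma integrable_lborel_affine:
  fixes t :: "'a::euclidean_space" and f :: "'a \<Rightarrow> real"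
  assumes f: "integrable lborel f" and c: "c \<noteq> 0"
  shows "integrable lborel (\<lambda>x. f (t + c *\<^sub>R x))"
proof -
  have [measurable]: "f \<in> borel_measurable borel" using borel_measurable_integrable[OF f] by simp
  show ?thesis
    using f unfolding integrable_iff_bounded
    by (subst (asm) nn_integral_lborel_affine[where c=c and t=t])
       (use c in \<open>auto simp: ennreal_mult_less_top\<close>)
qed

text \<open>The integral of a translate of \<open>F\<close> does not depend on the translation, so difference quotients of \<open>F\<close> have
  integral 0, and dominated convergence passes to the derivative. This avoids iterated integration in
  coordinates.\<close>

lemma integral_partial_deriv_eq_0:
  fixes F :: "real^'n::finite \<Rightarrow> real"
  assumes F: "C_k (Suc 0) F" and K: "compact K" "\<And>x. x \<notin> K \<Longrightarrow> F x = 0"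
  shows "(\<integral>x. partial_deriv i F x \<partial>lborel) = 0"
proof -
  let ?e = "axis i 1 :: real^'n"
  let ?D = "partial_deriv i F"
  define h :: "nat \<Rightarrow> real" where "h n = inverse (real (Suc n))" for n
  have h: "0 < h n" "h n \<le> 1" for n by (auto simp: h_def field_simps)
  have hlim: "h \<longlonglongrightarrow> 0" unfolding h_def by (rule LIMSEQ_inverse_real_of_nat)
  have contF: "continuous_on UNIV F" and diff: "F differentiable (at x)"
    and contD: "continuous_on UNIV ?D" for x
    using F by (auto intro!: continuous_at_imp_continuous_on differentiable_imp_continuous_within)
  have D0: "?D x = 0" if "x \<notin> K" for x using vanishing_partial_deriv[OF K that] .
  have [measurable]: "F \<in> borel_measurable borel" "?D \<in> borel_measurable borel"
    using contF contD by (auto intro: borel_measurable_continuous_onI)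
  obtain B where B: "B > 0" "\<And>x. \<bar>?D x\<bar> \<le> B"
    using compactly_supported_bounded[OF K(1) D0 contD] by metis
  obtain R where R: "\<And>x. x \<in> K \<Longrightarrow> norm x \<le> R"
    using compact_imp_bounded[OF K(1)] by (auto simp: bounded_iff)
  define q where "q n x = (F (x + h n *\<^sub>R ?e) - F x) / h n" for n x
  have intF: "integrable lborel F" by (rule compactly_supported_integrable[OF K contF])
  have shift: "integrable lborel (\<lambda>x. F (x + h n *\<^sub>R ?e))"
    "(\<integral>x. F (x + h n *\<^sub>R ?e) \<partial>lborel) = (\<integral>x. F x \<partial>lborel)" for n
    using integrable_lborel_affine[OF intF, of 1 "h n *\<^sub>R ?e"]
      integral_lborel_affine[of F 1 "h n *\<^sub>R ?e"] by (simp_all add: add.commute)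
  have q0: "(\<integral>x. q n x \<partial>lborel) = 0" for n
    unfolding q_def using shift intF by (simp add: Bochner_Integration.integral_diff)
  \<comment> \<open>by the mean value theorem the difference quotients are bounded, and they vanish away from the support\<close>
  have slope: "\<exists>z. 0 < z \<and> z < h n \<and> q n x = ?D (x + z *\<^sub>R ?e)" for n x
  proof -
    have der: "((\<lambda>t. F (x + t *\<^sub>R ?e)) has_real_derivative ?D (x + t *\<^sub>R ?e)) (at t)" for t
      by (rule has_real_derivative_along_axis[OF diff])
    obtain l z where z: "0 < z" "z < h n" "DERIV (\<lambda>t. F (x + t *\<^sub>R ?e)) z :> l"
      "F (x + h n *\<^sub>R ?e) - F (x + 0 *\<^sub>R ?e) = (h n - 0) * l"
      using MVT[of 0 "h n" "\<lambda>t. F (x + t *\<^sub>R ?e)"] der h(1)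
      by (meson DERIV_isCont continuous_at_imp_continuous_on real_differentiable_def)
    have "l = ?D (x + z *\<^sub>R ?e)" using DERIV_unique[OF z(3) der] .
    then show ?thesis using z h(1)[of n] by (intro exI[of _ z]) (auto simp: q_def)
  qed
  have "(\<lambda>n. \<integral>x. q n x \<partial>lborel) \<longlonglongrightarrow> (\<integral>x. ?D x \<partial>lborel)"
  proof (rule integral_dominated_convergence)
    show "?D \<in> borel_measurable lborel" "q n \<in> borel_measurable lborel" for n
      unfolding q_def by measurable
    show "integrable lborel (\<lambda>x::real^'n. B * indicator (cball 0 (R + 1)) x)"
      by (intro integrable_mult_right integrable_real_indicator)
         (use emeasure_bounded_finite[OF bounded_cball, of "0::real^'n" "R + 1"] in auto)
    show "AE x in lborel. (\<lambda>n. q n x) \<longlonglongrightarrow> ?D x"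
    proof (rule AE_I2)
      fix x
      obtain z where z: "\<And>n. 0 < z n" "\<And>n. z n < h n" "\<And>n. q n x = ?D (x + z n *\<^sub>R ?e)"
        using slope[of _ x] by metis
      have "z \<longlonglongrightarrow> 0"
        by (rule tendsto_sandwich[OF _ _ tendsto_const hlim]) (auto intro!: always_eventually less_imp_le z)
      then have "(\<lambda>n. x + z n *\<^sub>R ?e) \<longlonglongrightarrow> x + 0 *\<^sub>R ?e" by (intro tendsto_intros)
      then have "(\<lambda>n. ?D (x + z n *\<^sub>R ?e)) \<longlonglongrightarrow> ?D x"
        using contD by (auto simp: continuous_on_eq_continuous_at intro: isCont_tendsto_compose)
      then show "(\<lambda>n. q n x) \<longlonglongrightarrow> ?D x" by (simp add: z(3))
    qed
    show "AE x in lborel. norm (q n x) \<le> B * indicator (cball 0 (R + 1)) x" for n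
    proof (rule AE_I2)
      fix x
      obtain z where z: "0 < z" "z < h n" "q n x = ?D (x + z *\<^sub>R ?e)" using slope by blast
      show "norm (q n x) \<le> B * indicator (cball 0 (R + 1)) x"
      proof (cases "x \<in> cball 0 (R + 1)")
        case False
        have "norm x \<le> norm (x + z *\<^sub>R ?e) + norm (z *\<^sub>R ?e)"
          using norm_triangle_ineq4[of "x + z *\<^sub>R ?e" "z *\<^sub>R ?e"] by simp
        moreover have "norm (z *\<^sub>R ?e) \<le> 1" using z h(2)[of n] by simp
        ultimately have "x + z *\<^sub>R ?e \<notin> K" using False R[of "x + z *\<^sub>R ?e"] by auto
        then show ?thesis using D0 z False by simp
      qed (use z B in auto)
    qed
  qed
  then show ?thesis unfolding q0 by (simp add: LIMSEQ_const_iff)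
qed

lemma green_identity:
  fixes \<phi> w :: "real^'n::finite \<Rightarrow> real"
  assumes \<phi>: "C_k 2 \<phi>" and w: "C_k 2 w" and K: "compact K" "\<And>x. x \<notin> K \<Longrightarrow> \<phi> x = 0"
  shows "(\<integral>x. w x * laplacian \<phi> x \<partial>lborel) = (\<integral>x. laplacian w x * \<phi> x \<partial>lborel)"
proof -
  have C1: "C_k (Suc 0) u" "C_k (Suc 0) (partial_deriv i u)" "continuous_on UNIV u"
    "continuous_on UNIV (partial_deriv i u)" "continuous_on UNIV (partial_deriv i (partial_deriv i u))"
    "u differentiable (at x)" "partial_deriv i u differentiable (at x)"
    if "C_k 2 u" for u :: "real^'n \<Rightarrow> real" and i x
  proof -
    have *: "C_k_on (Suc (Suc 0)) UNIV u" using that by (simp add: C_k_on_UNIV numeral_2_eq_2)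
    show "C_k (Suc 0) u" using C_k_on_Suc[OF *] by (simp add: C_k_on_UNIV)
    show "C_k (Suc 0) (partial_deriv i u)" using * by (simp add: C_k_on_UNIV)
    show "continuous_on UNIV u" using C_k_on_continuous[OF *] by simp
    show "continuous_on UNIV (partial_deriv i u)"
      using * by (auto intro!: continuous_at_imp_continuous_on differentiable_imp_continuous_within)
    show "continuous_on UNIV (partial_deriv i (partial_deriv i u))"
      "u differentiable (at x)" "partial_deriv i u differentiable (at x)" using * by auto
  qed
  have d0: "partial_deriv i \<phi> x = 0" if "x \<notin> K" for i x using vanishing_partial_deriv[OF K that] .
  have dd0: "partial_deriv i (partial_deriv i \<phi>) x = 0" if "x \<notin> K" for i x
    using vanishing_partial_deriv[OF K(1) d0 that] .
  have int: "integrable lborel (\<lambda>x. w x * partial_deriv i (partial_deriv i \<phi>) x)"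
     "integrable lborel (\<lambda>x. partial_deriv i w x * partial_deriv i \<phi> x)"
     "integrable lborel (\<lambda>x. partial_deriv i (partial_deriv i w) x * \<phi> x)" for i
    by (rule compactly_supported_integrable[OF K(1)];
        auto intro!: continuous_on_mult C1[OF \<phi>] C1[OF w] simp: dd0 d0 K(2))+
  have parts: "(\<integral>x. w x * partial_deriv i (partial_deriv i \<phi>) x \<partial>lborel)
    = (\<integral>x. partial_deriv i (partial_deriv i w) x * \<phi> x \<partial>lborel)" for i
  proof -
    have "C_k (Suc 0) (\<lambda>x. w x * partial_deriv i \<phi> x)" "C_k (Suc 0) (\<lambda>x. partial_deriv i w x * \<phi> x)"
      unfolding C_k_on_UNIV[symmetric]
      by (rule C_k_on_mult; simp only: C_k_on_UNIV C1[OF \<phi>] C1[OF w] open_UNIV)+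
    from integral_partial_deriv_eq_0[OF this(1) K(1), of i] integral_partial_deriv_eq_0[OF this(2) K(1), of i]
    have "(\<integral>x. partial_deriv i (\<lambda>x. w x * partial_deriv i \<phi> x) x \<partial>lborel) = 0"
      "(\<integral>x. partial_deriv i (\<lambda>x. partial_deriv i w x * \<phi> x) x \<partial>lborel) = 0" by (simp_all add: d0 K(2))
    then show ?thesis
      using int by (simp add: partial_deriv_mult C1[OF \<phi>] C1[OF w])
  qed
  have "(\<integral>x. w x * laplacian \<phi> x \<partial>lborel) = (\<Sum>i\<in>UNIV. \<integral>x. w x * partial_deriv i (partial_deriv i \<phi>) x \<partial>lborel)"
    unfolding laplacian_def sum_distrib_left by (rule Bochner_Integration.integral_sum) (rule int)
  also have "\<dots> = (\<Sum>i\<in>UNIV. \<integral>x. partial_deriv i (partial_deriv i w) x * \<phi> x \<partial>lborel)"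
    unfolding parts ..
  also have "\<dots> = (\<integral>x. laplacian w x * \<phi> x \<partial>lborel)"
    unfolding laplacian_def sum_distrib_right by (rule Bochner_Integration.integral_sum[symmetric]) (rule int)
  finally show ?thesis .
qed

section \<open>Integrals of powers of the norm\<close>

text \<open>Over a shell on which the norm is comparable with \<open>\<rho>\<close>, the integral of \<open>|x|^a\<close> is at most a constant times
  \<open>\<rho>^(a+N)\<close>. Over a set covered by shells whose radii form a geometric progression the bounds sum to a geometric
  series. The progression decreases for integrals over balls and increases for integrals over their
  complements.\<close>

lemma nn_integral_norm_powr_dyadic:
  fixes A :: "(real^'n::finite) set"
  assumes b: "b > 0" "b powr (a + real CARD('n)) < 1" and r: "r > 0" and [measurable]: "A \<in> sets borel"
    and cover: "\<And>x. x \<in> A \<Longrightarrow> x \<noteq> 0 \<Longrightarrow> \<exists>k. r * b ^ k / 2 \<le> norm x \<and> norm x < r * b ^ k"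
  shows "(\<integral>\<^sup>+x. ennreal (norm x powr a) * indicator A x \<partial>lborel)
    \<le> ennreal (max 1 (2 powr - a) * unit_ball_vol (real CARD('n)) / (1 - b powr (a + real CARD('n))) * r powr (a + real CARD('n)))"
proof -
  let ?N = "real CARD('n)"
  define M where "M = max 1 (2 powr - a)"
  define \<omega> where "\<omega> = unit_ball_vol ?N"
  define \<theta> where "\<theta> = b powr (a + ?N)"
  have M: "M \<ge> 0" and \<omega>: "\<omega> \<ge> 0" and \<theta>: "0 \<le> \<theta>" "\<theta> < 1"
    using b by (auto simp: M_def \<omega>_def \<theta>_def)
  define \<rho> where "\<rho> k = r * b ^ k" for k
  have \<rho>: "\<rho> k > 0" for k using b r by (simp add: \<rho>_def)
  have shell: "norm x powr a \<le> M * \<rho> k powr a" if "\<rho> k / 2 \<le> norm x" "norm x < \<rho> k" for x :: "real^'n" and k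
  proof (cases "a \<ge> 0")
    case True
    then have "norm x powr a \<le> 1 * \<rho> k powr a" using that by (auto intro: powr_mono2)
    also have "\<dots> \<le> M * \<rho> k powr a" by (intro mult_right_mono) (auto simp: M_def)
    finally show ?thesis .
  next
    case False
    then have "norm x powr a \<le> (\<rho> k / 2) powr a" using that \<rho>[of k] by (intro powr_mono2') auto
    also have "\<dots> = 2 powr - a * \<rho> k powr a" 
      unfolding powr_divide powr_minus by (rule trans[OF divide_inverse mult.commute])
    also have "\<dots> \<le> M * \<rho> k powr a" by (intro mult_right_mono) (auto simp: M_def)
    finally show ?thesis .
  qed
  have "(\<integral>\<^sup>+x. ennreal (norm x powr a) * indicator A x \<partial>lborel)
    \<le> (\<integral>\<^sup>+x. (\<Sum>k. ennreal (M * \<rho> k powr a) * indicator (ball 0 (\<rho> k)) (x::real^'n)) \<partial>lborel)"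
  proof (rule nn_integral_mono)
    fix x :: "real^'n"
    show "ennreal (norm x powr a) * indicator A x
       \<le> (\<Sum>k. ennreal (M * \<rho> k powr a) * indicator (ball 0 (\<rho> k)) x)"
    proof (cases "x \<in> A \<and> x \<noteq> 0")
      case True
      then obtain k where k: "\<rho> k / 2 \<le> norm x" "norm x < \<rho> k" using cover unfolding \<rho>_def by blast
      have "ennreal (norm x powr a) * indicator A x
         \<le> ennreal (M * \<rho> k powr a) * indicator (ball 0 (\<rho> k)) x"
        using True k shell[OF k] by (auto simp: indicator_def intro: ennreal_leI)
      also have "\<dots> \<le> (\<Sum>k. ennreal (M * \<rho> k powr a) * indicator (ball 0 (\<rho> k)) x)"
      proof -
        have "f k \<le> suminf f" for f :: "nat \<Rightarrow> ennreal"
          using sum_le_suminf[OF summableI, of "{k}" f] by simp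
        then show ?thesis .
      qed
      finally show ?thesis .
    qed (auto simp: indicator_def)
  qed
  also have "\<dots> = (\<Sum>k. \<integral>\<^sup>+x. ennreal (M * \<rho> k powr a) * indicator (ball 0 (\<rho> k)) (x::real^'n) \<partial>lborel)"
    
    by (intro nn_integral_suminf borel_measurable_times_ennreal borel_measurable_const borel_measurable_indicator) simp
  also have "\<dots> = (\<Sum>k. ennreal (M * \<omega> * r powr (a + ?N) * \<theta> ^ k))"
  proof (rule suminf_cong)
    fix k
    have "(\<integral>\<^sup>+x. ennreal (M * \<rho> k powr a) * indicator (ball 0 (\<rho> k)) (x::real^'n) \<partial>lborel)
      = ennreal (M * \<rho> k powr a) * ennreal (\<omega> * \<rho> k ^ CARD('n))"
      using \<rho>[of k] emeasure_ball[of "\<rho> k" "0::real^'n"] by (simp add: nn_integral_cmult_indicator \<omega>_def)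
    also have "\<dots> = ennreal (M * \<rho> k powr a * (\<omega> * \<rho> k ^ CARD('n)))"
      using M by (subst ennreal_mult'[symmetric]) (auto simp: mult_nonneg_nonneg)
    also have "\<rho> k ^ CARD('n) = \<rho> k powr ?N" using \<rho>[of k] by (simp add: powr_realpow)
    also have "M * \<rho> k powr a * (\<omega> * \<rho> k powr ?N) = M * \<omega> * \<rho> k powr (a + ?N)"
      by (simp add: powr_add)
    also have "\<rho> k powr (a + ?N) = r powr (a + ?N) * \<theta> ^ k"
    proof -
      have "(b ^ k) powr c = (b powr c) ^ k" for c
        using b(1) by (induction k) (auto simp: powr_mult)
      then show ?thesis using r b by (simp add: \<rho>_def \<theta>_def powr_mult)
    qed
    finally show "(\<integral>\<^sup>+x. ennreal (M * \<rho> k powr a) * indicator (ball 0 (\<rho> k)) (x::real^'n) \<partial>lborel)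
      = ennreal (M * \<omega> * r powr (a + ?N) * \<theta> ^ k)" by (simp add: mult.assoc)
  qed
  also have "\<dots> = ennreal (\<Sum>k. M * \<omega> * r powr (a + ?N) * \<theta> ^ k)"
    using \<theta> M \<omega> by (intro suminf_ennreal2 summable_mult summable_geometric) auto
  also have "(\<Sum>k. M * \<omega> * r powr (a + ?N) * \<theta> ^ k) = M * \<omega> * r powr (a + ?N) * (1 / (1 - \<theta>))"
    using \<theta> by (subst suminf_mult) (auto simp: suminf_geometric intro: summable_geometric)
  finally show ?thesis by (simp only: M_def \<omega>_def \<theta>_def times_divide_eq_right times_divide_eq_left mult_1_right)
qed

lemma nn_integral_norm_powr_ball:
  assumes a: "a > - real CARD('n::finite)"
  obtains C where "C \<ge> 0" "\<And>r. r > 0 \<Longrightarrow>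
    (\<integral>\<^sup>+x. ennreal (norm x powr a) * indicator (ball 0 r) (x::real^'n) \<partial>lborel)
     \<le> ennreal (C * r powr (a + real CARD('n)))"
proof
  let ?N = "real CARD('n)"
  have \<theta>: "(1/2) powr (a + ?N) < 1" using a powr_less_mono'[of "1/2" 0 "a + ?N"] by simp
  show "0 \<le> max 1 (2 powr - a) * unit_ball_vol ?N / (1 - (1/2) powr (a + ?N))"
    using \<theta> by (intro divide_nonneg_nonneg mult_nonneg_nonneg) auto
  fix r :: real assume r: "r > 0"
  show "(\<integral>\<^sup>+x. ennreal (norm x powr a) * indicator (ball 0 r) (x::real^'n) \<partial>lborel)
     \<le> ennreal (max 1 (2 powr - a) * unit_ball_vol ?N / (1 - (1/2) powr (a + ?N)) * r powr (a + ?N))"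
  proof (rule nn_integral_norm_powr_dyadic)
    fix x :: "real^'n" assume x: "x \<in> ball 0 r" "x \<noteq> 0"
    obtain n where n: "(1/2) ^ n < norm x / r"
      using real_arch_pow_inv[of "norm x / r" "1/2"] x r by auto
    \<comment> \<open>the outermost shell whose inner radius does not exceed the norm of \<open>x\<close>\<close>
    define k where "k = (LEAST k. r * (1/2) ^ k / 2 \<le> norm x)"
    have "r * (1/2) ^ n / 2 \<le> norm x"
      using n r by (simp add: field_simps)
    then have k1: "r * (1/2) ^ k / 2 \<le> norm x" unfolding k_def by (rule LeastI)
    have "norm x < r * (1/2) ^ k"
    proof (cases k)
      case (Suc j)
      then have "\<not> r * (1/2) ^ j / 2 \<le> norm x"
        using not_less_Least[of j "\<lambda>k. r * (1/2) ^ k / 2 \<le> norm x"] k_def by linarith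
      then show ?thesis using Suc by simp
    qed (use x in auto)
    with k1 show "\<exists>k. r * (1/2) ^ k / 2 \<le> norm x \<and> norm x < r * (1/2) ^ k" by blast
  qed (use \<theta> r in auto)
qed

lemma nn_integral_norm_powr_outside_ball:
  assumes a: "a < - real CARD('n::finite)"
  obtains C where "C \<ge> 0" "\<And>r. r > 0 \<Longrightarrow>
    (\<integral>\<^sup>+x. ennreal (norm x powr a) * indicator (- ball 0 r) (x::real^'n) \<partial>lborel)
     \<le> ennreal (C * r powr (a + real CARD('n)))"
proof
  let ?N = "real CARD('n)"
  let ?C = "max 1 (2 powr - a) * unit_ball_vol ?N / (1 - 2 powr (a + ?N))"
  have \<theta>: "2 powr (a + ?N) < 1" using a powr_less_mono[of "a + ?N" 0 2] by simp
  show "0 \<le> ?C * 2 powr (a + ?N)"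
    using \<theta> by (intro divide_nonneg_nonneg mult_nonneg_nonneg) auto
  fix r :: real assume r: "r > 0"
  have "(\<integral>\<^sup>+x. ennreal (norm x powr a) * indicator (- ball 0 r) (x::real^'n) \<partial>lborel)
     \<le> ennreal (?C * (2 * r) powr (a + ?N))"
  proof (rule nn_integral_norm_powr_dyadic)
    fix x :: "real^'n" assume x: "x \<in> - ball 0 r" "x \<noteq> 0"
    obtain n where n: "norm x / r < 2 ^ n"
      using real_arch_pow[of 2 "norm x / r"] by auto
    \<comment> \<open>the radii start with \<open>2 * r\<close>, so that the first shell begins at \<open>r\<close>\<close>
    define k where "k = (LEAST k. norm x < 2 * r * 2 ^ k)"
    have "norm x < r * 2 ^ n" using n r by (simp add: field_simps)
    also have "\<dots> \<le> 2 * r * 2 ^ n" using r by simp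
    finally have k1: "norm x < 2 * r * 2 ^ k" unfolding k_def by (rule LeastI)
    have "2 * r * 2 ^ k / 2 \<le> norm x"
    proof (cases k)
      case (Suc j)
      then have "\<not> norm x < 2 * r * 2 ^ j"
        using not_less_Least[of j "\<lambda>k. norm x < 2 * r * 2 ^ k"] k_def by linarith
      then show ?thesis using Suc by simp
    qed (use x in auto)
    with k1 show "\<exists>k. 2 * r * 2 ^ k / 2 \<le> norm x \<and> norm x < 2 * r * 2 ^ k" by blast
  qed (use \<theta> r in auto)
  then show "(\<integral>\<^sup>+x. ennreal (norm x powr a) * indicator (- ball 0 r) (x::real^'n) \<partial>lborel)
     \<le> ennreal (?C * 2 powr (a + ?N) * r powr (a + ?N))"
    using r by (simp add: powr_mult mult.assoc)
qed

section \<open>The Riesz potential of order two and the weighted Rellich inequality\<close>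

text \<open>Up to a constant factor this is the Newtonian potential of \<open>f\<close>, with values in the extended reals so that no
  integrability has to be discussed.\<close>

definition riesz2 :: "(real^'n::finite \<Rightarrow> real) \<Rightarrow> real^'n \<Rightarrow> ennreal" where
  "riesz2 f x = (\<integral>\<^sup>+y. ennreal (norm (x - y) powr (2 - real CARD('n)) * f y) \<partial>lborel)"

text \<open>The estimates below are stated for a real function \<open>u\<close> below the potential of \<open>f\<close>, which allows real powers of \<open>u\<close>
  although the potential itself may be infinite.\<close>

definition riesz2_majorised :: "(real^'n::finite \<Rightarrow> real) \<Rightarrow> (real^'n \<Rightarrow> real) \<Rightarrow> bool" where
  "riesz2_majorised u f \<longleftrightarrow> u \<in> borel_measurable borel \<and> f \<in> borel_measurable borel \<and>
     (\<forall>x. 0 \<le> u x \<and> 0 \<le> f x \<and> ennreal (u x) \<le> riesz2 f x)"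

lemma riesz2_majorisedD:
  assumes "riesz2_majorised u f"
  shows "u \<in> borel_measurable borel" "f \<in> borel_measurable borel" "0 \<le> u x" "0 \<le> f x"
    "ennreal (u x) \<le> riesz2 f x"
  using assms by (auto simp: riesz2_majorised_def)

lemma nn_integral_lborel_reflect:
  fixes x :: "'a::euclidean_space"
  assumes [measurable]: "f \<in> borel_measurable borel"
  shows "(\<integral>\<^sup>+y. f (x - y) \<partial>lborel) = (\<integral>\<^sup>+y. f y \<partial>lborel)"
  using nn_integral_lborel_affine[OF assms, of "-1" x] by simp

lemma nn_integral_lborel_swap:
  assumes [measurable]: "case_prod f \<in> borel_measurable (borel \<Otimes>\<^sub>M borel)"
  shows "(\<integral>\<^sup>+x. (\<integral>\<^sup>+y. f x y \<partial>lborel) \<partial>lborel) = (\<integral>\<^sup>+y. (\<integral>\<^sup>+x. f x y \<partial>lborel) \<partial>lborel)"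
  by (rule lborel_pair.Fubini') measurable

lemma ennreal_le_sqrt_if_square_le:
  fixes F :: ennreal
  assumes "F\<^sup>2 \<le> ennreal a" "a \<ge> 0" shows "F \<le> ennreal (sqrt a)"
proof (cases F)
  case (real r)
  then have "r\<^sup>2 \<le> a" using assms by (simp add: ennreal_power)
  then have "r \<le> sqrt a" by (simp add: real_le_rsqrt)
  with real show ?thesis by (simp add: ennreal_leI)
qed (use assms in \<open>auto simp: power2_eq_square ennreal_top_mult top_unique\<close>)

text \<open>By scaling the integral must be a multiple of \<open>|x|^(2-s)\<close>; the content is its finiteness. The three dangerous places
  are \<open>y = 0\<close>, which needs \<open>s < N\<close>, the diagonal \<open>y = x\<close>, where the kernel is always integrable, and
  infinity, which needs \<open>s > 2\<close>.\<close>

lemma nn_integral_riesz2_kernel_powr: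
  assumes s: "2 < s" "s < real CARD('n::finite)"
  obtains C where "C \<ge> 0" "\<And>x::real^'n. x \<noteq> 0 \<Longrightarrow>
    (\<integral>\<^sup>+y. ennreal (norm (x - y) powr (2 - real CARD('n)) * norm y powr - s) \<partial>lborel)
      \<le> ennreal (C * norm x powr (2 - s))"
proof -
  let ?N = "real CARD('n)"
  obtain C1 where C1: "C1 \<ge> 0" "\<And>r. r > 0 \<Longrightarrow>
    (\<integral>\<^sup>+x. ennreal (norm x powr - s) * indicator (ball 0 r) (x::real^'n) \<partial>lborel) \<le> ennreal (C1 * r powr (- s + ?N))"
    using nn_integral_norm_powr_ball[where 'n='n and a="- s"] s by auto
  obtain C2 where C2: "C2 \<ge> 0" "\<And>r. r > 0 \<Longrightarrow>
    (\<integral>\<^sup>+x. ennreal (norm x powr (2 - ?N)) * indicator (ball 0 r) (x::real^'n) \<partial>lborel) \<le> ennreal (C2 * r powr (2 - ?N + ?N))"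
    using nn_integral_norm_powr_ball[where 'n='n and a="2 - ?N"] by auto
  obtain C3 where C3: "C3 \<ge> 0" "\<And>r. r > 0 \<Longrightarrow>
    (\<integral>\<^sup>+x. ennreal (norm x powr (2 - ?N - s)) * indicator (- ball 0 r) (x::real^'n) \<partial>lborel) \<le> ennreal (C3 * r powr (2 - ?N - s + ?N))"
    using nn_integral_norm_powr_outside_ball[where 'n='n and a="2 - ?N - s"] s by auto
  define C where "C = (C1 + C2 + 3 powr (?N - 2) * C3) * (1/2) powr (2 - s)"
  show ?thesis
  proof
    show "C \<ge> 0" using C1 C2 C3 by (simp add: C_def)
    fix x :: "real^'n" assume x: "x \<noteq> 0"
    define R where "R = norm x / 2"
    have R: "R > 0" using x by (simp add: R_def)
    define f1 where "f1 y = ennreal (norm y powr - s) * indicator (ball 0 R) y" for y :: "real^'n"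
    define f2 where "f2 y = ennreal (norm y powr (2 - ?N)) * indicator (ball 0 R) y" for y :: "real^'n"
    define f3 where "f3 y = ennreal (norm y powr (2 - ?N - s)) * indicator (- ball 0 R) y" for y :: "real^'n"
    have [measurable]: "f1 \<in> borel_measurable borel" "f2 \<in> borel_measurable borel" "f3 \<in> borel_measurable borel"
      unfolding f1_def f2_def f3_def by (intro borel_measurable_times_ennreal borel_measurable_indicator; simp)+
    have pw: "ennreal (norm (x - y) powr (2 - ?N) * norm y powr - s)
      \<le> ennreal (R powr (2 - ?N)) * f1 y + ennreal (R powr - s) * f2 (x - y) + ennreal (3 powr (?N - 2)) * f3 y" for y
    proof -
      have tri: "2 * R \<le> norm (x - y) + norm y"
        using norm_triangle_ineq[of "x - y" y] by (simp add: R_def)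
      \<comment> \<open>near the origin, near the diagonal, and far from both, where \<open>|y| \<le> 3 |x - y|\<close>\<close>
      consider "norm y < R" | "norm (x - y) < R" | "norm y \<ge> R" "norm (x - y) \<ge> R" by linarith
      then show ?thesis
      proof cases
        case 1
        then have "norm (x - y) powr (2 - ?N) \<le> R powr (2 - ?N)"
          using tri R s by (intro powr_mono2') auto
        then have "ennreal (norm (x - y) powr (2 - ?N) * norm y powr - s) \<le> ennreal (R powr (2 - ?N)) * f1 y"
          using 1 by (simp add: f1_def ennreal_mult'[symmetric] ennreal_leI mult_right_mono)
        then show ?thesis by (simp add: add_increasing2 add.assoc)
      next
        case 2
        then have "norm y powr - s \<le> R powr - s"
          using tri R s by (intro powr_mono2') auto
        then have "norm (x - y) powr (2 - ?N) * norm y powr - s \<le> R powr - s * norm (x - y) powr (2 - ?N)"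
          by (simp add: mult.commute mult_right_mono)
        then have "ennreal (norm (x - y) powr (2 - ?N) * norm y powr - s) \<le> ennreal (R powr - s) * f2 (x - y)"
          using 2 by (simp add: f2_def ennreal_mult'[symmetric] ennreal_leI)
        then show ?thesis by (metis add_increasing add_increasing2 zero_le)
      next
        case 3
        then have "norm y \<le> 3 * norm (x - y)"
          using norm_triangle_ineq3[of x "x - y"] norm_triangle_ineq[of "y - x" x] by (simp add: R_def norm_minus_commute)
        then have "norm (x - y) powr (2 - ?N) \<le> (norm y / 3) powr (2 - ?N)"
          using 3 R s by (intro powr_mono2') auto
        also have "\<dots> = 3 powr (?N - 2) * norm y powr (2 - ?N)"
          unfolding powr_divide using powr_minus_divide[of 3 "?N - 2"] by simp
        finally have "norm (x - y) powr (2 - ?N) * norm y powr - s \<le> 3 powr (?N - 2) * norm y powr (2 - ?N) * norm y powr - s"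
          by (intro mult_right_mono) auto
        also have "\<dots> = 3 powr (?N - 2) * norm y powr (2 - ?N - s)"
          unfolding mult.assoc powr_add[symmetric] by simp
        finally have "ennreal (norm (x - y) powr (2 - ?N) * norm y powr - s) \<le> ennreal (3 powr (?N - 2)) * f3 y"
          using 3 by (simp add: f3_def ennreal_mult'[symmetric] ennreal_leI)
        then show ?thesis by (simp add: add_increasing)
      qed
    qed
    have "(\<integral>\<^sup>+y. ennreal (norm (x - y) powr (2 - ?N) * norm y powr - s) \<partial>lborel)
       \<le> (\<integral>\<^sup>+y. ennreal (R powr (2 - ?N)) * f1 y + ennreal (R powr - s) * f2 (x - y) + ennreal (3 powr (?N - 2)) * f3 y \<partial>lborel)"
      by (intro nn_integral_mono pw)
    also have "\<dots> = ennreal (R powr (2 - ?N)) * integral\<^sup>N lborel f1 + ennreal (R powr - s) * (\<integral>\<^sup>+y. f2 (x - y) \<partial>lborel)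
       + ennreal (3 powr (?N - 2)) * integral\<^sup>N lborel f3"
      by (simp add: nn_integral_add nn_integral_cmult)
    also have "(\<integral>\<^sup>+y. f2 (x - y) \<partial>lborel) = integral\<^sup>N lborel f2"
      by (rule nn_integral_lborel_reflect) measurable
    also have "ennreal (R powr (2 - ?N)) * integral\<^sup>N lborel f1 + ennreal (R powr - s) * integral\<^sup>N lborel f2
       + ennreal (3 powr (?N - 2)) * integral\<^sup>N lborel f3
       \<le> ennreal (R powr (2 - ?N)) * ennreal (C1 * R powr (- s + ?N)) + ennreal (R powr - s) * ennreal (C2 * R powr (2 - ?N + ?N))
        + ennreal (3 powr (?N - 2)) * ennreal (C3 * R powr (2 - ?N - s + ?N))"
      unfolding f1_def f2_def f3_def by (intro add_mono mult_left_mono C1 C2 C3 R) auto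
    also have "\<dots> = ennreal (R powr (2 - ?N) * (C1 * R powr (- s + ?N)) + R powr - s * (C2 * R powr (2 - ?N + ?N))
        + 3 powr (?N - 2) * (C3 * R powr (2 - ?N - s + ?N)))"
      using C1 C2 C3 by (simp add: ennreal_mult'[symmetric] ennreal_plus[symmetric] del: ennreal_plus)
    also have "R powr (2 - ?N) * (C1 * R powr (- s + ?N)) + R powr - s * (C2 * R powr (2 - ?N + ?N))
        + 3 powr (?N - 2) * (C3 * R powr (2 - ?N - s + ?N)) = (C1 + C2 + 3 powr (?N - 2) * C3) * R powr (2 - s)"
    proof -
      have "R powr (2 - ?N) * R powr (- s + ?N) = R powr (2 - s)" "R powr - s * R powr (2 - ?N + ?N) = R powr (2 - s)"
        "R powr (2 - ?N - s + ?N) = R powr (2 - s)"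
        unfolding powr_add[symmetric] by simp_all
      then show ?thesis by (simp add: algebra_simps)
    qed
    also have "\<dots> = C * norm x powr (2 - s)"
      unfolding C_def R_def using powr_mult[of "1/2" "norm x" "2 - s"] by simp
    finally show "(\<integral>\<^sup>+y. ennreal (norm (x - y) powr (2 - ?N) * norm y powr - s) \<partial>lborel)
      \<le> ennreal (C * norm x powr (2 - s))" .
  qed
qed

lemma riesz2_measurable [measurable]:
  fixes f :: "real^'n::finite \<Rightarrow> real"
  assumes [measurable]: "f \<in> borel_measurable borel"
  shows "riesz2 f \<in> borel_measurable borel"
  unfolding riesz2_def by measurable

text \<open>Schur's test: Cauchy-Schwarz with the splitting \<open>1 = |y|^(-s/2) |y|^(s/2)\<close> bounds \<open>(T f)^2\<close> by \<open>C |x|^(2-s)\<close> times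
  \<open>T (|y|^s f^2)\<close>, and integrating against \<open>|x|^(\<alpha>-4)\<close> lets the kernel act on the power
  \<open>|x|^(-(s+2-\<alpha>))\<close>. Both applications of the kernel require their exponents, \<open>s\<close> and \<open>s + 2 - \<alpha>\<close>, to lie
  strictly between 2 and \<open>N\<close>.\<close>

lemma weighted_rellich:
  fixes \<alpha> :: real
  assumes N: "real CARD('n::finite) > 2" and \<alpha>: "4 - real CARD('n) < \<alpha>" "\<alpha> < real CARD('n)"
  obtains C where "C \<ge> 0" "\<And>f u :: real^'n \<Rightarrow> real. riesz2_majorised u f \<Longrightarrow>
     (\<integral>\<^sup>+x. ennreal (norm x powr (\<alpha> - 4) * (u x)\<^sup>2) \<partial>lborel) \<le> ennreal C * (\<integral>\<^sup>+x. ennreal (norm x powr \<alpha> * (f x)\<^sup>2) \<partial>lborel)"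
proof -
  let ?N = "real CARD('n)"
  \<comment> \<open>both exponents must lie between 2 and \<open>N\<close>; the four conditions on \<open>s\<close> are compatible because \<open>4 - N < \<alpha> < N\<close>\<close>
  obtain s where s: "max 2 \<alpha> < s" "s < min ?N (?N + \<alpha> - 2)"
    using dense[of "max 2 \<alpha>" "min ?N (?N + \<alpha> - 2)"] N \<alpha> by auto
  define \<sigma> where "\<sigma> = s + 2 - \<alpha>"
  have \<sigma>: "2 < \<sigma>" "\<sigma> < ?N" using s by (auto simp: \<sigma>_def)
  obtain C1 where C1: "C1 \<ge> 0" "\<And>x::real^'n. x \<noteq> 0 \<Longrightarrow>
    (\<integral>\<^sup>+y. ennreal (norm (x - y) powr (2 - ?N) * norm y powr - s) \<partial>lborel) \<le> ennreal (C1 * norm x powr (2 - s))"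
    using nn_integral_riesz2_kernel_powr[where 'n='n and s=s] s by auto
  obtain C2 where C2: "C2 \<ge> 0" "\<And>x::real^'n. x \<noteq> 0 \<Longrightarrow>
    (\<integral>\<^sup>+y. ennreal (norm (x - y) powr (2 - ?N) * norm y powr - \<sigma>) \<partial>lborel) \<le> ennreal (C2 * norm x powr (2 - \<sigma>))"
    using nn_integral_riesz2_kernel_powr[where 'n='n and s=\<sigma>] \<sigma> by auto
  show ?thesis
  proof
    show "C1 * C2 \<ge> 0" using C1 C2 by simp
    fix f u :: "real^'n \<Rightarrow> real" assume maj: "riesz2_majorised u f"
    note [measurable] = riesz2_majorisedD(1,2)[OF maj]
    note u = riesz2_majorisedD(3)[OF maj] and f = riesz2_majorisedD(4)[OF maj] and le = riesz2_majorisedD(5)[OF maj]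
    let ?k = "\<lambda>x y::real^'n. norm (x - y) powr (2 - ?N)"
    have ae0: "AE x in lborel. x \<noteq> (0::real^'n)"
      by (rule AE_I[of _ _ "{0}"]) auto
    have schur: "ennreal (norm x powr (\<alpha> - 4) * (u x)\<^sup>2)
      \<le> (\<integral>\<^sup>+y. ennreal C1 * ennreal (?k x y * norm x powr - \<sigma> * (norm y powr s * (f y)\<^sup>2)) \<partial>lborel)"
      if x: "x \<noteq> 0" for x
    proof -
      let ?g = "\<lambda>y. sqrt (?k x y * norm y powr - s)" and ?h = "\<lambda>y. sqrt (?k x y * norm y powr s) * f y"
      have "riesz2 f x = (\<integral>\<^sup>+y. ennreal (?g y) * ennreal (?h y) \<partial>lborel)"
        unfolding riesz2_def
      proof (rule nn_integral_cong_AE, use ae0 in eventually_elim)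
        fix y :: "real^'n" assume y: "y \<noteq> 0"
        have "?g y * ?h y = sqrt ((?k x y)\<^sup>2 * (norm y powr - s * norm y powr s)) * f y"
          by (simp add: real_sqrt_mult[symmetric] power2_eq_square mult_ac)
        also have "norm y powr - s * norm y powr s = 1" using y unfolding powr_add[symmetric] by simp
        finally have "?g y * ?h y = ?k x y * f y"
          by (simp only: mult_1_right real_sqrt_abs abs_of_nonneg[OF powr_ge_zero])
        from this[symmetric] show "ennreal (?k x y * f y) = ennreal (?g y) * ennreal (?h y)"
          using f by (simp only:) (rule ennreal_mult; simp)
      qed
      then have "(riesz2 f x)\<^sup>2 \<le> (\<integral>\<^sup>+y. ennreal (?g y)^2 \<partial>lborel) * (\<integral>\<^sup>+y. ennreal (?h y)^2 \<partial>lborel)"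
        by (simp only:) (rule Cauchy_Schwarz_nn_integral; measurable)
      also have "(\<integral>\<^sup>+y. ennreal (?g y)^2 \<partial>lborel) \<le> ennreal (C1 * norm x powr (2 - s))"
        using C1(2)[OF x] by (simp add: ennreal_power)
      also have "(\<integral>\<^sup>+y. ennreal (?h y)^2 \<partial>lborel) = (\<integral>\<^sup>+y. ennreal (?k x y * (norm y powr s * (f y)\<^sup>2)) \<partial>lborel)"
        using f by (simp add: ennreal_power power_mult_distrib mult.assoc)
      finally have R2: "(riesz2 f x)\<^sup>2 \<le> ennreal (C1 * norm x powr (2 - s)) * (\<integral>\<^sup>+y. ennreal (?k x y * (norm y powr s * (f y)\<^sup>2)) \<partial>lborel)"
        by (simp add: mult_right_mono)
      have "ennreal (norm x powr (\<alpha> - 4) * (u x)\<^sup>2) = ennreal (norm x powr (\<alpha> - 4)) * (ennreal (u x))\<^sup>2"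
        using u by (simp add: ennreal_mult' ennreal_power)
      also have "\<dots> \<le> ennreal (norm x powr (\<alpha> - 4)) * (riesz2 f x)\<^sup>2"
        using le by (intro mult_left_mono power_mono) auto
      also have "\<dots> \<le> ennreal (norm x powr (\<alpha> - 4)) * (ennreal (C1 * norm x powr (2 - s)) * (\<integral>\<^sup>+y. ennreal (?k x y * (norm y powr s * (f y)\<^sup>2)) \<partial>lborel))"
        by (intro mult_left_mono R2) auto
      also have "\<dots> = ennreal C1 * (ennreal (norm x powr (\<alpha> - 4) * norm x powr (2 - s)) * (\<integral>\<^sup>+y. ennreal (?k x y * (norm y powr s * (f y)\<^sup>2)) \<partial>lborel))"
        using C1(1) by (simp add: ennreal_mult' mult_ac)
      also have "norm x powr (\<alpha> - 4) * norm x powr (2 - s) = norm x powr - \<sigma>"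
        unfolding powr_add[symmetric] by (simp add: \<sigma>_def algebra_simps)
      also have "ennreal C1 * (ennreal (norm x powr - \<sigma>) * (\<integral>\<^sup>+y. ennreal (?k x y * (norm y powr s * (f y)\<^sup>2)) \<partial>lborel))
        = (\<integral>\<^sup>+y. ennreal C1 * ennreal (?k x y * norm x powr - \<sigma> * (norm y powr s * (f y)\<^sup>2)) \<partial>lborel)"
        by (subst nn_integral_cmult[symmetric], measurable, subst nn_integral_cmult[symmetric], measurable)
           (simp add: ennreal_mult' mult_ac)
      finally show ?thesis .
    qed
    have "(\<integral>\<^sup>+x. ennreal (norm x powr (\<alpha> - 4) * (u x)\<^sup>2) \<partial>lborel)
      \<le> (\<integral>\<^sup>+x. (\<integral>\<^sup>+y. ennreal C1 * ennreal (?k x y * norm x powr - \<sigma> * (norm y powr s * (f y)\<^sup>2)) \<partial>lborel) \<partial>lborel)"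
      using ae0 by (intro nn_integral_mono_AE) (auto elim!: eventually_mono dest: schur)
    also have "\<dots> = (\<integral>\<^sup>+y. (\<integral>\<^sup>+x. ennreal C1 * ennreal (?k x y * norm x powr - \<sigma> * (norm y powr s * (f y)\<^sup>2)) \<partial>lborel) \<partial>lborel)"
      by (rule nn_integral_lborel_swap) measurable
    also have "\<dots> \<le> (\<integral>\<^sup>+y. ennreal (C1 * C2) * ennreal (norm y powr \<alpha> * (f y)\<^sup>2) \<partial>lborel)"
    proof (rule nn_integral_mono_AE, use ae0 in eventually_elim)
      fix y :: "real^'n" assume y: "y \<noteq> 0"
      have "(\<integral>\<^sup>+x. ennreal C1 * ennreal (?k x y * norm x powr - \<sigma> * (norm y powr s * (f y)\<^sup>2)) \<partial>lborel)
        = ennreal C1 * ennreal (norm y powr s * (f y)\<^sup>2) * (\<integral>\<^sup>+x. ennreal (?k y x * norm x powr - \<sigma>) \<partial>lborel)"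
        by (subst nn_integral_cmult[symmetric], measurable)
           (simp add: ennreal_mult' mult_ac norm_minus_commute)
      also have "\<dots> \<le> ennreal C1 * ennreal (norm y powr s * (f y)\<^sup>2) * ennreal (C2 * norm y powr (2 - \<sigma>))"
        by (intro mult_left_mono C2 y) auto
      also have "\<dots> = ennreal (C1 * C2) * ennreal ((norm y powr s * norm y powr (2 - \<sigma>)) * (f y)\<^sup>2)"
        using C1(1) C2(1) by (simp add: ennreal_mult'[symmetric] mult_ac)
      also have "norm y powr s * norm y powr (2 - \<sigma>) = norm y powr \<alpha>"
        unfolding powr_add[symmetric] by (simp add: \<sigma>_def)
      finally show "(\<integral>\<^sup>+x. ennreal C1 * ennreal (?k x y * norm x powr - \<sigma> * (norm y powr s * (f y)\<^sup>2)) \<partial>lborel)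
        \<le> ennreal (C1 * C2) * ennreal (norm y powr \<alpha> * (f y)\<^sup>2)" .
    qed
    also have "\<dots> = ennreal (C1 * C2) * (\<integral>\<^sup>+y. ennreal (norm y powr \<alpha> * (f y)\<^sup>2) \<partial>lborel)"
      by (rule nn_integral_cmult) measurable
    finally show "(\<integral>\<^sup>+x. ennreal (norm x powr (\<alpha> - 4) * (u x)\<^sup>2) \<partial>lborel)
      \<le> ennreal (C1 * C2) * (\<integral>\<^sup>+x. ennreal (norm x powr \<alpha> * (f x)\<^sup>2) \<partial>lborel)" .
  qed
qed

section \<open>The Hardy-Littlewood-Sobolev inequality\<close>

text \<open>Cut the kernel at a radius \<open>R\<close>. Cauchy-Schwarz bounds the outer part by a multiple of \<open>R^((4-N)/2)\<close>, since \<open>N > 4\<close>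
  makes the square of the kernel integrable at infinity; the inner part applied to the values \<open>g \<le> t\<close> is at most a
  multiple of \<open>t R^2\<close>. With \<open>R\<close> and \<open>t\<close> chosen such that both are a third of the level \<open>\<mu>\<close>, only the inner
  part applied to the values \<open>g > t\<close> can make up the rest, and Markov's inequality measures the set where it does. The
  threshold \<open>t\<close> comes out as \<open>c \<mu>^p\<close> with \<open>p = N / (N - 4)\<close>, so the estimate for \<open>h^p\<close> has the form known from the
  Hardy-Littlewood maximal function.\<close>

lemma riesz2_weak_estimate:
  fixes p :: real
  assumes N: "real CARD('n::finite) > 4" and p: "p = real CARD('n) / (real CARD('n) - 4)"
  obtains c where "c > 0" "\<And>(g :: real^'n \<Rightarrow> real) h \<mu>. riesz2_majorised h g \<Longrightarrow> (\<integral>\<^sup>+x. ennreal ((g x)\<^sup>2) \<partial>lborel) \<le> 1 \<Longrightarrow> 0 < \<mu> \<Longrightarrow>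
     emeasure lborel {x. \<mu> \<le> h x}
       \<le> ennreal (1 / (c * \<mu> powr p)) * (\<integral>\<^sup>+x. ennreal (g x) * indicator {c * \<mu> powr p<..} (g x) \<partial>lborel)"
proof -
  let ?N = "real CARD('n)"
  obtain A0 where A0: "A0 \<ge> 0" "\<And>r. r > 0 \<Longrightarrow>
    (\<integral>\<^sup>+x. ennreal (norm x powr (4 - 2 * ?N)) * indicator (- ball 0 r) (x::real^'n) \<partial>lborel) \<le> ennreal (A0 * r powr (4 - 2 * ?N + ?N))"
    using nn_integral_norm_powr_outside_ball[where 'n='n and a="4 - 2 * ?N"] N by auto
  obtain B0 where B0: "B0 \<ge> 0" "\<And>r. r > 0 \<Longrightarrow>
    (\<integral>\<^sup>+x. ennreal (norm x powr (2 - ?N)) * indicator (ball 0 r) (x::real^'n) \<partial>lborel) \<le> ennreal (B0 * r powr (2 - ?N + ?N))"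
    using nn_integral_norm_powr_ball[where 'n='n and a="2 - ?N"] by auto
  \<comment> \<open>adding 1 makes the constants positive, so that they may be divided by\<close>
  define A where "A = A0 + 1"
  define B where "B = B0 + 1"
  have A: "A > 0" and B: "B > 0" using A0 B0 by (auto simp: A_def B_def)
  \<comment> \<open>the radius \<open>R\<close> is determined by \<open>sqrt A * R^((4-N)/2) = \<mu> / 3\<close>, hence this exponent\<close>
  define e where "e = - (2 / (?N - 4))"
  define c where "c = (3 * sqrt A) powr (2 * e) / (3 * B)"
  show ?thesis
  proof
    show "c > 0" using A B by (simp add: c_def)
    fix g h :: "real^'n \<Rightarrow> real" and \<mu> :: real
    assume maj: "riesz2_majorised h g" and g2: "(\<integral>\<^sup>+x. ennreal ((g x)\<^sup>2) \<partial>lborel) \<le> 1" and \<mu>: "0 < \<mu>"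
    note [measurable] = riesz2_majorisedD(1,2)[OF maj]
    note g = riesz2_majorisedD(4)[OF maj] and le = riesz2_majorisedD(5)[OF maj]
    define R where "R = (\<mu> / (3 * sqrt A)) powr e"
    \<comment> \<open>chosen so that the values \<open>g \<le> t\<close> contribute at most \<open>B * R^2 * t = \<mu> / 3\<close>\<close>
    define t where "t = \<mu> / (3 * (B * R\<^sup>2))"
    have R: "R > 0" using A \<mu> by (simp add: R_def)
    have t: "t > 0" using \<mu> R B by (simp add: t_def)
    have R_far: "sqrt (A * R powr (4 - 2 * ?N + ?N)) = \<mu> / 3"
    proof -
      have "R powr (4 - 2 * ?N + ?N) = (\<mu> / (3 * sqrt A)) powr (e * (4 - 2 * ?N + ?N))"
        unfolding R_def powr_powr ..
      also have "e * (4 - 2 * ?N + ?N) = 2" using N by (simp add: e_def field_simps)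
      also have "(\<mu> / (3 * sqrt A)) powr 2 = (\<mu> / (3 * sqrt A))\<^sup>2" using A \<mu> by (simp add: powr_numeral)
      also have "\<dots> = (\<mu> / 3)\<^sup>2 / A" using A by (simp add: power_divide power_mult_distrib)
      finally show ?thesis using A \<mu> by simp
    qed
    have t_eq: "t = c * \<mu> powr p"
    proof -
      have "R\<^sup>2 = R powr 2" using R by (simp add: powr_numeral)
      also have "\<dots> = (\<mu> / (3 * sqrt A)) powr (2 * e)" unfolding R_def powr_powr by (simp add: mult.commute)
      also have "\<dots> = \<mu> powr (2 * e) / (3 * sqrt A) powr (2 * e)" by (rule powr_divide)
      finally have "t = \<mu> / \<mu> powr (2 * e) * c" using B by (simp add: t_def c_def)
      also have "\<mu> / \<mu> powr (2 * e) = \<mu> powr (1 - 2 * e)" using \<mu> powr_diff[of \<mu> 1 "2 * e"] by simp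
      also have "1 - 2 * e = p" using N by (simp add: e_def p field_simps)
      finally show ?thesis by simp
    qed
    define K1 where "K1 z = ennreal (norm z powr (2 - ?N)) * indicator (ball 0 R) z" for z :: "real^'n"
    define K2 where "K2 z = ennreal (norm z powr (2 - ?N)) * indicator (- ball 0 R) z" for z :: "real^'n"
    have [measurable]: "K1 \<in> borel_measurable borel" "K2 \<in> borel_measurable borel"
      unfolding K1_def K2_def by (intro borel_measurable_times_ennreal borel_measurable_indicator; simp)+
    have K1: "(\<integral>\<^sup>+y. K1 (x - y) \<partial>lborel) \<le> ennreal (B * R\<^sup>2)" for x
    proof -
      have "(\<integral>\<^sup>+y. K1 (x - y) \<partial>lborel) \<le> ennreal (B0 * R powr (2 - ?N + ?N))"
        by (subst nn_integral_lborel_reflect, measurable) (use B0(2)[OF R] in \<open>simp add: K1_def[abs_def]\<close>)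
      also have "\<dots> \<le> ennreal (B * R\<^sup>2)" using R by (intro ennreal_leI) (auto simp: B_def powr_numeral mult_right_mono)
      finally show ?thesis .
    qed
    define big where "big y = ennreal (g y) * indicator {t<..} (g y)" for y
    have [measurable]: "big \<in> borel_measurable borel" unfolding big_def by measurable
    define F where "F x = (\<integral>\<^sup>+y. K2 (x - y) * ennreal (g y) \<partial>lborel)" for x
    define G where "G x = (\<integral>\<^sup>+y. K1 (x - y) * ennreal t \<partial>lborel)" for x
    define H where "H x = (\<integral>\<^sup>+y. K1 (x - y) * big y \<partial>lborel)" for x
    have [measurable]: "H \<in> borel_measurable borel" unfolding H_def by measurable
    have split: "riesz2 g x \<le> F x + G x + H x" for x
    proof -
      have "riesz2 g x \<le> (\<integral>\<^sup>+y. K2 (x - y) * ennreal (g y) + K1 (x - y) * ennreal t + K1 (x - y) * big y \<partial>lborel)"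
        unfolding riesz2_def
      proof (rule nn_integral_mono)
        fix y
        show "ennreal (norm (x - y) powr (2 - ?N) * g y) \<le> K2 (x - y) * ennreal (g y) + K1 (x - y) * ennreal t + K1 (x - y) * big y"
        proof (cases "x - y \<in> ball 0 R")
          case True
          then have K: "ennreal (norm (x - y) powr (2 - ?N) * g y) = K1 (x - y) * ennreal (g y)"
            using g[of y] by (simp add: K1_def ennreal_mult')
          have "ennreal (g y) \<le> ennreal t + big y"
            by (auto simp: big_def indicator_def intro: ennreal_leI)
          then have "K1 (x - y) * ennreal (g y) \<le> K1 (x - y) * ennreal t + K1 (x - y) * big y"
            by (metis mult_left_mono distrib_left zero_le)
          then show ?thesis unfolding K by (simp add: add.assoc add_increasing)
        next
          case False
          then have "ennreal (norm (x - y) powr (2 - ?N) * g y) = K2 (x - y) * ennreal (g y)"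
            using g[of y] by (simp add: K2_def ennreal_mult' indicator_def)
          then show ?thesis by (simp add: add.assoc add_increasing2)
        qed
      qed
      also have "\<dots> = F x + G x + H x"
        unfolding F_def G_def H_def by (simp add: nn_integral_add)
      finally show ?thesis .
    qed
    have F: "F x \<le> ennreal (\<mu> / 3)" for x
    proof -
      have "(F x)\<^sup>2 \<le> (\<integral>\<^sup>+y. (K2 (x - y))\<^sup>2 \<partial>lborel) * (\<integral>\<^sup>+y. (ennreal (g y))\<^sup>2 \<partial>lborel)"
        unfolding F_def by (rule Cauchy_Schwarz_nn_integral) measurable
      also have "\<dots> \<le> (\<integral>\<^sup>+y. (K2 (x - y))\<^sup>2 \<partial>lborel) * 1"
        using g2 g by (intro mult_left_mono) (auto simp: ennreal_power)
      also have "(\<integral>\<^sup>+y. (K2 (x - y))\<^sup>2 \<partial>lborel) = (\<integral>\<^sup>+y. (K2 y)\<^sup>2 \<partial>lborel)"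
        by (rule nn_integral_lborel_reflect) measurable
      also have "(\<lambda>y. (K2 y)\<^sup>2) = (\<lambda>z. ennreal (norm z powr (4 - 2 * ?N)) * indicator (- ball 0 R) z)"
      proof
        fix z :: "real^'n"
        have "(norm z powr (2 - ?N))\<^sup>2 = norm z powr (4 - 2 * ?N)"
          unfolding power2_eq_square powr_add[symmetric] by simp
        then show "(K2 z)\<^sup>2 = ennreal (norm z powr (4 - 2 * ?N)) * indicator (- ball 0 R) z"
          by (auto simp: K2_def power_mult_distrib ennreal_power indicator_def)
      qed
      also have "(\<integral>\<^sup>+z. ennreal (norm z powr (4 - 2 * ?N)) * indicator (- ball 0 R) (z::real^'n) \<partial>lborel) * 1
         \<le> ennreal (A * R powr (4 - 2 * ?N + ?N))"
      proof -
        have "A0 * R powr (4 - 2 * ?N + ?N) \<le> A * R powr (4 - 2 * ?N + ?N)"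
          by (intro mult_right_mono) (auto simp: A_def)
        then show ?thesis using A0(2)[OF R] order_trans[OF _ ennreal_leI] by simp
      qed
      finally have "F x \<le> ennreal (sqrt (A * R powr (4 - 2 * ?N + ?N)))"
        using A by (intro ennreal_le_sqrt_if_square_le) auto
      then show ?thesis unfolding R_far .
    qed
    have G: "G x \<le> ennreal (\<mu> / 3)" for x
    proof -
      have "G x = (\<integral>\<^sup>+y. K1 (x - y) \<partial>lborel) * ennreal t" unfolding G_def by (rule nn_integral_multc) measurable
      also have "\<dots> \<le> ennreal (B * R\<^sup>2) * ennreal t" by (intro mult_right_mono K1) auto
      also have "\<dots> = ennreal (B * R\<^sup>2 * t)" using B by (simp add: ennreal_mult')
      also have "B * R\<^sup>2 * t = \<mu> / 3" using B R by (simp add: t_def)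
      finally show ?thesis .
    qed
    have sub: "{x. \<mu> \<le> h x} \<subseteq> {x\<in>space lborel. 1 \<le> ennreal (3 / \<mu>) * H x}"
    proof safe
      fix x assume "\<mu> \<le> h x"
      then have "ennreal \<mu> \<le> riesz2 g x" using le[of x] by (meson ennreal_leI order_trans)
      also have "\<dots> \<le> F x + G x + H x" by (rule split)
      also have "\<dots> \<le> ennreal (\<mu> / 3) + ennreal (\<mu> / 3) + H x" by (intro add_mono F G order_refl)
      finally have *: "ennreal \<mu> \<le> ennreal (\<mu> / 3) + ennreal (\<mu> / 3) + H x" .
      have "ennreal (\<mu> / 3) \<le> H x"
      proof (cases "H x")
        case (real r)
        then have "\<mu> \<le> \<mu> / 3 + \<mu> / 3 + r" using * \<mu> by (simp add: ennreal_plus[symmetric] del: ennreal_plus)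
        then show ?thesis using real by (auto intro: ennreal_leI)
      qed auto
      then have "ennreal (3 / \<mu>) * ennreal (\<mu> / 3) \<le> ennreal (3 / \<mu>) * H x" by (intro mult_left_mono) auto
      then show "1 \<le> ennreal (3 / \<mu>) * H x" using \<mu> by (simp add: ennreal_mult'[symmetric])
    qed auto
    have "emeasure lborel {x. \<mu> \<le> h x} \<le> emeasure lborel {x\<in>space lborel. 1 \<le> ennreal (3 / \<mu>) * H x}"
      by (rule emeasure_mono[OF sub]) measurable
    also have "\<dots> \<le> ennreal (3 / \<mu>) * (\<integral>\<^sup>+x. H x \<partial>lborel)"
      using nn_integral_Markov_inequality[of H UNIV lborel "ennreal (3 / \<mu>)"] by simp
    also have "(\<integral>\<^sup>+x. H x \<partial>lborel) = (\<integral>\<^sup>+y. (\<integral>\<^sup>+x. K1 (x - y) * big y \<partial>lborel) \<partial>lborel)"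
      unfolding H_def by (rule nn_integral_lborel_swap) measurable
    also have "\<dots> \<le> (\<integral>\<^sup>+y. ennreal (B * R\<^sup>2) * big y \<partial>lborel)"
    proof (rule nn_integral_mono)
      fix y
      have "K1 (x - y) = K1 (y - x)" for x by (simp add: K1_def norm_minus_commute indicator_def)
      then have "(\<integral>\<^sup>+x. K1 (x - y) * big y \<partial>lborel) = (\<integral>\<^sup>+x. K1 (y - x) \<partial>lborel) * big y"
        by (simp add: nn_integral_multc)
      also have "\<dots> \<le> ennreal (B * R\<^sup>2) * big y" by (intro mult_right_mono K1) auto
      finally show "(\<integral>\<^sup>+x. K1 (x - y) * big y \<partial>lborel) \<le> ennreal (B * R\<^sup>2) * big y" .
    qed
    also have "\<dots> = ennreal (B * R\<^sup>2) * (\<integral>\<^sup>+y. big y \<partial>lborel)" by (rule nn_integral_cmult) measurable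
    also have "ennreal (3 / \<mu>) * (ennreal (B * R\<^sup>2) * (\<integral>\<^sup>+y. big y \<partial>lborel)) = ennreal (1 / t) * (\<integral>\<^sup>+y. big y \<partial>lborel)"
    proof -
      have "ennreal (3 / \<mu>) * ennreal (B * R\<^sup>2) = ennreal (1 / t)"
        using B \<mu> by (simp add: ennreal_mult'[symmetric] t_def)
      then show ?thesis by (simp add: mult.assoc[symmetric])
    qed
    finally show "emeasure lborel {x. \<mu> \<le> h x}
       \<le> ennreal (1 / (c * \<mu> powr p)) * (\<integral>\<^sup>+x. ennreal (g x) * indicator {c * \<mu> powr p<..} (g x) \<partial>lborel)"
      unfolding t_eq big_def by (simp add: mult_left_mono)
  qed
qed

text \<open>For \<open>v = h^(N/(N-4))\<close> the weak estimate reads: the measure of \<open>{v \<ge> s}\<close> is at most \<open>1/(c s)\<close> times the integral of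
  \<open>g\<close> over \<open>{g > c s}\<close>. Inserting it into \<open>\<integral> v^2 = \<integral> 2 s |{v \<ge> s}| ds\<close> and exchanging the integrals leaves a multiple
  of \<open>\<integral> g^2\<close>.\<close>

lemma riesz2_hardy_littlewood_sobolev:
  assumes N: "real CARD('n::finite) > 4"
  obtains C where "C \<ge> 0" "\<And>g h :: real^'n \<Rightarrow> real. riesz2_majorised h g \<Longrightarrow> (\<integral>\<^sup>+x. ennreal ((g x)\<^sup>2) \<partial>lborel) \<le> 1 \<Longrightarrow>
     (\<integral>\<^sup>+x. ennreal (h x powr (2 * real CARD('n) / (real CARD('n) - 4))) \<partial>lborel) \<le> ennreal C"
proof -
  let ?N = "real CARD('n)"
  define p where "p = ?N / (?N - 4)"
  have p: "p > 0" using N by (simp add: p_def)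
  obtain c where c: "c > 0" and weak: "\<And>(g :: real^'n \<Rightarrow> real) h \<mu>. riesz2_majorised h g \<Longrightarrow> (\<integral>\<^sup>+x. ennreal ((g x)\<^sup>2) \<partial>lborel) \<le> 1 \<Longrightarrow> 0 < \<mu> \<Longrightarrow>
     emeasure lborel {x. \<mu> \<le> h x}
       \<le> ennreal (1 / (c * \<mu> powr p)) * (\<integral>\<^sup>+x. ennreal (g x) * indicator {c * \<mu> powr p<..} (g x) \<partial>lborel)"
    using riesz2_weak_estimate[OF N p_def] by blast
  show ?thesis
  proof
    show "2 / c\<^sup>2 \<ge> 0" by simp
    fix g h :: "real^'n \<Rightarrow> real"
    assume maj: "riesz2_majorised h g" and g2: "(\<integral>\<^sup>+x. ennreal ((g x)\<^sup>2) \<partial>lborel) \<le> 1"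
    note [measurable] = riesz2_majorisedD(1,2)[OF maj]
    note h = riesz2_majorisedD(3)[OF maj] and g = riesz2_majorisedD(4)[OF maj]
    define v where "v x = h x powr p" for x
    have [measurable]: "v \<in> borel_measurable borel" unfolding v_def by measurable
    have v: "v x \<ge> 0" for x by (simp add: v_def)
    \<comment> \<open>layer cake formula for the square\<close>
    have layer: "ennreal ((v x)\<^sup>2) = (\<integral>\<^sup>+s. ennreal (2 * s) * indicator {0..v x} s \<partial>lborel)" for x
      using nn_integral_FTC_Icc[of "\<lambda>s. 2 * s" 0 "v x" "\<lambda>s. s\<^sup>2"] v[of x]
        DERIV_pow[of 2] by auto
    have powr2: "h x powr (2 * ?N / (?N - 4)) = (v x)\<^sup>2" for x
      unfolding v_def power2_eq_square powr_add[symmetric] by (simp add: p_def)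
    have ae0: "AE s in lborel. s \<noteq> (0::real)" by (rule AE_I[of _ _ "{0}"]) auto
    have "(\<integral>\<^sup>+x. ennreal (h x powr (2 * ?N / (?N - 4))) \<partial>lborel)
      = (\<integral>\<^sup>+x. (\<integral>\<^sup>+s. ennreal (2 * s) * indicator {0..v x} s \<partial>lborel) \<partial>lborel)"
      unfolding powr2 layer ..
    also have "\<dots> = (\<integral>\<^sup>+s. (\<integral>\<^sup>+x. ennreal (2 * s) * indicator {0..v x} s \<partial>lborel) \<partial>lborel)"
      by (rule lborel_pair.Fubini') (simp add: atLeastAtMost_def[abs_def] indicator_def[abs_def] if_distrib)
    also have "\<dots> \<le> (\<integral>\<^sup>+s. (\<integral>\<^sup>+x. ennreal (2 / c) * (ennreal (g x) * indicator {0..g x / c} s) \<partial>lborel) \<partial>lborel)"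
    proof (rule nn_integral_mono_AE, use ae0 in eventually_elim)
      fix s :: real assume s0: "s \<noteq> 0"
      show "(\<integral>\<^sup>+x. ennreal (2 * s) * indicator {0..v x} s \<partial>lborel)
         \<le> (\<integral>\<^sup>+x. ennreal (2 / c) * (ennreal (g x) * indicator {0..g x / c} s) \<partial>lborel)"
      proof (cases "s > 0")
        case True
        define \<mu> where "\<mu> = s powr (1 / p)"
        have \<mu>: "\<mu> > 0" "\<mu> powr p = s" using True p by (auto simp: \<mu>_def powr_powr)
        have iff: "s \<le> v x \<longleftrightarrow> \<mu> \<le> h x" for x
          using powr_mono2[of p \<mu> "h x"] powr_less_mono2[of p "h x" \<mu>] \<mu> p h[of x] unfolding v_def by linarith
        have "(\<integral>\<^sup>+x. ennreal (2 * s) * indicator {0..v x} s \<partial>lborel) = (\<integral>\<^sup>+x. ennreal (2 * s) * indicator {x. \<mu> \<le> h x} x \<partial>lborel)"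
          using True by (intro nn_integral_cong) (auto simp: indicator_def iff)
        also have "\<dots> = ennreal (2 * s) * emeasure lborel {x. \<mu> \<le> h x}" by (rule nn_integral_cmult_indicator) measurable
        also have "\<dots> \<le> ennreal (2 * s) * (ennreal (1 / (c * s)) * (\<integral>\<^sup>+x. ennreal (g x) * indicator {c * s<..} (g x) \<partial>lborel))"
          using weak[OF maj g2 \<mu>(1)] \<mu>(2) by (intro mult_left_mono) auto
        also have "\<dots> = ennreal (2 / c) * (\<integral>\<^sup>+x. ennreal (g x) * indicator {c * s<..} (g x) \<partial>lborel)"
        proof -
          have "ennreal (2 * s) * ennreal (1 / (c * s)) = ennreal (2 / c)"
            using True c by (simp add: ennreal_mult'[symmetric])
          then show ?thesis by (simp add: mult.assoc[symmetric])
        qed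
        also have "\<dots> = (\<integral>\<^sup>+x. ennreal (2 / c) * (ennreal (g x) * indicator {c * s<..} (g x)) \<partial>lborel)"
          by (rule nn_integral_cmult[symmetric]) measurable
        also have "\<dots> \<le> (\<integral>\<^sup>+x. ennreal (2 / c) * (ennreal (g x) * indicator {0..g x / c} s) \<partial>lborel)"
          using c True by (intro nn_integral_mono mult_left_mono) (auto simp: indicator_def field_simps)
        finally show ?thesis .
      qed (auto simp: ennreal_neg)
    qed
    also have "\<dots> = (\<integral>\<^sup>+x. (\<integral>\<^sup>+s. ennreal (2 / c) * (ennreal (g x) * indicator {0..g x / c} s) \<partial>lborel) \<partial>lborel)"
      by (rule lborel_pair.Fubini') (simp add: atLeastAtMost_def[abs_def] indicator_def[abs_def] if_distrib)
    also have "\<dots> = (\<integral>\<^sup>+x. ennreal (2 / c\<^sup>2) * ennreal ((g x)\<^sup>2) \<partial>lborel)"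
    proof (rule nn_integral_cong)
      fix x
      have "(\<integral>\<^sup>+s. ennreal (2 / c) * (ennreal (g x) * indicator {0..g x / c} s) \<partial>lborel)
        = ennreal (2 / c) * (ennreal (g x) * ennreal (g x / c))"
        using g[of x] c by (simp add: nn_integral_cmult)
      also have "\<dots> = ennreal (2 / c\<^sup>2) * ennreal ((g x)\<^sup>2)"
        using g[of x] c by (simp add: ennreal_mult'[symmetric] power2_eq_square)
      finally show "(\<integral>\<^sup>+s. ennreal (2 / c) * (ennreal (g x) * indicator {0..g x / c} s) \<partial>lborel)
        = ennreal (2 / c\<^sup>2) * ennreal ((g x)\<^sup>2)" .
    qed
    also have "\<dots> = ennreal (2 / c\<^sup>2) * (\<integral>\<^sup>+x. ennreal ((g x)\<^sup>2) \<partial>lborel)"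
      by (rule nn_integral_cmult) measurable
    also have "\<dots> \<le> ennreal (2 / c\<^sup>2) * 1" by (intro mult_left_mono g2) auto
    finally show "(\<integral>\<^sup>+x. ennreal (h x powr (2 * ?N / (?N - 4))) \<partial>lborel) \<le> ennreal (2 / c\<^sup>2)" by simp
  qed
qed

section \<open>The Stein-Weiss inequality\<close>

text \<open>A crude form of Young's inequality; pointwise it replaces the interpolation of integrals by Hoelder's
  inequality.\<close>

lemma powr_interpolation_le_add:
  fixes a b \<theta> :: real
  assumes "0 \<le> a" "0 \<le> b" "0 \<le> \<theta>" "\<theta> \<le> 1"
  shows "a powr \<theta> * b powr (1 - \<theta>) \<le> a + b"
proof -
  let ?m = "max a b"
  have "a powr \<theta> * b powr (1 - \<theta>) \<le> ?m powr \<theta> * ?m powr (1 - \<theta>)"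
    using assms by (intro mult_mono powr_mono2) auto
  also have "\<dots> = ?m" using assms unfolding powr_add[symmetric] by auto
  also have "\<dots> \<le> a + b" using assms by auto
  finally show ?thesis .
qed

text \<open>If \<open>|y|\<close> is not comparable with \<open>|x|\<close>, the kernel is at most a multiple of \<open>max(|x|,|y|)^(2-N)\<close>. After Cauchy-Schwarz
  it remains to integrate \<open>|y|^(-\<alpha>)\<close> over a ball, where \<open>\<alpha> < N\<close> enters, and \<open>|y|^(4-2N-\<alpha>)\<close> over the complement
  of a ball, where \<open>\<alpha> > 4 - N\<close> enters.\<close>

lemma riesz2_far_part_bound:
  fixes \<alpha> :: real
  assumes N: "real CARD('n::finite) > 2" and \<alpha>: "4 - real CARD('n) < \<alpha>" "\<alpha> < real CARD('n)"
  obtains D where "D \<ge> 0" "\<And>(f :: real^'n \<Rightarrow> real) x. f \<in> borel_measurable borel \<Longrightarrow> (\<And>x. 0 \<le> f x) \<Longrightarrow>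
     (\<integral>\<^sup>+x. ennreal (norm x powr \<alpha> * (f x)\<^sup>2) \<partial>lborel) \<le> 1 \<Longrightarrow> x \<noteq> 0 \<Longrightarrow>
     (\<integral>\<^sup>+y. ennreal (norm (x - y) powr (2 - real CARD('n)) * f y) * indicator {y. norm y < norm x / 2 \<or> 2 * norm x < norm y} y \<partial>lborel)
       \<le> ennreal (D * norm x powr ((4 - real CARD('n) - \<alpha>) / 2))"
proof -
  let ?N = "real CARD('n)"
  obtain C1 where C1: "C1 \<ge> 0" "\<And>r. r > 0 \<Longrightarrow>
    (\<integral>\<^sup>+x. ennreal (norm x powr - \<alpha>) * indicator (ball 0 r) (x::real^'n) \<partial>lborel) \<le> ennreal (C1 * r powr (- \<alpha> + ?N))"
    using nn_integral_norm_powr_ball[where 'n='n and a="- \<alpha>"] \<alpha> by auto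
  obtain C2 where C2: "C2 \<ge> 0" "\<And>r. r > 0 \<Longrightarrow>
    (\<integral>\<^sup>+x. ennreal (norm x powr (4 - 2 * ?N - \<alpha>)) * indicator (- ball 0 r) (x::real^'n) \<partial>lborel) \<le> ennreal (C2 * r powr (4 - 2 * ?N - \<alpha> + ?N))"
    using nn_integral_norm_powr_outside_ball[where 'n='n and a="4 - 2 * ?N - \<alpha>"] \<alpha> by auto
  define h where "h = (1/2) powr (4 - 2 * ?N)"
  define D where "D = h * (C1 + C2)"
  have h: "h \<ge> 0" and D: "D \<ge> 0" using C1 C2 by (auto simp: D_def h_def)
  show ?thesis
  proof
    show "sqrt D \<ge> 0" using D by simp
    fix f :: "real^'n \<Rightarrow> real" and x :: "real^'n"
    assume [measurable]: "f \<in> borel_measurable borel" and f: "\<And>x. 0 \<le> f x"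
      and f2: "(\<integral>\<^sup>+x. ennreal (norm x powr \<alpha> * (f x)\<^sup>2) \<partial>lborel) \<le> 1" and x: "x \<noteq> 0"
    let ?far = "{y. norm y < norm x / 2 \<or> 2 * norm x < norm y}"
    let ?k = "\<lambda>y. norm (x - y) powr (2 - ?N)"
    have nx: "norm x > 0" using x by simp
    have [measurable]: "?far \<in> sets borel" by measurable
    define f1 where "f1 y = ennreal (norm y powr - \<alpha>) * indicator (ball 0 (norm x)) y" for y :: "real^'n"
    define f3 where "f3 y = ennreal (norm y powr (4 - 2 * ?N - \<alpha>)) * indicator (- ball 0 (norm x)) y" for y :: "real^'n"
    have [measurable]: "f1 \<in> borel_measurable borel" "f3 \<in> borel_measurable borel"
      unfolding f1_def f3_def by (intro borel_measurable_times_ennreal borel_measurable_indicator; simp)+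
    define G where "G y = ennreal (?k y * norm y powr (- \<alpha> / 2)) * indicator ?far y" for y
    have [measurable]: "G \<in> borel_measurable borel" unfolding G_def by measurable
    have ae0: "AE y in lborel. y \<noteq> (0::real^'n)" by (rule AE_I[of _ _ "{0}"]) auto
    have "(\<integral>\<^sup>+y. ennreal (?k y * f y) * indicator ?far y \<partial>lborel) = (\<integral>\<^sup>+y. G y * ennreal (norm y powr (\<alpha> / 2) * f y) \<partial>lborel)"
    proof (rule nn_integral_cong_AE, use ae0 in eventually_elim)
      fix y :: "real^'n" assume y: "y \<noteq> 0"
      have "norm y powr (- \<alpha> / 2) * norm y powr (\<alpha> / 2) = 1" using y unfolding powr_add[symmetric] by simp
      then have "?k y * norm y powr (- \<alpha> / 2) * (norm y powr (\<alpha> / 2) * f y) = ?k y * f y"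
        by (metis (no_types, opaque_lifting) mult.assoc mult.left_neutral)
      then show "ennreal (?k y * f y) * indicator ?far y = G y * ennreal (norm y powr (\<alpha> / 2) * f y)"
        using f[of y] by (simp add: G_def indicator_def ennreal_mult'[symmetric])
    qed
    moreover have "(\<integral>\<^sup>+y. G y * ennreal (norm y powr (\<alpha> / 2) * f y) \<partial>lborel)\<^sup>2
       \<le> ennreal (D * norm x powr (4 - ?N - \<alpha>))"
    proof -
      have "(\<integral>\<^sup>+y. G y * ennreal (norm y powr (\<alpha> / 2) * f y) \<partial>lborel)\<^sup>2
        \<le> (\<integral>\<^sup>+y. (G y)\<^sup>2 \<partial>lborel) * (\<integral>\<^sup>+y. (ennreal (norm y powr (\<alpha> / 2) * f y))\<^sup>2 \<partial>lborel)"
        by (rule Cauchy_Schwarz_nn_integral) measurable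
      also have "(\<integral>\<^sup>+y. (ennreal (norm y powr (\<alpha> / 2) * f y))\<^sup>2 \<partial>lborel) = (\<integral>\<^sup>+x. ennreal (norm x powr \<alpha> * (f x)\<^sup>2) \<partial>lborel)"
      proof (rule nn_integral_cong)
        fix y :: "real^'n"
        have "(norm y powr (\<alpha> / 2))\<^sup>2 = norm y powr \<alpha>" unfolding power2_eq_square powr_add[symmetric] by simp
        then show "(ennreal (norm y powr (\<alpha> / 2) * f y))\<^sup>2 = ennreal (norm y powr \<alpha> * (f y)\<^sup>2)"
          using f[of y] by (simp add: ennreal_power power_mult_distrib)
      qed
      also have "(\<integral>\<^sup>+y. (G y)\<^sup>2 \<partial>lborel) * (\<integral>\<^sup>+x. ennreal (norm x powr \<alpha> * (f x)\<^sup>2) \<partial>lborel) \<le> (\<integral>\<^sup>+y. (G y)\<^sup>2 \<partial>lborel) * 1"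
        by (intro mult_left_mono f2) auto
      also have "(\<integral>\<^sup>+y. (G y)\<^sup>2 \<partial>lborel) \<le> (\<integral>\<^sup>+y. ennreal (h * norm x powr (4 - 2 * ?N)) * f1 y + ennreal h * f3 y \<partial>lborel)"
      proof (rule nn_integral_mono)
        fix y
        have sq: "(?k y * norm y powr (- \<alpha> / 2))\<^sup>2 = norm (x - y) powr (4 - 2 * ?N) * norm y powr - \<alpha>"
          unfolding power_mult_distrib unfolding power2_eq_square powr_add[symmetric] by simp
        consider "norm y < norm x / 2" | "2 * norm x < norm y" | "y \<notin> ?far" by auto
        then show "(G y)\<^sup>2 \<le> ennreal (h * norm x powr (4 - 2 * ?N)) * f1 y + ennreal h * f3 y"
        proof cases
          case 1
          have "norm x / 2 \<le> norm (x - y)" using 1 norm_triangle_ineq2[of x y] by simp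
          then have "norm (x - y) powr (4 - 2 * ?N) \<le> (norm x / 2) powr (4 - 2 * ?N)"
            using nx N by (intro powr_mono2') auto
          also have "\<dots> = h * norm x powr (4 - 2 * ?N)"
            unfolding h_def using powr_mult[of "1/2" "norm x" "4 - 2 * ?N"] by simp
          finally have le: "norm (x - y) powr (4 - 2 * ?N) * norm y powr - \<alpha> \<le> h * norm x powr (4 - 2 * ?N) * norm y powr - \<alpha>"
            by (intro mult_right_mono) auto
          have "(G y)\<^sup>2 = ennreal (norm (x - y) powr (4 - 2 * ?N) * norm y powr - \<alpha>)"
            using 1 unfolding sq[symmetric] by (simp add: G_def ennreal_power)
          also have "\<dots> \<le> ennreal (h * norm x powr (4 - 2 * ?N) * norm y powr - \<alpha>)" by (rule ennreal_leI[OF le])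
          also have "\<dots> = ennreal (h * norm x powr (4 - 2 * ?N)) * f1 y"
          proof -
            have "norm y < norm x" using 1 norm_ge_zero[of y] by linarith
            then show ?thesis using h by (simp add: f1_def ennreal_mult'')
          qed
          also have "\<dots> \<le> \<dots> + ennreal h * f3 y" by (simp add: add_increasing2)
          finally show ?thesis .
        next
          case 2
          have "norm y / 2 \<le> norm (x - y)" using 2 norm_triangle_ineq2[of y x] by (simp add: norm_minus_commute)
          then have "norm (x - y) powr (4 - 2 * ?N) \<le> (norm y / 2) powr (4 - 2 * ?N)"
            using 2 nx N by (intro powr_mono2') auto
          also have "\<dots> = h * norm y powr (4 - 2 * ?N)"
            unfolding h_def using powr_mult[of "1/2" "norm y" "4 - 2 * ?N"] by simp
          finally have "norm (x - y) powr (4 - 2 * ?N) * norm y powr - \<alpha> \<le> h * norm y powr (4 - 2 * ?N) * norm y powr - \<alpha>"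
            by (intro mult_right_mono) auto
          also have "\<dots> = h * norm y powr (4 - 2 * ?N - \<alpha>)" unfolding mult.assoc powr_add[symmetric] by simp
          finally have le: "norm (x - y) powr (4 - 2 * ?N) * norm y powr - \<alpha> \<le> h * norm y powr (4 - 2 * ?N - \<alpha>)" .
          have "(G y)\<^sup>2 = ennreal (norm (x - y) powr (4 - 2 * ?N) * norm y powr - \<alpha>)"
            using 2 unfolding sq[symmetric] by (simp add: G_def ennreal_power)
          also have "\<dots> \<le> ennreal (h * norm y powr (4 - 2 * ?N - \<alpha>))" by (rule ennreal_leI[OF le])
          also have "\<dots> = ennreal h * f3 y"
          proof -
            have "\<not> norm y < norm x" using 2 norm_ge_zero[of x] by linarith
            then show ?thesis using h by (simp add: f3_def ennreal_mult'')
          qed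
          also have "\<dots> \<le> ennreal (h * norm x powr (4 - 2 * ?N)) * f1 y + \<dots>" by (simp add: add_increasing)
          finally show ?thesis .
        next
          case 3
          then have "G y = 0" by (simp add: G_def indicator_def)
          then show ?thesis by simp
        qed
      qed
      also have "\<dots> = ennreal (h * norm x powr (4 - 2 * ?N)) * integral\<^sup>N lborel f1 + ennreal h * integral\<^sup>N lborel f3"
        by (simp add: nn_integral_add nn_integral_cmult)
      also have "\<dots> \<le> ennreal (h * norm x powr (4 - 2 * ?N)) * ennreal (C1 * norm x powr (- \<alpha> + ?N))
          + ennreal h * ennreal (C2 * norm x powr (4 - 2 * ?N - \<alpha> + ?N))"
        unfolding f1_def f3_def by (intro add_mono mult_left_mono C1 C2 nx) auto
      also have "\<dots> = ennreal (h * norm x powr (4 - 2 * ?N) * (C1 * norm x powr (- \<alpha> + ?N)) + h * (C2 * norm x powr (4 - 2 * ?N - \<alpha> + ?N)))"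
        using C1 C2 h by (simp add: ennreal_mult'[symmetric] ennreal_plus[symmetric] del: ennreal_plus)
      also have "h * norm x powr (4 - 2 * ?N) * (C1 * norm x powr (- \<alpha> + ?N)) + h * (C2 * norm x powr (4 - 2 * ?N - \<alpha> + ?N))
         = D * norm x powr (4 - ?N - \<alpha>)"
      proof -
        have 1: "norm x powr (4 - 2 * ?N) * norm x powr (- \<alpha> + ?N) = norm x powr (4 - ?N - \<alpha>)"
          unfolding powr_add[symmetric] by (rule arg_cong[where f="\<lambda>e. norm x powr e"]) simp
        have 2: "4 - 2 * ?N - \<alpha> + ?N = 4 - ?N - \<alpha>" by simp
        have "h * norm x powr (4 - 2 * ?N) * (C1 * norm x powr (- \<alpha> + ?N))
          = h * C1 * (norm x powr (4 - 2 * ?N) * norm x powr (- \<alpha> + ?N))" by (simp only: mult_ac)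
        then show ?thesis unfolding 1 2 D_def by (simp add: algebra_simps)
      qed
      finally show ?thesis by simp
    qed
    ultimately have "(\<integral>\<^sup>+y. ennreal (?k y * f y) * indicator ?far y \<partial>lborel)
      \<le> ennreal (sqrt (D * norm x powr (4 - ?N - \<alpha>)))"
      using D by (auto intro!: ennreal_le_sqrt_if_square_le)
    also have "sqrt (D * norm x powr (4 - ?N - \<alpha>)) = sqrt D * norm x powr ((4 - ?N - \<alpha>) / 2)"
      using nx by (simp add: real_sqrt_mult powr_half_sqrt[symmetric] powr_powr)
    finally show "(\<integral>\<^sup>+y. ennreal (?k y * f y) * indicator ?far y \<partial>lborel)
      \<le> ennreal (sqrt D * norm x powr ((4 - ?N - \<alpha>) / 2))" .
  qed
qed

text \<open>Let \<open>F(x)\<close> be the bound for the far part. Where \<open>u \<le> 2 F\<close>, the factor \<open>u^(q-2)\<close> of \<open>u^q\<close> is bounded through \<open>F\<close>, and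
  the choice of \<open>q\<close> turns the weight into \<open>|x|^(\<alpha>-4)\<close>. Elsewhere half of \<open>u\<close> comes from the near part, so
  \<open>w = |x|^(\<alpha>/2) u\<close> is below a multiple of the potential of \<open>g = |y|^(\<alpha>/2) f\<close>, and
  \<open>|x|^l u^q = |x|^(-\<beta>) w^q\<close> with \<open>0 \<le> \<beta> \<le> 4\<close> is interpolated between \<open>|x|^(-4) w^2\<close> and
  \<open>w^(2N/(N-4))\<close>.\<close>

lemma stein_weiss_riesz2:
  fixes \<alpha> l q :: real
  assumes N: "real CARD('n::finite) > 4" and \<alpha>: "4 - real CARD('n) < \<alpha>" "\<alpha> < real CARD('n)"
    and l: "l - \<alpha> > - 4" "(real CARD('n) - 4) * (l - \<alpha>) \<le> 4 * \<alpha>"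
    and q: "q = 2 * (real CARD('n) + l) / (real CARD('n) + \<alpha> - 4)"
  obtains C where "C \<ge> 0" "\<And>f u :: real^'n \<Rightarrow> real. riesz2_majorised u f \<Longrightarrow>
     (\<integral>\<^sup>+x. ennreal (norm x powr \<alpha> * (f x)\<^sup>2) \<partial>lborel) \<le> 1 \<Longrightarrow>
     (\<integral>\<^sup>+x. ennreal (norm x powr l * u x powr q) \<partial>lborel) \<le> ennreal C"
proof -
  let ?N = "real CARD('n)"
  have N2: "?N > 2" using N by simp
  obtain D where D: "D \<ge> 0" and far: "\<And>(f :: real^'n \<Rightarrow> real) x. f \<in> borel_measurable borel \<Longrightarrow> (\<And>x. 0 \<le> f x) \<Longrightarrow>
     (\<integral>\<^sup>+x. ennreal (norm x powr \<alpha> * (f x)\<^sup>2) \<partial>lborel) \<le> 1 \<Longrightarrow> x \<noteq> 0 \<Longrightarrow>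
     (\<integral>\<^sup>+y. ennreal (norm (x - y) powr (2 - ?N) * f y) * indicator {y. norm y < norm x / 2 \<or> 2 * norm x < norm y} y \<partial>lborel)
       \<le> ennreal (D * norm x powr ((4 - ?N - \<alpha>) / 2))"
    using riesz2_far_part_bound[OF N2 \<alpha>] by blast
  obtain CR where CR: "CR \<ge> 0" and rellich: "\<And>f u :: real^'n \<Rightarrow> real. riesz2_majorised u f \<Longrightarrow>
     (\<integral>\<^sup>+x. ennreal (norm x powr (\<alpha> - 4) * (u x)\<^sup>2) \<partial>lborel) \<le> ennreal CR * (\<integral>\<^sup>+x. ennreal (norm x powr \<alpha> * (f x)\<^sup>2) \<partial>lborel)"
    using weighted_rellich[OF N2 \<alpha>] by blast
  obtain CH where CH: "CH \<ge> 0" and hls: "\<And>g h :: real^'n \<Rightarrow> real. riesz2_majorised h g \<Longrightarrow> (\<integral>\<^sup>+x. ennreal ((g x)\<^sup>2) \<partial>lborel) \<le> 1 \<Longrightarrow>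
     (\<integral>\<^sup>+x. ennreal (h x powr (2 * ?N / (?N - 4))) \<partial>lborel) \<le> ennreal CH"
    using riesz2_hardy_littlewood_sobolev[OF N] by blast
  define r where "r = 2 * ?N / (?N - 4)"
  define \<beta> where "\<beta> = q * \<alpha> / 2 - l"
  \<comment> \<open>the interpolation parameter: weight \<open>|x|^(-4)\<close> at \<open>\<theta> = 1\<close>, no weight at \<open>\<theta> = 0\<close>\<close>
  define \<theta> where "\<theta> = \<beta> / 4"
  \<comment> \<open>the factor 2 absorbs the far half of \<open>u\<close>, the power compares \<open>|y|^(\<alpha>/2)\<close> with \<open>|x|^(\<alpha>/2)\<close>\<close>
  define \<kappa> where "\<kappa> = 2 * 2 powr (\<bar>\<alpha>\<bar> / 2)"
  define M where "M = (2 * D) powr (q - 2)"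
  have dpos: "?N + \<alpha> - 4 > 0" using \<alpha> by simp
  have q2: "q > 2" using l dpos by (simp add: q field_simps)
  have qmul: "q * (?N + \<alpha> - 4) = 2 * (?N + l)" using dpos by (simp add: q)
  have \<beta>_eq: "\<beta> = ?N - q * (?N - 4) / 2" using qmul by (simp add: \<beta>_def field_simps)
  have \<theta>: "0 \<le> \<theta>" "\<theta> \<le> 1"
  proof -
    have "(q * (?N - 4)) * (?N + \<alpha> - 4) = (q * (?N + \<alpha> - 4)) * (?N - 4)" by (simp only: mult_ac)
    also have "\<dots> = 2 * (?N + l) * (?N - 4)" unfolding qmul ..
    also have "\<dots> \<le> (2 * ?N) * (?N + \<alpha> - 4)" using l(2) by (simp add: algebra_simps)
    finally have "q * (?N - 4) \<le> 2 * ?N" using dpos by (rule mult_right_le_imp_le)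
    then show "0 \<le> \<theta>" by (simp add: \<theta>_def \<beta>_eq)
    have "2 * (?N - 4) \<le> q * (?N - 4)" using q2 N by (intro mult_right_mono) auto
    then show "\<theta> \<le> 1" by (simp add: \<theta>_def \<beta>_eq)
  qed
  have expo: "2 * \<theta> + r * (1 - \<theta>) = q"
    using N by (simp add: \<theta>_def \<beta>_eq r_def field_simps)
  have \<kappa>: "\<kappa> > 0" by (simp add: \<kappa>_def)
  have M: "M \<ge> 0" by (simp add: M_def)
  show ?thesis
  proof
    show "(M + 1) * CR + \<kappa> powr r * CH \<ge> 0" using CR CH M by simp
    fix f u :: "real^'n \<Rightarrow> real"
    assume maj: "riesz2_majorised u f"
      and f2: "(\<integral>\<^sup>+x. ennreal (norm x powr \<alpha> * (f x)\<^sup>2) \<partial>lborel) \<le> 1"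
    note [measurable] = riesz2_majorisedD(1,2)[OF maj]
    note u = riesz2_majorisedD(3)[OF maj] and f = riesz2_majorisedD(4)[OF maj] and le = riesz2_majorisedD(5)[OF maj]
    define F where "F x = D * norm x powr ((4 - ?N - \<alpha>) / 2)" for x :: "real^'n"
    have F0: "F x \<ge> 0" for x using D by (simp add: F_def)
    \<comment> \<open>the set where the near part of the potential dominates\<close>
    define E where "E = {x. x \<noteq> 0 \<and> 2 * F x < u x}"
    have [measurable]: "E \<in> sets borel" unfolding E_def F_def by measurable
    define g where "g y = norm y powr (\<alpha> / 2) * f y" for y
    define h where "h x = indicator E x * (norm x powr (\<alpha> / 2) * u x / \<kappa>)" for x
    have [measurable]: "g \<in> borel_measurable borel" "h \<in> borel_measurable borel"
      unfolding g_def h_def by measurable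
    have g0: "g x \<ge> 0" and h0: "h x \<ge> 0" for x using f[of x] u[of x] \<kappa> by (auto simp: g_def h_def)
    have g2: "(\<integral>\<^sup>+x. ennreal ((g x)\<^sup>2) \<partial>lborel) \<le> 1"
    proof -
      have "(g x)\<^sup>2 = norm x powr \<alpha> * (f x)\<^sup>2" for x
        unfolding g_def power_mult_distrib unfolding power2_eq_square powr_add[symmetric] by simp
      then show ?thesis using f2 by simp
    qed
    have h_le: "ennreal (h x) \<le> riesz2 g x" for x
    proof (cases "x \<in> E")
      case True
      then have x: "x \<noteq> 0" and ux: "2 * F x < u x" by (auto simp: E_def)
      define far where "far = {y::real^'n. norm y < norm x / 2 \<or> 2 * norm x < norm y}"
      define k where "k y = norm (x - y) powr (2 - ?N)" for y
      have k0: "k y \<ge> 0" for y by (simp add: k_def)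
      have [measurable]: "far \<in> sets borel" unfolding far_def by measurable
      have [measurable]: "k \<in> borel_measurable borel" unfolding k_def by measurable
      have "ennreal (u x) \<le> (\<integral>\<^sup>+y. ennreal (k y * f y) \<partial>lborel)"
        using le[of x] by (simp add: riesz2_def k_def)
      also have "\<dots> = (\<integral>\<^sup>+y. ennreal (k y * f y) * indicator far y + ennreal (k y * f y) * indicator (- far) y \<partial>lborel)"
        by (intro nn_integral_cong) (auto simp: indicator_def)
      also have "\<dots> = (\<integral>\<^sup>+y. ennreal (k y * f y) * indicator far y \<partial>lborel) + (\<integral>\<^sup>+y. ennreal (k y * f y) * indicator (- far) y \<partial>lborel)"
        by (rule nn_integral_add) measurable
      also have "(\<integral>\<^sup>+y. ennreal (k y * f y) * indicator far y \<partial>lborel) \<le> ennreal (F x)"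
        using far[of f x] f f2 x by (simp add: F_def k_def far_def)
      also have "ennreal (F x) \<le> ennreal (u x / 2)" using ux by (intro ennreal_leI) simp
      also have "(\<integral>\<^sup>+y. ennreal (k y * f y) * indicator (- far) y \<partial>lborel)
         \<le> (\<integral>\<^sup>+y. ennreal (\<kappa> / 2 * norm x powr (- \<alpha> / 2)) * ennreal (k y * g y) \<partial>lborel)"
      proof (rule nn_integral_mono)
        fix y
        show "ennreal (k y * f y) * indicator (- far) y \<le> ennreal (\<kappa> / 2 * norm x powr (- \<alpha> / 2)) * ennreal (k y * g y)"
        proof (cases "y \<in> far")
          case False
          then have y: "norm x / 2 \<le> norm y" "norm y \<le> 2 * norm x" by (auto simp: far_def)
          then have y0: "norm y > 0" using x by (smt (verit) half_gt_zero zero_less_norm_iff)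
          have "1 \<le> 2 powr (\<bar>\<alpha>\<bar> / 2) * (norm x powr (- \<alpha> / 2) * norm y powr (\<alpha> / 2))"
          proof -
            have "norm x powr (\<alpha> / 2) \<le> 2 powr (\<bar>\<alpha>\<bar> / 2) * norm y powr (\<alpha> / 2)"
            proof (cases "\<alpha> \<ge> 0")
              case True
              then have "norm x powr (\<alpha> / 2) \<le> (2 * norm y) powr (\<alpha> / 2)" using y by (intro powr_mono2) auto
              then show ?thesis using True by (simp add: powr_mult)
            next
              case False
              have "norm x powr (\<alpha> / 2) \<le> (norm y / 2) powr (\<alpha> / 2)" using y y0 False by (intro powr_mono2') auto
              also have "\<dots> = norm y powr (\<alpha> / 2) * 2 powr (- (\<alpha> / 2))"
                unfolding powr_divide powr_minus by (rule divide_inverse)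
              finally show ?thesis using False by (simp add: mult.commute)
            qed
            then have "norm x powr (- \<alpha> / 2) * norm x powr (\<alpha> / 2) \<le> norm x powr (- \<alpha> / 2) * (2 powr (\<bar>\<alpha>\<bar> / 2) * norm y powr (\<alpha> / 2))"
              by (intro mult_left_mono) auto
            moreover have "norm x powr (- \<alpha> / 2) * norm x powr (\<alpha> / 2) = 1" using x unfolding powr_add[symmetric] by simp
            ultimately show ?thesis by (simp add: mult_ac)
          qed
          then have "k y * f y * 1 \<le> k y * f y * (2 powr (\<bar>\<alpha>\<bar> / 2) * (norm x powr (- \<alpha> / 2) * norm y powr (\<alpha> / 2)))"
            using k0 f by (intro mult_left_mono) auto
          also have "\<dots> = \<kappa> / 2 * norm x powr (- \<alpha> / 2) * (k y * g y)" by (simp add: \<kappa>_def g_def mult_ac)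
          finally have "ennreal (k y * f y) \<le> ennreal (\<kappa> / 2 * norm x powr (- \<alpha> / 2) * (k y * g y))" by (simp add: ennreal_leI)
          also have "\<dots> = ennreal (\<kappa> / 2 * norm x powr (- \<alpha> / 2)) * ennreal (k y * g y)"
            by (rule ennreal_mult) (use \<kappa> k0 g0 in auto)
          finally show ?thesis using False by simp
        qed simp
      qed
      also have "\<dots> = ennreal (\<kappa> / 2 * norm x powr (- \<alpha> / 2)) * riesz2 g x"
        unfolding riesz2_def k_def[symmetric] by (rule nn_integral_cmult) measurable
      \<comment> \<open>the term \<open>u x / 2\<close> can be subtracted only if the potential of \<open>g\<close> is finite; otherwise there is nothing to prove\<close>
      finally have main: "ennreal (u x) \<le> ennreal (u x / 2) + ennreal (\<kappa> / 2 * norm x powr (- \<alpha> / 2)) * riesz2 g x"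
        by (simp add: add_mono)
      show ?thesis
      proof (cases "riesz2 g x")
        case (real t)
        then have "ennreal (u x) \<le> ennreal (u x / 2 + \<kappa> / 2 * norm x powr (- \<alpha> / 2) * t)"
          using main \<kappa> u[of x] by (simp add: ennreal_mult'[symmetric] ennreal_plus[symmetric] del: ennreal_plus)
        then have "u x \<le> u x / 2 + \<kappa> / 2 * norm x powr (- \<alpha> / 2) * t"
          using u[of x] real \<kappa> by (subst (asm) ennreal_le_iff) auto
        then have "u x \<le> \<kappa> * norm x powr (- \<alpha> / 2) * t" by simp
        then have "norm x powr (\<alpha> / 2) * u x \<le> norm x powr (\<alpha> / 2) * (\<kappa> * norm x powr (- \<alpha> / 2) * t)"
          by (intro mult_left_mono) auto
        also have "\<dots> = (norm x powr (\<alpha> / 2) * norm x powr (- \<alpha> / 2)) * (\<kappa> * t)" by (simp only: mult_ac)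
        also have "norm x powr (\<alpha> / 2) * norm x powr (- \<alpha> / 2) = 1" using x unfolding powr_add[symmetric] by simp
        finally have "norm x powr (\<alpha> / 2) * u x \<le> \<kappa> * t" by simp
        then have "h x \<le> t" using True \<kappa> by (simp add: h_def field_simps)
        then show ?thesis using real by (simp add: ennreal_leI)
      qed simp
    qed (simp add: h_def)
    have pw: "norm x powr l * u x powr q \<le> (M + 1) * (norm x powr (\<alpha> - 4) * (u x)\<^sup>2) + \<kappa> powr r * h x powr r" if x: "x \<noteq> 0" for x
    proof (cases "x \<in> E")
      case False
      then have ux: "u x \<le> 2 * F x" using x by (auto simp: E_def)
      have "u x powr q = (u x)\<^sup>2 * u x powr (q - 2)"
        using u[of x] q2 by (cases "u x = 0") (auto simp: powr_diff powr_numeral)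
      also have "\<dots> \<le> (u x)\<^sup>2 * (2 * F x) powr (q - 2)"
        using u[of x] ux q2 by (intro mult_left_mono powr_mono2) auto
      also have "(2 * F x) powr (q - 2) = M * norm x powr ((4 - ?N - \<alpha>) / 2 * (q - 2))"
      proof -
        have "2 * F x = (2 * D) * norm x powr ((4 - ?N - \<alpha>) / 2)" by (simp add: F_def)
        then show ?thesis using D by (simp only: M_def powr_mult powr_powr)
      qed
      finally have "norm x powr l * u x powr q \<le> norm x powr l * ((u x)\<^sup>2 * (M * norm x powr ((4 - ?N - \<alpha>) / 2 * (q - 2))))"
        by (intro mult_left_mono) auto
      also have "\<dots> = M * (u x)\<^sup>2 * (norm x powr l * norm x powr ((4 - ?N - \<alpha>) / 2 * (q - 2)))" by (simp only: mult_ac)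
      also have "norm x powr l * norm x powr ((4 - ?N - \<alpha>) / 2 * (q - 2)) = norm x powr (\<alpha> - 4)"
      proof -
        have "l + (4 - ?N - \<alpha>) / 2 * (q - 2) = \<alpha> - 4" using qmul by (simp add: field_simps)
        then show ?thesis unfolding powr_add[symmetric] by simp
      qed
      also have "M * (u x)\<^sup>2 * norm x powr (\<alpha> - 4) \<le> (M + 1) * (norm x powr (\<alpha> - 4) * (u x)\<^sup>2) + \<kappa> powr r * h x powr r"
      proof -
        have "0 \<le> norm x powr (\<alpha> - 4) * (u x)\<^sup>2" "0 \<le> \<kappa> powr r * h x powr r" by auto
        then show ?thesis by (simp add: algebra_simps)
      qed
      finally show ?thesis .
    next
      case True
      define w where "w = norm x powr (\<alpha> / 2) * u x"
      have w: "w \<ge> 0" using u by (simp add: w_def)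
      have hw: "h x = w / \<kappa>" using True by (simp add: h_def w_def)
      have a: "norm x powr - 4 * w\<^sup>2 = norm x powr (\<alpha> - 4) * (u x)\<^sup>2"
      proof -
        have "norm x powr - 4 * w\<^sup>2 = (norm x powr - 4 * (norm x powr (\<alpha> / 2) * norm x powr (\<alpha> / 2))) * (u x)\<^sup>2"
          by (simp only: w_def power2_eq_square mult_ac)
        also have "norm x powr - 4 * (norm x powr (\<alpha> / 2) * norm x powr (\<alpha> / 2)) = norm x powr (\<alpha> - 4)"
          unfolding powr_add[symmetric] by simp
        finally show ?thesis .
      qed
      have "norm x powr l * u x powr q = norm x powr - \<beta> * w powr q"
      proof -
        have "norm x powr - \<beta> * w powr q = (norm x powr - \<beta> * norm x powr (\<alpha> / 2 * q)) * u x powr q"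
          unfolding w_def powr_mult powr_powr by (simp only: mult_ac)
        also have "norm x powr - \<beta> * norm x powr (\<alpha> / 2 * q) = norm x powr l"
          unfolding powr_add[symmetric] by (simp add: \<beta>_def algebra_simps)
        finally show ?thesis by simp
      qed
      also have "\<dots> = (norm x powr - 4 * w\<^sup>2) powr \<theta> * (w powr r) powr (1 - \<theta>)"
      proof -
        have "(w\<^sup>2) powr \<theta> = w powr (2 * \<theta>)" using w by (cases "w = 0") (auto simp: powr_numeral[symmetric] powr_powr simp del: powr_numeral)
        then have "(norm x powr - 4 * w\<^sup>2) powr \<theta> * (w powr r) powr (1 - \<theta>)
          = norm x powr (- 4 * \<theta>) * (w powr (2 * \<theta>) * w powr (r * (1 - \<theta>)))"
          using w by (simp only: powr_mult powr_powr mult.assoc)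
        also have "w powr (2 * \<theta>) * w powr (r * (1 - \<theta>)) = w powr q"
          unfolding powr_add[symmetric] expo ..
        also have "- 4 * \<theta> = - \<beta>" by (simp add: \<theta>_def)
        finally show ?thesis by simp
      qed
      also have "\<dots> \<le> norm x powr - 4 * w\<^sup>2 + w powr r"
        using \<theta> by (intro powr_interpolation_le_add) auto
      also have "w powr r = \<kappa> powr r * h x powr r"
        using w \<kappa> unfolding hw by (simp add: powr_mult[symmetric])
      finally have "norm x powr l * u x powr q \<le> norm x powr (\<alpha> - 4) * (u x)\<^sup>2 + \<kappa> powr r * h x powr r" unfolding a .
      also have "norm x powr (\<alpha> - 4) * (u x)\<^sup>2 \<le> (M + 1) * (norm x powr (\<alpha> - 4) * (u x)\<^sup>2)"
        using M by (simp add: mult_right_mono[of 1 "M + 1", simplified])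
      finally show ?thesis by simp
    qed
    have "(\<integral>\<^sup>+x. ennreal (norm x powr l * u x powr q) \<partial>lborel)
      \<le> (\<integral>\<^sup>+x. ennreal (M + 1) * ennreal (norm x powr (\<alpha> - 4) * (u x)\<^sup>2) + ennreal (\<kappa> powr r) * ennreal (h x powr r) \<partial>lborel)"
    proof (rule nn_integral_mono_AE)
      have "AE x in lborel. x \<noteq> (0::real^'n)" by (rule AE_I[of _ _ "{0}"]) auto
      then show "AE x in lborel. ennreal (norm x powr l * u x powr q)
        \<le> ennreal (M + 1) * ennreal (norm x powr (\<alpha> - 4) * (u x)\<^sup>2) + ennreal (\<kappa> powr r) * ennreal (h x powr r)"
      proof eventually_elim
        case (elim x)
        from ennreal_leI[OF pw[OF elim]] show ?case
          using M by (simp add: ennreal_plus ennreal_mult')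
      qed
    qed
    also have "\<dots> = ennreal (M + 1) * (\<integral>\<^sup>+x. ennreal (norm x powr (\<alpha> - 4) * (u x)\<^sup>2) \<partial>lborel)
        + ennreal (\<kappa> powr r) * (\<integral>\<^sup>+x. ennreal (h x powr r) \<partial>lborel)"
      by (subst nn_integral_add, measurable) (simp add: nn_integral_cmult)
    also have "\<dots> \<le> ennreal (M + 1) * ennreal CR + ennreal (\<kappa> powr r) * ennreal CH"
    proof (intro add_mono mult_left_mono)
      have "(\<integral>\<^sup>+x. ennreal (norm x powr (\<alpha> - 4) * (u x)\<^sup>2) \<partial>lborel) \<le> ennreal CR * (\<integral>\<^sup>+x. ennreal (norm x powr \<alpha> * (f x)\<^sup>2) \<partial>lborel)"
        by (rule rellich[OF maj])
      also have "\<dots> \<le> ennreal CR * 1" by (intro mult_left_mono f2) auto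
      finally show "(\<integral>\<^sup>+x. ennreal (norm x powr (\<alpha> - 4) * (u x)\<^sup>2) \<partial>lborel) \<le> ennreal CR" by simp
      show "(\<integral>\<^sup>+x. ennreal (h x powr r) \<partial>lborel) \<le> ennreal CH"
        unfolding r_def by (rule hls[OF _ g2]) (use g0 h0 h_le in \<open>simp add: riesz2_majorised_def\<close>)
    qed auto
    also have "\<dots> = ennreal ((M + 1) * CR + \<kappa> powr r * CH)"
      using M CR CH by (simp add: ennreal_mult'[symmetric] ennreal_plus[symmetric] del: ennreal_plus)
    finally show "(\<integral>\<^sup>+x. ennreal (norm x powr l * u x powr q) \<partial>lborel) \<le> ennreal ((M + 1) * CR + \<kappa> powr r * CH)" .
  qed
qed

section \<open>Test functions as Newtonian potentials\<close>

text \<open>The kernel \<open>|z|^(2-N)\<close> with \<open>|z|^2\<close> replaced by \<open>|z|^2 + d\<close>, and the kernel itself for \<open>d = 0\<close>.\<close>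

definition riesz_reg :: "real \<Rightarrow> real^'n::finite \<Rightarrow> real" where
  "riesz_reg d z = (z \<bullet> z + d) powr ((2 - real CARD('n)) / 2)"

lemma riesz_reg_0: "riesz_reg 0 z = norm (z::real^'n::finite) powr (2 - real CARD('n))"
proof (cases "z = 0")
  case False
  then have "z \<bullet> z = norm z powr 2" by (simp add: power2_norm_eq_inner[symmetric] powr_numeral)
  then show ?thesis unfolding riesz_reg_def add_0_right by (simp only: powr_powr) (simp add: diff_divide_distrib)
qed (simp add: riesz_reg_def)

lemma riesz_reg_nonneg [simp]: "riesz_reg d z \<ge> 0"
  by (simp add: riesz_reg_def)

lemma riesz_reg_measurable [measurable]: "riesz_reg d \<in> borel_measurable borel"
  unfolding riesz_reg_def[abs_def] by measurable

lemma riesz_reg_minus: "riesz_reg d (x - y) = riesz_reg d (y - x)"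
  by (simp add: riesz_reg_def inner_diff_left inner_diff_right algebra_simps)

lemma riesz_reg_le:
  assumes "d \<ge> 0" "z \<noteq> 0" "real CARD('n::finite) \<ge> 2"
  shows "riesz_reg d z \<le> riesz_reg 0 (z::real^'n)"
  unfolding riesz_reg_def using assms by (intro powr_mono2') auto

lemma riesz_reg_le_const:
  assumes "d > 0" "real CARD('n::finite) \<ge> 2"
  shows "riesz_reg d (z::real^'n) \<le> d powr ((2 - real CARD('n)) / 2)"
  unfolding riesz_reg_def using assms by (intro powr_mono2') auto

lemma continuous_on_riesz_reg: "d > 0 \<Longrightarrow> continuous_on S (riesz_reg d)"
  unfolding riesz_reg_def[abs_def]
  by (intro continuous_intros) (simp add: add_nonneg_eq_0_iff)

lemma riesz_reg_tendsto:
  assumes "z \<noteq> 0" "d \<longlonglongrightarrow> 0"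
  shows "(\<lambda>n. riesz_reg (d n) z) \<longlonglongrightarrow> riesz_reg 0 (z::real^'n::finite)"
  unfolding riesz_reg_def using assms by (intro tendsto_intros) auto

lemma AE_lborel_neq: "AE x in lborel. x \<noteq> (a :: 'a :: euclidean_space)"
  by (rule AE_I[of _ _ "{a}"]) auto

lemma emeasure_lborel_cball_less_top: "emeasure lborel (cball (a :: 'a :: euclidean_space) r) < \<infinity>"
  by (rule emeasure_bounded_finite) simp

text \<open>The extremal functions of Sobolev inequalities have this shape, whence the name.\<close>

lemma integrable_bubble:
  fixes b :: real
  assumes b: "2 * b < - real CARD('n::finite)"
  shows "integrable lborel (\<lambda>z::real^'n. (z \<bullet> z + 1) powr b)"
proof (rule integrableI_nonneg)
  let ?N = "real CARD('n)"
  obtain C where C: "C \<ge> 0" "\<And>r. r > 0 \<Longrightarrow>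
    (\<integral>\<^sup>+x. ennreal (norm x powr (2 * b)) * indicator (- ball 0 r) (x::real^'n) \<partial>lborel) \<le> ennreal (C * r powr (2 * b + ?N))"
    using nn_integral_norm_powr_outside_ball[where 'n='n, OF b] by blast
  define f1 where "f1 z = ennreal (norm z powr (2 * b)) * indicator (- ball 0 1) z" for z :: "real^'n"
  have [measurable]: "f1 \<in> borel_measurable borel"
    unfolding f1_def by (intro borel_measurable_times_ennreal borel_measurable_indicator; simp)
  have "(\<integral>\<^sup>+z. ennreal ((z \<bullet> z + 1) powr b) \<partial>(lborel :: (real^'n) measure)) \<le> (\<integral>\<^sup>+z. indicator (ball 0 1) z + f1 z \<partial>lborel)"
  proof (rule nn_integral_mono)
    fix z :: "real^'n"
    show "ennreal ((z \<bullet> z + 1) powr b) \<le> indicator (ball 0 1) z + f1 z"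
    proof (cases "z \<in> ball 0 1")
      case True
      have "(z \<bullet> z + 1) powr b \<le> 1 powr b" using b by (intro powr_mono2') auto
      then show ?thesis using True by (simp add: add_increasing2)
    next
      case False
      then have z: "norm z \<ge> 1" by simp
      have "(z \<bullet> z + 1) powr b \<le> (z \<bullet> z) powr b" using b z by (intro powr_mono2') auto
      also have "(z \<bullet> z) powr b = norm z powr (2 * b)"
      proof -
        have e: "z \<bullet> z = norm z powr 2" by (simp add: power2_norm_eq_inner[symmetric] powr_numeral)
        show ?thesis unfolding e by (rule powr_powr)
      qed
      finally have "ennreal ((z \<bullet> z + 1) powr b) \<le> ennreal (norm z powr (2 * b))" by (rule ennreal_leI)
      then show ?thesis using False by (simp add: f1_def)
    qed
  qed
  also have "\<dots> = emeasure lborel (ball (0::real^'n) 1) + integral\<^sup>N lborel f1"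
    by (subst nn_integral_add) (auto intro!: borel_measurable_indicator)
  also have "\<dots> < \<infinity>"
    using C(2)[of 1] emeasure_bounded_finite[OF bounded_ball, of "0::real^'n" 1]
    unfolding f1_def by (auto simp: less_top[symmetric] top_unique)
  finally show "(\<integral>\<^sup>+z. ennreal ((z \<bullet> z + 1) powr b) \<partial>(lborel :: (real^'n) measure)) < \<infinity>" .
qed auto

text \<open>The total mass of the bump \<open>- \<Delta> (|x|^2 + d)^((2-N)/2)\<close>, which is the same for all \<open>d > 0\<close>; for
  \<open>d = 1\<close> it is this integral.\<close>

definition bubble_mass :: "'n::finite itself \<Rightarrow> real" where
  "bubble_mass _ = real CARD('n) * (real CARD('n) - 2) *
     (\<integral>z. ((z::real^'n) \<bullet> z + 1) powr ((2 - real CARD('n)) / 2 - 2) \<partial>lborel)"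

lemma bubble_mass_pos:
  assumes "real CARD('n::finite) > 2" shows "bubble_mass TYPE('n) > 0"
proof -
  let ?f = "\<lambda>z::real^'n. (z \<bullet> z + 1) powr ((2 - real CARD('n)) / 2 - 2)"
  have int: "integrable lborel ?f" by (rule integrable_bubble) (simp add: field_simps)
  have pos: "?f z > 0" for z by (simp add: add_nonneg_eq_0_iff)
  have "(\<integral>z. ?f z \<partial>lborel) \<noteq> 0"
  proof
    assume "(\<integral>z. ?f z \<partial>lborel) = 0"
    then have "AE z in lborel. ?f z = 0" using int by (subst (asm) integral_nonneg_eq_0_iff_AE) auto
    then have "AE z in (lborel :: (real^'n) measure). False"
      by eventually_elim (use pos in \<open>metis less_irrefl\<close>)
    then show False by (simp add: AE_iff_null null_sets_def emeasure_lborel_UNIV)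
  qed
  then have "(\<integral>z. ?f z \<partial>lborel) > 0" by (simp add: less_le integral_nonneg_AE)
  then show ?thesis using assms by (simp add: bubble_mass_def)
qed

lemma laplacian_continuous:
  assumes "C_k 2 (\<phi> :: real^'n::finite \<Rightarrow> real)" shows "continuous_on UNIV (laplacian \<phi>)"
  using assms unfolding laplacian_def[abs_def] numeral_2_eq_2 by (auto intro!: continuous_on_sum)

lemma laplacian_vanishing:
  assumes "compact (K :: (real^'n::finite) set)" "\<And>x. x \<notin> K \<Longrightarrow> \<phi> x = 0" "x \<notin> K"
  shows "laplacian \<phi> x = 0"
proof -
  have "partial_deriv i \<phi> y = 0" if "y \<notin> K" for i y using vanishing_partial_deriv[OF assms(1,2) that] .
  from vanishing_partial_deriv[OF assms(1) this assms(3)] show ?thesis by (simp add: laplacian_def)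
qed

lemma nn_integral_riesz_ball_finite:
  obtains C where "C \<ge> 0" "(\<integral>\<^sup>+z. ennreal (riesz_reg 0 z) * indicator (ball 0 R) (z::real^'n::finite) \<partial>lborel) \<le> ennreal C"
proof (cases "R > 0")
  case True
  obtain C where C: "C \<ge> 0" "\<And>r. r > 0 \<Longrightarrow>
    (\<integral>\<^sup>+x. ennreal (norm x powr (2 - real CARD('n))) * indicator (ball 0 r) (x::real^'n) \<partial>lborel) \<le> ennreal (C * r powr (2 - real CARD('n) + real CARD('n)))"
    using nn_integral_norm_powr_ball[where 'n='n and a="2 - real CARD('n)"] by auto
  show ?thesis using C True by (intro that[of "C * R powr (2 - real CARD('n) + real CARD('n))"]) (auto simp: riesz_reg_0)
next
  case False
  then have e: "ball (0::real^'n) R = {}" by simp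
  show ?thesis by (rule that[of 0], simp, unfold e) simp
qed

lemma integrable_riesz_kernel_times:
  fixes f :: "real^'n::finite \<Rightarrow> real"
  assumes K: "compact K" "\<And>x. x \<notin> K \<Longrightarrow> f x = 0" and f: "continuous_on UNIV f"
  shows "integrable lborel (\<lambda>y. riesz_reg 0 (x - y) * f y)"
proof -
  have [measurable]: "f \<in> borel_measurable borel" using f by (rule borel_measurable_continuous_onI)
  obtain B where B: "B > 0" "\<And>x. \<bar>f x\<bar> \<le> B" using compactly_supported_bounded[OF K f] by blast
  obtain R where R: "\<And>y. y \<in> K \<Longrightarrow> norm y \<le> R" using compact_imp_bounded[OF K(1)] by (auto simp: bounded_iff)
  obtain C where C: "C \<ge> 0" "(\<integral>\<^sup>+z. ennreal (riesz_reg 0 z) * indicator (ball 0 (norm x + R + 1)) (z::real^'n) \<partial>lborel) \<le> ennreal C"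
    by (rule nn_integral_riesz_ball_finite)
  define f1 where "f1 z = ennreal (riesz_reg 0 z) * indicator (ball 0 (norm x + R + 1)) (z::real^'n)" for z
  have [measurable]: "f1 \<in> borel_measurable borel"
    unfolding f1_def by (intro borel_measurable_times_ennreal borel_measurable_indicator; simp)
  have "(\<integral>\<^sup>+y. ennreal (norm (riesz_reg 0 (x - y) * f y)) \<partial>lborel) \<le> (\<integral>\<^sup>+y. ennreal B * f1 (x - y) \<partial>lborel)"
  proof (rule nn_integral_mono)
    fix y
    show "ennreal (norm (riesz_reg 0 (x - y) * f y)) \<le> ennreal B * f1 (x - y)"
    proof (cases "y \<in> K")
      case True
      have "norm (x - y) \<le> norm x + norm y" by (rule norm_triangle_ineq4)
      then have 1: "indicator (ball 0 (norm x + R + 1)) (x - y) = (1::ennreal)"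
        using R[OF True] by (auto simp: indicator_def)
      have "norm (riesz_reg 0 (x - y) * f y) \<le> B * riesz_reg 0 (x - y)"
        using mult_left_mono[OF B(2)[of y] riesz_reg_nonneg[of 0 "x - y"]] by (simp add: abs_mult mult.commute)
      then have "ennreal (norm (riesz_reg 0 (x - y) * f y)) \<le> ennreal (B * riesz_reg 0 (x - y))" by (rule ennreal_leI)
      then show ?thesis unfolding f1_def 1 using B by (simp add: ennreal_mult')
    qed (simp add: K)
  qed
  also have "\<dots> = ennreal B * integral\<^sup>N lborel f1"
    by (simp add: nn_integral_cmult nn_integral_lborel_reflect)
  also have "\<dots> \<le> ennreal B * ennreal C" using C(2) unfolding f1_def by (rule mult_left_mono) simp
  also have "\<dots> < \<infinity>" by (simp add: ennreal_mult_less_top)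
  finally show ?thesis unfolding integrable_iff_bounded by simp
qed

text \<open>Apply Green's identity with the regularised kernel and let \<open>d\<close> tend to 0. On one side the kernel converges, dominated
  by its limit. On the other side, after the substitution \<open>y = x + sqrt(d) z\<close>, the bump no longer depends on \<open>d\<close> and
  \<open>\<phi>\<close> is evaluated at points that tend to \<open>x\<close>.\<close>

lemma potential_representation:
  fixes \<phi> :: "real^'n::finite \<Rightarrow> real"
  assumes N: "real CARD('n) > 2" and \<phi>: "C_k 2 \<phi>" and K: "compact K" "\<And>x. x \<notin> K \<Longrightarrow> \<phi> x = 0"
  shows "(\<integral>y. riesz_reg 0 (x - y) * laplacian \<phi> y \<partial>lborel) = - bubble_mass TYPE('n) * \<phi> x"
proof -
  let ?N = "real CARD('n)"
  define b where "b = (2 - ?N) / 2"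
  define d where "d n = inverse (real (Suc n))" for n
  have d: "d n > 0" for n by (simp add: d_def)
  have dlim: "d \<longlonglongrightarrow> 0" unfolding d_def by (rule LIMSEQ_inverse_real_of_nat)
  have cont\<phi>: "continuous_on UNIV \<phi>" using C_k_on_continuous[of 2 UNIV \<phi>] \<phi> by (simp add: C_k_on_UNIV)
  have contL: "continuous_on UNIV (laplacian \<phi>)" by (rule laplacian_continuous[OF \<phi>])
  have L0: "laplacian \<phi> y = 0" if "y \<notin> K" for y using laplacian_vanishing[OF K that] .
  have [measurable]: "\<phi> \<in> borel_measurable borel" "laplacian \<phi> \<in> borel_measurable borel"
    using cont\<phi> contL by (auto intro: borel_measurable_continuous_onI)
  obtain B where B: "B > 0" "\<And>x. \<bar>\<phi> x\<bar> \<le> B" using compactly_supported_bounded[OF K cont\<phi>] by blast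
  have eq: "(\<integral>y. riesz_reg (d n) (x - y) * laplacian \<phi> y \<partial>lborel)
    = - (?N * (?N - 2)) * (\<integral>z. (z \<bullet> z + 1) powr (b - 2) * \<phi> (x + sqrt (d n) *\<^sub>R z) \<partial>lborel)" for n
  proof -
    let ?w = "\<lambda>y. ((y - x) \<bullet> (y - x) + d n) powr b"
    have "{y. 0 < (y - x) \<bullet> (y - x) + d n} = UNIV" using d[of n] by (auto simp: add_nonneg_pos)
    then have w: "C_k 2 ?w" using C_k_on_regularised_power[of 2 x "d n" b] by (simp add: C_k_on_UNIV)
    have "(\<integral>y. riesz_reg (d n) (x - y) * laplacian \<phi> y \<partial>lborel) = (\<integral>y. ?w y * laplacian \<phi> y \<partial>lborel)"
      by (subst riesz_reg_minus) (simp add: riesz_reg_def b_def)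
    also have "\<dots> = (\<integral>y. laplacian ?w y * \<phi> y \<partial>lborel)" by (rule green_identity[OF \<phi> w K])
    also have "\<dots> = (\<integral>y. - (?N * (?N - 2)) * (d n * ((y - x) \<bullet> (y - x) + d n) powr (b - 2) * \<phi> y) \<partial>lborel)"
      by (simp add: laplacian_regularised_power[OF d b_def] mult_ac)
    also have "\<dots> = - (?N * (?N - 2)) * (\<integral>y. d n * ((y - x) \<bullet> (y - x) + d n) powr (b - 2) * \<phi> y \<partial>lborel)"
      by (rule integral_mult_right_zero)
    also have "(\<integral>y. d n * ((y - x) \<bullet> (y - x) + d n) powr (b - 2) * \<phi> y \<partial>lborel)
      = \<bar>sqrt (d n)\<bar> ^ DIM(real^'n) * (\<integral>z. d n * ((x + sqrt (d n) *\<^sub>R z - x) \<bullet> (x + sqrt (d n) *\<^sub>R z - x) + d n) powr (b - 2) * \<phi> (x + sqrt (d n) *\<^sub>R z) \<partial>lborel)"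
      using d[of n] by (intro integral_lborel_affine) auto
    also have "\<dots> = (\<integral>z. \<bar>sqrt (d n)\<bar> ^ DIM(real^'n) * (d n * ((x + sqrt (d n) *\<^sub>R z - x) \<bullet> (x + sqrt (d n) *\<^sub>R z - x) + d n) powr (b - 2) * \<phi> (x + sqrt (d n) *\<^sub>R z)) \<partial>lborel)"
      by (rule integral_mult_right_zero[symmetric])
    also have "\<dots> = (\<integral>z. (z \<bullet> z + 1) powr (b - 2) * \<phi> (x + sqrt (d n) *\<^sub>R z) \<partial>lborel)"
    proof (rule Bochner_Integration.integral_cong[OF refl])
      fix z :: "real^'n"
      \<comment> \<open>the powers of \<open>d\<close> from the Jacobian, from the factor \<open>d\<close> and from the bump cancel\<close>
      have s: "\<bar>sqrt (d n)\<bar> ^ DIM(real^'n) = d n powr (?N / 2)"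
        using d[of n] by (simp add: powr_half_sqrt[symmetric] powr_realpow[symmetric] powr_powr)
      have "(x + sqrt (d n) *\<^sub>R z - x) \<bullet> (x + sqrt (d n) *\<^sub>R z - x) + d n = d n * (z \<bullet> z + 1)"
        using d[of n] by (simp add: algebra_simps)
      then have Q: "((x + sqrt (d n) *\<^sub>R z - x) \<bullet> (x + sqrt (d n) *\<^sub>R z - x) + d n) powr (b - 2) = d n powr (b - 2) * (z \<bullet> z + 1) powr (b - 2)"
        by (simp only: powr_mult)
      have "d n powr (?N / 2) * d n powr 1 * d n powr (b - 2) = 1"
        using d[of n] unfolding powr_add[symmetric] by (simp add: b_def field_simps)
      then have "d n powr (?N / 2) * d n * d n powr (b - 2) = 1" using d[of n] by simp
      then show "\<bar>sqrt (d n)\<bar> ^ DIM(real^'n) * (d n * ((x + sqrt (d n) *\<^sub>R z - x) \<bullet> (x + sqrt (d n) *\<^sub>R z - x) + d n) powr (b - 2) * \<phi> (x + sqrt (d n) *\<^sub>R z))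
        = (z \<bullet> z + 1) powr (b - 2) * \<phi> (x + sqrt (d n) *\<^sub>R z)"
        unfolding s Q by (metis (no_types, lifting) mult.assoc mult.left_neutral)
    qed
    finally show ?thesis .
  qed
  have left: "(\<lambda>n. \<integral>y. riesz_reg (d n) (x - y) * laplacian \<phi> y \<partial>lborel) \<longlonglongrightarrow> (\<integral>y. riesz_reg 0 (x - y) * laplacian \<phi> y \<partial>lborel)"
  proof (rule integral_dominated_convergence)
    show "integrable lborel (\<lambda>y. norm (riesz_reg 0 (x - y) * laplacian \<phi> y))"
      using integrable_riesz_kernel_times[OF K(1) L0 contL] by (rule integrable_norm)
    show "AE y in lborel. (\<lambda>n. riesz_reg (d n) (x - y) * laplacian \<phi> y) \<longlonglongrightarrow> riesz_reg 0 (x - y) * laplacian \<phi> y"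
      using AE_lborel_neq[of x] by eventually_elim (intro tendsto_mult riesz_reg_tendsto dlim tendsto_const, simp)
    show "AE y in lborel. norm (riesz_reg (d n) (x - y) * laplacian \<phi> y) \<le> norm (riesz_reg 0 (x - y) * laplacian \<phi> y)" for n
      using AE_lborel_neq[of x]
    proof eventually_elim
      case (elim y)
      then have "riesz_reg (d n) (x - y) \<le> riesz_reg 0 (x - y)"
        using d[of n] N by (intro riesz_reg_le) auto
      then show ?case by (simp add: abs_mult mult_right_mono)
    qed
  qed measurable
  have right: "(\<lambda>n. \<integral>z. (z \<bullet> z + 1) powr (b - 2) * \<phi> (x + sqrt (d n) *\<^sub>R z) \<partial>lborel)
     \<longlonglongrightarrow> (\<integral>z. (z \<bullet> z + 1) powr (b - 2) * \<phi> x \<partial>(lborel :: (real^'n) measure))"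
  proof (rule integral_dominated_convergence)
    show "integrable lborel (\<lambda>z::real^'n. (z \<bullet> z + 1) powr (b - 2) * B)"
      by (intro integrable_mult_left integrable_bubble) (simp add: b_def field_simps)
    show "AE z in lborel. (\<lambda>n. (z \<bullet> z + 1) powr (b - 2) * \<phi> (x + sqrt (d n) *\<^sub>R z)) \<longlonglongrightarrow> (z \<bullet> z + 1) powr (b - 2) * \<phi> x"
    proof (rule AE_I2)
      fix z :: "real^'n"
      have "(\<lambda>n. x + sqrt (d n) *\<^sub>R z) \<longlonglongrightarrow> x + sqrt 0 *\<^sub>R z" by (intro tendsto_intros dlim)
      then have "(\<lambda>n. \<phi> (x + sqrt (d n) *\<^sub>R z)) \<longlonglongrightarrow> \<phi> x"
        using cont\<phi> by (auto simp: continuous_on_eq_continuous_at intro: isCont_tendsto_compose)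
      then show "(\<lambda>n. (z \<bullet> z + 1) powr (b - 2) * \<phi> (x + sqrt (d n) *\<^sub>R z)) \<longlonglongrightarrow> (z \<bullet> z + 1) powr (b - 2) * \<phi> x"
        by (intro tendsto_intros)
    qed
    show "AE z in lborel. norm ((z \<bullet> z + 1) powr (b - 2) * \<phi> (x + sqrt (d n) *\<^sub>R z)) \<le> (z \<bullet> z + 1) powr (b - 2) * B" for n
      using B by (auto simp: abs_mult intro!: mult_left_mono)
  qed measurable
  from tendsto_mult_left[OF right, of "- (?N * (?N - 2))"] left
  have "(\<integral>y. riesz_reg 0 (x - y) * laplacian \<phi> y \<partial>lborel) = - (?N * (?N - 2)) * (\<integral>z. (z \<bullet> z + 1) powr (b - 2) * \<phi> x \<partial>(lborel :: (real^'n) measure))"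
    unfolding eq by (rule LIMSEQ_unique[rotated])
  then show ?thesis by (simp add: bubble_mass_def b_def)
qed

lemma potential_bound:
  fixes \<phi> :: "real^'n::finite \<Rightarrow> real"
  assumes N: "real CARD('n) > 2" and \<phi>: "C_k 2 \<phi>" and K: "compact K" "\<And>x. x \<notin> K \<Longrightarrow> \<phi> x = 0"
  shows "ennreal (bubble_mass TYPE('n) * \<bar>\<phi> x\<bar>) \<le> riesz2 (\<lambda>y. \<bar>laplacian \<phi> y\<bar>) x"
proof -
  have int: "integrable lborel (\<lambda>y. riesz_reg 0 (x - y) * laplacian \<phi> y)"
    by (rule integrable_riesz_kernel_times[OF K(1) laplacian_vanishing[OF K] laplacian_continuous[OF \<phi>]])
  have "bubble_mass TYPE('n) * \<bar>\<phi> x\<bar> = norm (\<integral>y. riesz_reg 0 (x - y) * laplacian \<phi> y \<partial>lborel)"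
    using arg_cong[OF potential_representation[OF N \<phi> K, of x], of norm] bubble_mass_pos[OF N]
    by (simp add: abs_mult)
  then have "ennreal (bubble_mass TYPE('n) * \<bar>\<phi> x\<bar>) \<le> (\<integral>\<^sup>+y. ennreal (norm (riesz_reg 0 (x - y) * laplacian \<phi> y)) \<partial>lborel)"
    using integral_norm_bound_ennreal[OF int] by simp
  also have "\<dots> = riesz2 (\<lambda>y. \<bar>laplacian \<phi> y\<bar>) x"
    by (simp add: riesz2_def riesz_reg_0 abs_mult)
  finally show ?thesis .
qed

section \<open>Compactness in the space of integrable functions\<close>

text \<open>Young's inequality for the convolution with an \<open>L^1\<close> function, where only the values of the kernel at differences of
  points of \<open>S\<close> count. The kernels used here are locally integrable but not integrable.\<close>

lemma nn_integral_convolution_local_le: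
  fixes J f :: "real^'n::finite \<Rightarrow> ennreal"
  assumes [measurable]: "J \<in> borel_measurable borel" "f \<in> borel_measurable borel" "S \<in> sets borel" "T \<in> sets borel"
    and f: "\<And>y. y \<notin> S \<Longrightarrow> f y = 0" and diff: "\<And>x y. x \<in> S \<Longrightarrow> y \<in> S \<Longrightarrow> x - y \<in> T"
  shows "(\<integral>\<^sup>+x. (\<integral>\<^sup>+y. J (x - y) * f y \<partial>lborel) * indicator S x \<partial>lborel)
     \<le> (\<integral>\<^sup>+z. J z * indicator T z \<partial>lborel) * (\<integral>\<^sup>+y. f y \<partial>lborel)"
proof -
  define JT where "JT z = J z * indicator T z" for z
  have [measurable]: "JT \<in> borel_measurable borel" unfolding JT_def by measurable
  have "(\<integral>\<^sup>+x. (\<integral>\<^sup>+y. J (x - y) * f y \<partial>lborel) * indicator S x \<partial>lborel)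
    = (\<integral>\<^sup>+x. (\<integral>\<^sup>+y. J (x - y) * f y * indicator S x \<partial>lborel) \<partial>lborel)"
    by (simp add: nn_integral_multc)
  also have "\<dots> \<le> (\<integral>\<^sup>+x. (\<integral>\<^sup>+y. JT (x - y) * f y \<partial>lborel) \<partial>lborel)"
  proof (intro nn_integral_mono)
    fix x y show "J (x - y) * f y * indicator S x \<le> JT (x - y) * f y"
      using f[of y] diff[of x y] by (cases "y \<in> S"; cases "x \<in> S") (auto simp: JT_def)
  qed
  also have "\<dots> = (\<integral>\<^sup>+y. (\<integral>\<^sup>+x. JT (x - y) * f y \<partial>lborel) \<partial>lborel)"
    by (rule nn_integral_lborel_swap) measurable
  also have "\<dots> = (\<integral>\<^sup>+y. integral\<^sup>N lborel JT * f y \<partial>lborel)"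
  proof (rule nn_integral_cong)
    fix y
    have "(\<integral>\<^sup>+x. JT (x - y) \<partial>lborel) = integral\<^sup>N lborel JT"
      using nn_integral_lborel_affine[of JT 1 "- y"] by (simp add: algebra_simps)
    then show "(\<integral>\<^sup>+x. JT (x - y) * f y \<partial>lborel) = integral\<^sup>N lborel JT * f y"
      by (simp add: nn_integral_multc)
  qed
  also have "\<dots> = integral\<^sup>N lborel JT * (\<integral>\<^sup>+y. f y \<partial>lborel)" by (rule nn_integral_cmult) measurable
  finally show ?thesis unfolding JT_def .
qed

lemma diff_mem_ball_twice: "x \<in> cball 0 R \<Longrightarrow> y \<in> cball 0 R \<Longrightarrow> x - y \<in> ball (0::'a::real_normed_vector) (2 * R + 1)"
  using norm_triangle_ineq4[of x y] by simp

lemma laplacian_controls_L1: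
  assumes N: "real CARD('n::finite) > 2"
  obtains C where "C \<ge> 0" "\<And>(\<phi> :: real^'n \<Rightarrow> real) K. C_k 2 \<phi> \<Longrightarrow> compact K \<Longrightarrow> K \<subseteq> cball 0 R \<Longrightarrow> (\<And>x. x \<notin> K \<Longrightarrow> \<phi> x = 0) \<Longrightarrow>
     (\<integral>\<^sup>+x. ennreal \<bar>\<phi> x\<bar> \<partial>lborel) \<le> ennreal C * (\<integral>\<^sup>+x. ennreal \<bar>laplacian \<phi> x\<bar> \<partial>lborel)"
proof -
  define \<kappa> where "\<kappa> = bubble_mass TYPE('n)"
  have \<kappa>: "\<kappa> > 0" unfolding \<kappa>_def by (rule bubble_mass_pos[OF N])
  obtain C where C: "C \<ge> 0" "(\<integral>\<^sup>+z. ennreal (riesz_reg 0 z) * indicator (ball 0 (2 * R + 1)) (z::real^'n) \<partial>lborel) \<le> ennreal C"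
    by (rule nn_integral_riesz_ball_finite)
  show ?thesis
  proof
    show "C / \<kappa> \<ge> 0" using C \<kappa> by simp
    fix \<phi> :: "real^'n \<Rightarrow> real" and K
    assume \<phi>: "C_k 2 \<phi>" and K: "compact K" "K \<subseteq> cball 0 R" "\<And>x. x \<notin> K \<Longrightarrow> \<phi> x = 0"
    have contL: "continuous_on UNIV (laplacian \<phi>)" by (rule laplacian_continuous[OF \<phi>])
    have [measurable]: "laplacian \<phi> \<in> borel_measurable borel" "\<phi> \<in> borel_measurable borel"
      using contL C_k_on_continuous[of 2 UNIV \<phi>] \<phi> by (auto simp: C_k_on_UNIV intro: borel_measurable_continuous_onI)
    have L0: "laplacian \<phi> y = 0" if "y \<notin> K" for y by (rule laplacian_vanishing[OF K(1,3) that])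
    have LS: "laplacian \<phi> y = 0" if "y \<notin> cball 0 R" for y using L0 K(2) that by blast
    have "ennreal \<kappa> * (\<integral>\<^sup>+x. ennreal \<bar>\<phi> x\<bar> \<partial>lborel) = (\<integral>\<^sup>+x. ennreal (\<kappa> * \<bar>\<phi> x\<bar>) \<partial>lborel)"
      using \<kappa> by (simp add: nn_integral_cmult ennreal_mult')
    also have "\<dots> \<le> (\<integral>\<^sup>+x. (\<integral>\<^sup>+y. ennreal (riesz_reg 0 (x - y)) * ennreal \<bar>laplacian \<phi> y\<bar> \<partial>lborel) * indicator (cball 0 R) x \<partial>lborel)"
    proof (rule nn_integral_mono)
      fix x :: "real^'n"
      show "ennreal (\<kappa> * \<bar>\<phi> x\<bar>) \<le> (\<integral>\<^sup>+y. ennreal (riesz_reg 0 (x - y)) * ennreal \<bar>laplacian \<phi> y\<bar> \<partial>lborel) * indicator (cball 0 R) x"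
      proof (cases "x \<in> cball 0 R")
        case True
        have "ennreal (\<kappa> * \<bar>\<phi> x\<bar>) \<le> riesz2 (\<lambda>y. \<bar>laplacian \<phi> y\<bar>) x"
          unfolding \<kappa>_def by (rule potential_bound[OF N \<phi> K(1,3)])
        then show ?thesis using True by (simp add: riesz2_def riesz_reg_0 ennreal_mult')
      next
        case False
        then have "x \<notin> K" using K(2) by auto
        then show ?thesis by (simp add: K(3))
      qed
    qed
    also have "\<dots> \<le> (\<integral>\<^sup>+z. ennreal (riesz_reg 0 z) * indicator (ball 0 (2 * R + 1)) (z::real^'n) \<partial>lborel) * (\<integral>\<^sup>+y. ennreal \<bar>laplacian \<phi> y\<bar> \<partial>lborel)"
      by (rule nn_integral_convolution_local_le) (use LS diff_mem_ball_twice in \<open>auto simp del: mem_ball mem_cball\<close>)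
    also have "\<dots> \<le> ennreal C * (\<integral>\<^sup>+y. ennreal \<bar>laplacian \<phi> y\<bar> \<partial>lborel)"
      by (intro mult_right_mono C) auto
    finally have *: "ennreal \<kappa> * (\<integral>\<^sup>+x. ennreal \<bar>\<phi> x\<bar> \<partial>lborel) \<le> ennreal C * (\<integral>\<^sup>+y. ennreal \<bar>laplacian \<phi> y\<bar> \<partial>lborel)" .
    have "(\<integral>\<^sup>+x. ennreal \<bar>\<phi> x\<bar> \<partial>lborel) = ennreal (1 / \<kappa>) * (ennreal \<kappa> * (\<integral>\<^sup>+x. ennreal \<bar>\<phi> x\<bar> \<partial>lborel))"
      using \<kappa> by (simp add: mult.assoc[symmetric] ennreal_mult'[symmetric])
    also have "\<dots> \<le> ennreal (1 / \<kappa>) * (ennreal C * (\<integral>\<^sup>+y. ennreal \<bar>laplacian \<phi> y\<bar> \<partial>lborel))"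
      by (intro mult_left_mono *) auto
    also have "\<dots> = ennreal (C / \<kappa>) * (\<integral>\<^sup>+y. ennreal \<bar>laplacian \<phi> y\<bar> \<partial>lborel)"
      using \<kappa> C by (simp add: mult.assoc[symmetric] ennreal_mult'[symmetric])
    finally show "(\<integral>\<^sup>+x. ennreal \<bar>\<phi> x\<bar> \<partial>lborel) \<le> ennreal (C / \<kappa>) * (\<integral>\<^sup>+x. ennreal \<bar>laplacian \<phi> x\<bar> \<partial>lborel)" .
  qed
qed

text \<open>Convergence of the regularised kernels in \<open>L^1\<close> of a ball, which by Young's inequality is convergence of the operators
  on \<open>L^1\<close> functions supported in a ball.\<close>

lemma riesz_reg_L1_convergence:
  assumes N: "real CARD('n::finite) > 2" and d: "\<And>k. d k > 0" "d \<longlonglongrightarrow> 0"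
  obtains e where "e \<longlonglongrightarrow> (0::real)" "\<And>k. e k \<ge> 0"
    "\<And>k. (\<integral>\<^sup>+z. ennreal \<bar>riesz_reg 0 z - riesz_reg (d k) z\<bar> * indicator (ball 0 R) (z::real^'n) \<partial>lborel) \<le> ennreal (e k)"
proof -
  obtain C where C: "C \<ge> 0" "(\<integral>\<^sup>+z. ennreal (riesz_reg 0 z) * indicator (ball 0 R) (z::real^'n) \<partial>lborel) \<le> ennreal C"
    by (rule nn_integral_riesz_ball_finite)
  define T where "T = ball (0::real^'n) R"
  have [measurable]: "T \<in> sets borel" by (simp add: T_def)
  define h where "h k z = \<bar>riesz_reg 0 z - riesz_reg (d k) z\<bar> * indicator T z" for k z
  have [measurable]: "h k \<in> borel_measurable borel" for k unfolding h_def by measurable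
  have "(\<integral>\<^sup>+z. ennreal (norm (riesz_reg 0 z * indicator T z :: real)) \<partial>lborel) \<le> ennreal C"
  proof -
    have "ennreal (norm (riesz_reg 0 z * indicator T z :: real)) = ennreal (riesz_reg 0 z) * indicator (ball 0 R) z" for z
      by (simp add: T_def indicator_def)
    then show ?thesis using C(2) by simp
  qed
  then have int0: "integrable lborel (\<lambda>z. riesz_reg 0 z * indicator T z :: real)"
    unfolding integrable_iff_bounded by (auto simp: less_top[symmetric] top_unique)
  have dom: "AE z in lborel. norm (h k z) \<le> riesz_reg 0 z * indicator T z" for k
    using AE_lborel_neq[of 0]
  proof eventually_elim
    case (elim z)
    then have "riesz_reg (d k) z \<le> riesz_reg 0 z" using d(1)[of k] N by (intro riesz_reg_le) auto
    then have "\<bar>riesz_reg 0 z - riesz_reg (d k) z\<bar> \<le> riesz_reg 0 z" using riesz_reg_nonneg[of "d k" z] by linarith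
    then show ?case by (auto simp: h_def indicator_def)
  qed
  have int: "integrable lborel (h k)" for k
    by (rule Bochner_Integration.integrable_bound[OF int0]) (use dom[of k] in \<open>auto elim: eventually_mono\<close>)
  show ?thesis
  proof
    show "(\<lambda>k. \<integral>z. h k z \<partial>lborel) \<longlonglongrightarrow> 0"
    proof -
      have "(\<lambda>k. \<integral>z. h k z \<partial>lborel) \<longlonglongrightarrow> (\<integral>z. 0 \<partial>(lborel :: (real^'n) measure))"
      proof (rule integral_dominated_convergence[OF _ _ int0 _ dom])
        show "AE z in lborel. (\<lambda>k. h k z) \<longlonglongrightarrow> 0"
          using AE_lborel_neq[of 0]
        proof eventually_elim
          case (elim z)
          have "(\<lambda>k. \<bar>riesz_reg 0 z - riesz_reg (d k) z\<bar> * indicator T z) \<longlonglongrightarrow> \<bar>riesz_reg 0 z - riesz_reg 0 z\<bar> * indicator T z"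
            by (intro tendsto_intros riesz_reg_tendsto elim d)
          then show ?case by (simp add: h_def)
        qed
      qed measurable
      then show ?thesis by simp
    qed
    show "(\<integral>z. h k z \<partial>lborel) \<ge> 0" for k by (intro integral_nonneg_AE) (auto simp: h_def)
    show "(\<integral>\<^sup>+z. ennreal \<bar>riesz_reg 0 z - riesz_reg (d k) z\<bar> * indicator (ball 0 R) (z::real^'n) \<partial>lborel) \<le> ennreal (\<integral>z. h k z \<partial>lborel)" for k
    proof -
      have "(\<integral>\<^sup>+z. ennreal (h k z) \<partial>lborel) = ennreal (\<integral>z. h k z \<partial>lborel)"
        by (rule nn_integral_eq_integral[OF int]) (auto simp: h_def)
      moreover have "ennreal (h k z) = ennreal \<bar>riesz_reg 0 z - riesz_reg (d k) z\<bar> * indicator (ball 0 R) z" for z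
        by (simp add: h_def T_def indicator_def)
      ultimately show ?thesis by simp
    qed
  qed
qed

text \<open>The smoothed kernel is bounded and uniformly continuous on compact sets, so it maps a bounded sequence of \<open>L^1\<close> to a
  bounded equicontinuous sequence.\<close>

lemma uniformly_cauchy_subsequence_smoothed_potentials:
  fixes f :: "nat \<Rightarrow> real^'n::finite \<Rightarrow> real"
  assumes N: "real CARD('n) > 2" and d: "d > 0" and A: "A \<ge> 0"
    and f: "\<And>n. integrable lborel (f n)" "\<And>n y. y \<notin> cball 0 R \<Longrightarrow> f n y = 0"
       "\<And>n. (\<integral>y. \<bar>f n y\<bar> \<partial>lborel) \<le> A"
  shows "\<exists>r. strict_mono (r :: nat \<Rightarrow> nat) \<and> (\<forall>e>0. \<exists>M. \<forall>m\<ge>M. \<forall>n\<ge>M. \<forall>x\<in>cball 0 R.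
     \<bar>(\<integral>y. riesz_reg d (x - y) * f (r m) y \<partial>lborel) - (\<integral>y. riesz_reg d (x - y) * f (r n) y \<partial>lborel)\<bar> < e)"
proof -
  define F where "F n x = (\<integral>y. riesz_reg d (x - y) * f n y \<partial>lborel)" for n x
  let ?c = "d powr ((2 - real CARD('n)) / 2)"
  have [measurable]: "f n \<in> borel_measurable borel" for n using f(1)[of n] by (simp add: integrable_iff_bounded)
  have le: "riesz_reg d z \<le> ?c" for z :: "real^'n" using d N by (intro riesz_reg_le_const) auto
  have int: "integrable lborel (\<lambda>y. riesz_reg d (x - y) * f n y)" for n x
    by (rule Bochner_Integration.integrable_bound[of _ "\<lambda>y. ?c * f n y"])
       (auto intro!: integrable_mult_right f mult_right_mono le simp: abs_mult)
  have bound: "norm (F n x) \<le> ?c * A" for n x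
  proof -
    have "norm (F n x) \<le> (\<integral>y. norm (riesz_reg d (x - y) * f n y) \<partial>lborel)" unfolding F_def by (rule integral_norm_bound)
    also have "\<dots> \<le> (\<integral>y. ?c * \<bar>f n y\<bar> \<partial>lborel)"
      by (intro integral_mono integrable_norm int integrable_mult_right integrable_abs f)
         (auto intro!: mult_right_mono le simp: abs_mult)
    also have "\<dots> \<le> ?c * A" using f(3)[of n] by (simp add: mult_left_mono)
    finally show ?thesis .
  qed
  have equi: "\<exists>\<delta>>0. \<forall>n y. y \<in> cball 0 R \<and> norm (x - y) < \<delta> \<longrightarrow> norm (F n x - F n y) < e"
    if x: "x \<in> cball 0 R" and e: "e > 0" for x e
  proof -
    have uc: "uniformly_continuous_on (cball 0 (2 * R)) (riesz_reg d :: real^'n \<Rightarrow> real)"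
      by (rule compact_uniformly_continuous[OF continuous_on_riesz_reg[OF d] compact_cball])
    define e' where "e' = e / (A + 1)"
    have e': "e' > 0" using e A by (simp add: e'_def)
    obtain \<delta> where \<delta>: "\<delta> > 0" "\<And>u v :: real^'n. u \<in> cball 0 (2 * R) \<Longrightarrow> v \<in> cball 0 (2 * R) \<Longrightarrow> dist u v < \<delta> \<Longrightarrow> dist (riesz_reg d u) (riesz_reg d v) < e'"
      using uc e' unfolding uniformly_continuous_on_def by metis
    show ?thesis
    proof (intro exI[of _ \<delta>] conjI allI impI \<delta>(1))
      fix n x' assume x': "x' \<in> cball 0 R \<and> norm (x - x') < \<delta>"
      have pw: "norm (riesz_reg d (x - y) * f n y - riesz_reg d (x' - y) * f n y) \<le> e' * \<bar>f n y\<bar>" for y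
      proof (cases "y \<in> cball 0 R")
        case True
        have "x - y \<in> cball 0 (2 * R)" "x' - y \<in> cball 0 (2 * R)"
          using x x' True norm_triangle_ineq4[of x y] norm_triangle_ineq4[of x' y] by auto
        then have "dist (riesz_reg d (x - y)) (riesz_reg d (x' - y)) < e'"
          using x' by (intro \<delta>(2)) (auto simp: dist_norm)
        then show ?thesis
          unfolding left_diff_distrib[symmetric] by (simp add: dist_real_def abs_mult mult_right_mono)
      qed (use f(2) in simp)
      have "norm (F n x - F n x') = norm (\<integral>y. riesz_reg d (x - y) * f n y - riesz_reg d (x' - y) * f n y \<partial>lborel)"
        unfolding F_def using int by (simp add: Bochner_Integration.integral_diff)
      also have "\<dots> \<le> (\<integral>y. norm (riesz_reg d (x - y) * f n y - riesz_reg d (x' - y) * f n y) \<partial>lborel)" by (rule integral_norm_bound)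
      also have "\<dots> \<le> (\<integral>y. e' * \<bar>f n y\<bar> \<partial>lborel)"
        by (intro integral_mono pw integrable_norm Bochner_Integration.integrable_diff int integrable_mult_right integrable_abs f)
      also have "\<dots> \<le> e' * A" using f(3)[of n] e' by (simp add: mult_left_mono)
      also have "\<dots> < e" using e A by (simp add: e'_def field_simps)
      finally show "norm (F n x - F n x') < e" .
    qed
  qed
  obtain g k where k: "strict_mono (k :: nat \<Rightarrow> nat)"
     "\<And>e. 0 < e \<Longrightarrow> \<exists>N. \<forall>n x. n \<ge> N \<and> x \<in> cball 0 R \<longrightarrow> norm (F (k n) x - g x) < e"
    using Arzela_Ascoli[OF compact_cball[of "0::real^'n" R], of F "?c * A"] bound equi by metis
  show ?thesis
  proof (intro exI[of _ k] conjI k(1) allI impI)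
    fix e :: real assume "e > 0"
    then obtain M where M: "\<And>n x. n \<ge> M \<Longrightarrow> x \<in> cball 0 R \<Longrightarrow> norm (F (k n) x - g x) < e / 2"
      using k(2)[of "e / 2"] by auto
    show "\<exists>M. \<forall>m\<ge>M. \<forall>n\<ge>M. \<forall>x\<in>cball 0 R.
     \<bar>(\<integral>y. riesz_reg d (x - y) * f (k m) y \<partial>lborel) - (\<integral>y. riesz_reg d (x - y) * f (k n) y \<partial>lborel)\<bar> < e"
      unfolding F_def[symmetric]
    proof (intro exI[of _ M] allI impI ballI)
      fix m n and x :: "real^'n" assume "M \<le> m" "M \<le> n" "x \<in> cball 0 R"
      with M[of m x] M[of n x] show "\<bar>F (k m) x - F (k n) x\<bar> < e" unfolding real_norm_def by linarith
    qed
  qed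
qed

text \<open>The functions are potentials of their Laplacians, and the potential operator is a limit of the compact operators of the
  preceding lemma. A diagonal sequence makes the smoothed potentials Cauchy for every regularisation parameter
  \<open>d k\<close>.\<close>

lemma L1_compactness:
  fixes \<phi> :: "nat \<Rightarrow> real^'n::finite \<Rightarrow> real"
  assumes N: "real CARD('n) > 2" and \<phi>: "\<And>n. C_k 2 (\<phi> n)"
    and K: "\<And>n. compact (K n)" "\<And>n. K n \<subseteq> cball 0 R" "\<And>n x. x \<notin> K n \<Longrightarrow> \<phi> n x = 0"
    and A: "A \<ge> 0" "\<And>n. (\<integral>\<^sup>+x. ennreal \<bar>laplacian (\<phi> n) x\<bar> \<partial>lborel) \<le> ennreal A"
  obtains r where "strict_mono (r :: nat \<Rightarrow> nat)"
    "\<And>e. e > 0 \<Longrightarrow> \<exists>M. \<forall>m\<ge>M. \<forall>n\<ge>M. (\<integral>\<^sup>+x. ennreal \<bar>\<phi> (r m) x - \<phi> (r n) x\<bar> \<partial>lborel) \<le> ennreal e"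
proof -
  define f where "f n = laplacian (\<phi> n)" for n
  define S where "S = cball (0::real^'n) R"
  have [measurable]: "S \<in> sets borel" by (simp add: S_def)
  have contf: "continuous_on UNIV (f n)" for n unfolding f_def by (rule laplacian_continuous[OF \<phi>])
  have [measurable]: "f n \<in> borel_measurable borel" "\<phi> n \<in> borel_measurable borel" for n
    using contf C_k_on_continuous[of 2 UNIV "\<phi> n"] \<phi> by (auto simp: C_k_on_UNIV intro: borel_measurable_continuous_onI)
  have fK: "f n y = 0" if "y \<notin> K n" for n y unfolding f_def by (rule laplacian_vanishing[OF K(1,3) that])
  have fS: "f n y = 0" if "y \<notin> S" for n y using that K(2)[of n] unfolding S_def by (intro fK) blast
  have intf: "integrable lborel (f n)" for n by (rule compactly_supported_integrable[OF K(1) fK contf])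
  have fA: "(\<integral>y. \<bar>f n y\<bar> \<partial>lborel) \<le> A" for n
  proof -
    have "ennreal (\<integral>y. \<bar>f n y\<bar> \<partial>lborel) = (\<integral>\<^sup>+y. ennreal \<bar>f n y\<bar> \<partial>lborel)"
      using intf by (intro nn_integral_eq_integral[symmetric]) auto
    also have "\<dots> \<le> ennreal A" unfolding f_def by (rule A)
    finally show ?thesis using A(1) by (simp add: ennreal_le_iff)
  qed
  define d where "d k = inverse (real (Suc k))" for k
  have d: "d k > 0" for k by (simp add: d_def)
  have dlim: "d \<longlonglongrightarrow> 0" unfolding d_def by (rule LIMSEQ_inverse_real_of_nat)
  define F where "F k n x = (\<integral>y. riesz_reg (d k) (x - y) * f n y \<partial>lborel)" for k n x
  define P where "P k s \<longleftrightarrow> (\<forall>e>0. \<exists>M. \<forall>m\<ge>M. \<forall>n\<ge>M. \<forall>x\<in>S. \<bar>F k (s m) x - F k (s n) x\<bar> < e)" for k and s :: "nat \<Rightarrow> nat"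
  interpret subseqs P
  proof
    fix k and s :: "nat \<Rightarrow> nat"
    show "\<exists>r'. strict_mono r' \<and> P k (s \<circ> r')"
      using uniformly_cauchy_subsequence_smoothed_potentials[OF N d[of k] A(1), of "\<lambda>n. f (s n)" R] intf fS fA
      unfolding P_def F_def S_def comp_def by auto
  qed
  have stable: "P k (s \<circ> r)" if r: "strict_mono r" and s: "P k s" for r s :: "nat \<Rightarrow> nat" and k
    unfolding P_def
  proof (intro allI impI)
    fix e :: real assume "e > 0"
    then obtain M where M: "\<forall>m\<ge>M. \<forall>n\<ge>M. \<forall>x\<in>S. \<bar>F k (s m) x - F k (s n) x\<bar> < e" using s unfolding P_def by blast
    then show "\<exists>M. \<forall>m\<ge>M. \<forall>n\<ge>M. \<forall>x\<in>S. \<bar>F k ((s \<circ> r) m) x - F k ((s \<circ> r) n) x\<bar> < e"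
      using seq_suble[OF r] by (intro exI[of _ M]) (auto intro: order_trans)
  qed
  define D where "D = diagseq"
  have D_mono: "strict_mono D" unfolding D_def by (rule subseq_diagseq)
  have D: "P k (D \<circ> (+) (Suc k))" for k
    unfolding D_def by (rule diagseq_holds) (rule stable)
  have P: "P k D" for k
    unfolding P_def
  proof (intro allI impI)
    fix e :: real assume "e > 0"
    then obtain M where M: "\<And>m n x. m \<ge> M \<Longrightarrow> n \<ge> M \<Longrightarrow> x \<in> S \<Longrightarrow> \<bar>F k (D (Suc k + m)) x - F k (D (Suc k + n)) x\<bar> < e"
      using D[of k] unfolding P_def comp_def by blast
    show "\<exists>M. \<forall>m\<ge>M. \<forall>n\<ge>M. \<forall>x\<in>S. \<bar>F k (D m) x - F k (D n) x\<bar> < e"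
    proof (intro exI[of _ "Suc k + M"] allI impI ballI)
      fix m n x assume "Suc k + M \<le> m" "Suc k + M \<le> n" "x \<in> S"
      then show "\<bar>F k (D m) x - F k (D n) x\<bar> < e"
        using M[of "m - Suc k" "n - Suc k" x] by simp
    qed
  qed
  obtain err where err: "err \<longlonglongrightarrow> (0::real)" "\<And>k. err k \<ge> 0"
    "\<And>k. (\<integral>\<^sup>+z. ennreal \<bar>riesz_reg 0 z - riesz_reg (d k) z\<bar> * indicator (ball 0 (2 * R + 1)) (z::real^'n) \<partial>lborel) \<le> ennreal (err k)"
    using riesz_reg_L1_convergence[where d=d, OF N d dlim] by blast
  define \<kappa> where "\<kappa> = bubble_mass TYPE('n)"
  have \<kappa>: "\<kappa> > 0" unfolding \<kappa>_def by (rule bubble_mass_pos[OF N])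
  define H where "H k n x = (\<integral>\<^sup>+y. ennreal \<bar>riesz_reg 0 (x - y) - riesz_reg (d k) (x - y)\<bar> * ennreal \<bar>f n y\<bar> \<partial>lborel)" for k n x
  have [measurable]: "H k n \<in> borel_measurable borel" for k n unfolding H_def by measurable
  have H: "(\<integral>\<^sup>+x. H k n x * indicator S x \<partial>lborel) \<le> ennreal (err k * A)" for k n
  proof -
    have "(\<integral>\<^sup>+x. H k n x * indicator S x \<partial>lborel)
      \<le> (\<integral>\<^sup>+z. ennreal \<bar>riesz_reg 0 z - riesz_reg (d k) z\<bar> * indicator (ball 0 (2 * R + 1)) (z::real^'n) \<partial>lborel) * (\<integral>\<^sup>+y. ennreal \<bar>f n y\<bar> \<partial>lborel)"
      unfolding H_def by (rule nn_integral_convolution_local_le) (use fS diff_mem_ball_twice in \<open>auto simp: S_def simp del: mem_ball mem_cball\<close>)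
    also have "\<dots> \<le> ennreal (err k) * ennreal A"
      using A(2)[of n] unfolding f_def by (intro mult_mono err) auto
    finally show ?thesis using err(2) by (simp add: ennreal_mult')
  qed
  have approx: "ennreal \<bar>\<kappa> * \<phi> n x + F k n x\<bar> \<le> H k n x" for k n x
  proof -
    let ?c = "d k powr ((2 - real CARD('n)) / 2)"
    have i0: "integrable lborel (\<lambda>y. riesz_reg 0 (x - y) * f n y)"
      by (rule integrable_riesz_kernel_times[OF K(1) fK contf])
    have i1: "integrable lborel (\<lambda>y. riesz_reg (d k) (x - y) * f n y)"
      by (rule Bochner_Integration.integrable_bound[of _ "\<lambda>y. ?c * f n y"])
         (use d[of k] N in \<open>auto intro!: integrable_mult_right intf mult_right_mono riesz_reg_le_const simp: abs_mult\<close>)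
    have "\<kappa> * \<phi> n x = - (\<integral>y. riesz_reg 0 (x - y) * f n y \<partial>lborel)"
      unfolding \<kappa>_def f_def by (subst potential_representation[OF N \<phi> K(1,3)]) simp_all
    then have "\<kappa> * \<phi> n x + F k n x = (\<integral>y. riesz_reg (d k) (x - y) * f n y - riesz_reg 0 (x - y) * f n y \<partial>lborel)"
      using i0 i1 by (simp add: F_def Bochner_Integration.integral_diff)
    then have "ennreal \<bar>\<kappa> * \<phi> n x + F k n x\<bar> \<le> (\<integral>\<^sup>+y. ennreal (norm (riesz_reg (d k) (x - y) * f n y - riesz_reg 0 (x - y) * f n y)) \<partial>lborel)"
      using integral_norm_bound_ennreal[OF Bochner_Integration.integrable_diff[OF i1 i0]] by simp
    also have "\<dots> = H k n x"
      unfolding H_def left_diff_distrib[symmetric] by (simp add: abs_mult ennreal_mult' abs_minus_commute)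
    finally show ?thesis .
  qed
  show ?thesis
  proof (rule that[OF D_mono])
    fix e :: real assume e: "e > 0"
    define V where "V = measure lborel S"
    have V: "emeasure lborel S = ennreal V" "V \<ge> 0"
      using emeasure_lborel_cball_less_top[of "0::real^'n" R] by (auto simp: V_def S_def emeasure_eq_ennreal_measure)
    define \<eta> where "\<eta> = \<kappa> * e / (2 * (V + 1))"
    have \<eta>: "\<eta> > 0" using \<kappa> e V by (simp add: \<eta>_def)
    have "(\<lambda>k. 2 * (err k * A)) \<longlonglongrightarrow> 2 * (0 * A)" by (intro tendsto_intros err)
    then have "\<forall>\<^sub>F k in sequentially. 2 * (err k * A) < \<kappa> * e / 2"
      by (rule order_tendstoD(2)) (use \<kappa> e in simp)
    then obtain k where k: "2 * (err k * A) < \<kappa> * e / 2" by (auto simp: eventually_sequentially)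
    obtain M where M: "\<And>m n x. m \<ge> M \<Longrightarrow> n \<ge> M \<Longrightarrow> x \<in> S \<Longrightarrow> \<bar>F k (D m) x - F k (D n) x\<bar> < \<eta>"
      using P[of k] \<eta> unfolding P_def by blast
    show "\<exists>M. \<forall>m\<ge>M. \<forall>n\<ge>M. (\<integral>\<^sup>+x. ennreal \<bar>\<phi> (D m) x - \<phi> (D n) x\<bar> \<partial>lborel) \<le> ennreal e"
    proof (intro exI[of _ M] allI impI)
      fix m n assume mn: "M \<le> m" "M \<le> n"
      let ?a = "D m" and ?b = "D n"
      have "ennreal \<kappa> * (\<integral>\<^sup>+x. ennreal \<bar>\<phi> ?a x - \<phi> ?b x\<bar> \<partial>lborel) = (\<integral>\<^sup>+x. ennreal (\<kappa> * \<bar>\<phi> ?a x - \<phi> ?b x\<bar>) \<partial>lborel)"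
        using \<kappa> by (simp add: nn_integral_cmult ennreal_mult')
      also have "\<dots> \<le> (\<integral>\<^sup>+x. H k ?a x * indicator S x + H k ?b x * indicator S x + ennreal \<eta> * indicator S x \<partial>lborel)"
      proof (rule nn_integral_mono)
        fix x
        show "ennreal (\<kappa> * \<bar>\<phi> ?a x - \<phi> ?b x\<bar>) \<le> H k ?a x * indicator S x + H k ?b x * indicator S x + ennreal \<eta> * indicator S x"
        proof (cases "x \<in> S")
          case True
          have "\<kappa> * \<bar>\<phi> ?a x - \<phi> ?b x\<bar> = \<bar>(\<kappa> * \<phi> ?a x + F k ?a x) - (\<kappa> * \<phi> ?b x + F k ?b x) - (F k ?a x - F k ?b x)\<bar>"
            using \<kappa> by (simp add: abs_mult_pos' algebra_simps)
          also have "\<dots> \<le> \<bar>\<kappa> * \<phi> ?a x + F k ?a x\<bar> + \<bar>\<kappa> * \<phi> ?b x + F k ?b x\<bar> + \<eta>"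
            using M[OF mn True] by linarith
          finally have "ennreal (\<kappa> * \<bar>\<phi> ?a x - \<phi> ?b x\<bar>) \<le> ennreal (\<bar>\<kappa> * \<phi> ?a x + F k ?a x\<bar> + \<bar>\<kappa> * \<phi> ?b x + F k ?b x\<bar> + \<eta>)"
            by (rule ennreal_leI)
          also have "\<dots> = ennreal \<bar>\<kappa> * \<phi> ?a x + F k ?a x\<bar> + ennreal \<bar>\<kappa> * \<phi> ?b x + F k ?b x\<bar> + ennreal \<eta>"
            using \<eta> by simp
          also have "\<dots> \<le> H k ?a x + H k ?b x + ennreal \<eta>" by (intro add_mono approx order_refl)
          finally show ?thesis using True by simp
        next
          case False
          then have "x \<notin> K ?a" "x \<notin> K ?b" using K(2)[of ?a] K(2)[of ?b] unfolding S_def by blast+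
          then show ?thesis using K(3) by simp
        qed
      qed
      also have "\<dots> = (\<integral>\<^sup>+x. H k ?a x * indicator S x \<partial>lborel) + (\<integral>\<^sup>+x. H k ?b x * indicator S x \<partial>lborel) + ennreal \<eta> * ennreal V"
        using V(1) by (simp add: nn_integral_add nn_integral_cmult)
      also have "\<dots> \<le> ennreal (err k * A) + ennreal (err k * A) + ennreal \<eta> * ennreal V"
        by (intro add_mono H order_refl)
      also have "\<dots> = ennreal (2 * (err k * A) + \<eta> * V)"
        using err(2)[of k] A(1) \<eta> V(2) by (simp add: ennreal_mult'[symmetric] ennreal_plus[symmetric] del: ennreal_plus)
      also have "\<dots> \<le> ennreal (\<kappa> * e)"
      proof (rule ennreal_leI)
        have "\<eta> * V \<le> \<eta> * (V + 1)" using \<eta> by (intro mult_left_mono) auto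
        also have "\<dots> = \<kappa> * e / 2" using V(2) by (simp add: \<eta>_def field_simps)
        finally show "2 * (err k * A) + \<eta> * V \<le> \<kappa> * e" using k by simp
      qed
      finally have *: "ennreal \<kappa> * (\<integral>\<^sup>+x. ennreal \<bar>\<phi> ?a x - \<phi> ?b x\<bar> \<partial>lborel) \<le> ennreal (\<kappa> * e)" .
      have "(\<integral>\<^sup>+x. ennreal \<bar>\<phi> ?a x - \<phi> ?b x\<bar> \<partial>lborel) = ennreal (1 / \<kappa>) * (ennreal \<kappa> * (\<integral>\<^sup>+x. ennreal \<bar>\<phi> ?a x - \<phi> ?b x\<bar> \<partial>lborel))"
        using \<kappa> by (simp add: mult.assoc[symmetric] ennreal_mult'[symmetric])
      also have "\<dots> \<le> ennreal (1 / \<kappa>) * ennreal (\<kappa> * e)" by (intro mult_left_mono *) auto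
      also have "\<dots> = ennreal e" using \<kappa> e by (simp add: ennreal_mult'[symmetric])
      finally show "(\<integral>\<^sup>+x. ennreal \<bar>\<phi> ?a x - \<phi> ?b x\<bar> \<partial>lborel) \<le> ennreal e" .
    qed
  qed
qed

section \<open>The energy norm on test functions\<close>

lemma C_k_on_sum:
  assumes "open S" "\<And>i. i \<in> I \<Longrightarrow> C_k_on k S (f i)"
  shows "C_k_on k S (\<lambda>x. \<Sum>i\<in>I. f i x)"
  using assms(2)
proof (induction I rule: infinite_finite_induct)
  case (insert i I)
  then show ?case using C_k_on_add[OF assms(1), of k "f i" "\<lambda>x. \<Sum>i\<in>I. f i x"] by simp
qed (auto intro: C_k_on_const)

lemma C_k_laplacian:
  assumes "C_k (Suc (Suc k)) \<phi>" shows "C_k k (laplacian \<phi>)"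
  unfolding C_k_on_UNIV[symmetric] laplacian_def[abs_def]
  by (rule C_k_on_sum) (use assms in \<open>auto simp: C_k_on_UNIV\<close>)

lemma C_k_lincomb:
  assumes "C_k k \<phi>" "C_k k \<psi>" shows "C_k k (\<lambda>x. \<phi> x + c * \<psi> x)"
  using C_k_on_add[OF open_UNIV assms(1)[unfolded C_k_on_UNIV[symmetric]]
      C_k_on_mult[OF open_UNIV C_k_on_const assms(2)[unfolded C_k_on_UNIV[symmetric]]]]
  by (simp add: C_k_on_UNIV)

lemma laplacian_lincomb:
  assumes "C_k 2 \<phi>" "C_k 2 \<psi>"
  shows "laplacian (\<lambda>x. \<phi> x + c * \<psi> x) x = laplacian \<phi> x + c * laplacian \<psi> x"
proof -
  have d: "\<phi> differentiable (at x)" "partial_deriv i \<phi> differentiable (at x)"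
    "\<psi> differentiable (at x)" "partial_deriv i \<psi> differentiable (at x)" for i x
    using assms by (auto simp: numeral_2_eq_2)
  have cd: "(\<lambda>x. c * f x) differentiable (at x)" if "f differentiable (at x)" for f :: "real^'a \<Rightarrow> real" and x
    using that by (intro differentiable_mult) auto
  have cp: "partial_deriv i (\<lambda>x. c * f x) x = c * partial_deriv i f x" if "f differentiable (at x)" for f :: "real^'a \<Rightarrow> real" and i x
    using that by (subst partial_deriv_mult) (auto simp: partial_deriv_const)
  have "partial_deriv i (\<lambda>x. \<phi> x + c * \<psi> x) = (\<lambda>x. partial_deriv i \<phi> x + c * partial_deriv i \<psi> x)" for i
    by (rule ext) (simp add: partial_deriv_add cd cp d)
  then have "partial_deriv i (partial_deriv i (\<lambda>x. \<phi> x + c * \<psi> x)) x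
    = partial_deriv i (partial_deriv i \<phi>) x + c * partial_deriv i (partial_deriv i \<psi>) x" for i
    by (simp add: partial_deriv_add cd cp d)
  then show ?thesis by (simp add: laplacian_def sum.distrib sum_distrib_left)
qed

lemma test_functionsE:
  assumes "\<phi> \<in> test_functions U"
  obtains K where "compact K" "K \<subseteq> U" "\<And>x. x \<notin> K \<Longrightarrow> \<phi> x = 0" "\<And>k. C_k k \<phi>"
  using assms closure_subset[of "{x. \<phi> x \<noteq> 0}"] unfolding test_functions_def by blast

lemma test_functionsI:
  assumes "\<And>k. C_k k \<phi>" "compact K" "K \<subseteq> U" "\<And>x. x \<notin> K \<Longrightarrow> \<phi> x = 0"
  shows "\<phi> \<in> test_functions U"
proof -
  have "closure {x. \<phi> x \<noteq> 0} \<subseteq> K"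
    by (rule closure_minimal) (use assms(2,4) in \<open>auto intro: compact_imp_closed\<close>)
  moreover from this have "compact (closure {x. \<phi> x \<noteq> 0})"
    using compact_Int_closed[OF assms(2), of "closure {x. \<phi> x \<noteq> 0}"] by (simp add: inf.absorb2)
  ultimately show ?thesis using assms(1,3) by (auto simp: test_functions_def)
qed

lemma test_functions_lincomb:
  assumes "\<phi> \<in> test_functions U" "\<psi> \<in> test_functions U"
  shows "(\<lambda>x. \<phi> x + c * \<psi> x) \<in> test_functions U"
proof -
  obtain K where K: "compact K" "K \<subseteq> U" "\<And>x. x \<notin> K \<Longrightarrow> \<phi> x = 0" "\<And>k. C_k k \<phi>"
    using test_functionsE[OF assms(1)] by blast
  obtain L where L: "compact L" "L \<subseteq> U" "\<And>x. x \<notin> L \<Longrightarrow> \<psi> x = 0" "\<And>k. C_k k \<psi>"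
    using test_functionsE[OF assms(2)] by blast
  show ?thesis
    by (rule test_functionsI[of _ "K \<union> L"]) (use K L in \<open>auto intro: C_k_lincomb\<close>)
qed

lemma test_functions_algebra:
  assumes "\<phi> \<in> test_functions U" "\<psi> \<in> test_functions U"
  shows "(\<lambda>x. \<phi> x + \<psi> x) \<in> test_functions U" "(\<lambda>x. \<phi> x - \<psi> x) \<in> test_functions U"
    "(\<lambda>x. c * \<phi> x) \<in> test_functions U"
proof -
  show "(\<lambda>x. \<phi> x + \<psi> x) \<in> test_functions U" using test_functions_lincomb[OF assms, of 1] by simp
  show "(\<lambda>x. \<phi> x - \<psi> x) \<in> test_functions U" using test_functions_lincomb[OF assms, of "-1"] by simp
  show "(\<lambda>x. c * \<phi> x) \<in> test_functions U" using test_functions_lincomb[OF assms(1) assms(1), of "c - 1"]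
    by (simp add: algebra_simps)
qed

lemma nn_integral_lebesgue_on:
  assumes [measurable]: "f \<in> borel_measurable borel" "\<Omega> \<in> sets borel"
  shows "(\<integral>\<^sup>+x. f x \<partial>lebesgue_on \<Omega>) = (\<integral>\<^sup>+x. f x * indicator \<Omega> (x::'a::euclidean_space) \<partial>lborel)"
proof -
  have "\<Omega> \<inter> space lebesgue \<in> sets lebesgue"
    using assms(2) by (simp add: sets_completionI_sets)
  then have "(\<integral>\<^sup>+x. f x \<partial>lebesgue_on \<Omega>) = (\<integral>\<^sup>+x. f x * indicator \<Omega> x \<partial>lebesgue)"
    by (rule nn_integral_restrict_space)
  then show ?thesis by (simp only: nn_integral_completion)
qed

text \<open>The part of the hypotheses that concerns the norm alone; the target exponent and its weight enter
  later.\<close>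

locale weighted_domain =
  fixes \<Omega> :: "(real^'n::finite) set" and \<alpha> :: real
  assumes dim: "real CARD('n) > 4" and \<alpha>: "4 - real CARD('n) < \<alpha>" "\<alpha> < real CARD('n)"
    and \<Omega>: "open \<Omega>" "bounded \<Omega>"
begin

abbreviation V :: "(real^'n \<Rightarrow> real) set" where "V \<equiv> test_functions (\<Omega> - {0})"
abbreviation M :: "(real^'n) measure" where "M \<equiv> lebesgue_on \<Omega>"

text \<open>The inner product belonging to the norm. It is written over the whole space because test functions vanish
  outside \<open>\<Omega>\<close>.\<close>

definition energy :: "(real^'n \<Rightarrow> real) \<Rightarrow> (real^'n \<Rightarrow> real) \<Rightarrow> real" where
  "energy \<phi> \<psi> = (\<integral>x. norm x powr \<alpha> * laplacian \<phi> x * laplacian \<psi> x \<partial>lborel)"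

lemma dim2: "real CARD('n) > 2" using dim by simp

lemma \<Omega>_borel [measurable]: "\<Omega> \<in> sets borel" using \<Omega>(1) by simp

lemma V_C2: "\<phi> \<in> V \<Longrightarrow> C_k k \<phi>"
  by (simp add: test_functions_def)

lemma V_continuous: "\<phi> \<in> V \<Longrightarrow> continuous_on UNIV \<phi>"
  using V_C2[of \<phi> 0] by simp

lemma V_measurable: "\<phi> \<in> V \<Longrightarrow> \<phi> \<in> borel_measurable borel"
  by (rule borel_measurable_continuous_onI) (rule V_continuous)

lemma V_laplacian_measurable: "\<phi> \<in> V \<Longrightarrow> laplacian \<phi> \<in> borel_measurable borel"
  by (rule borel_measurable_continuous_onI) (rule laplacian_continuous[OF V_C2])

text \<open>The weight is singular at the origin, but the support of a test function stays away from it.\<close>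

lemma weighted_laplacian_C_k:
  assumes "\<phi> \<in> V" shows "C_k k (\<lambda>x. norm x powr \<alpha> * laplacian \<phi> x)"
proof -
  obtain K where K: "compact K" "K \<subseteq> \<Omega> - {0}" "\<And>x. x \<notin> K \<Longrightarrow> \<phi> x = 0" "\<And>k. C_k k \<phi>"
    using test_functionsE[OF assms] by blast
  have pow: "C_k_on k (- {0}) (\<lambda>x::real^'n. norm x powr \<alpha>)"
  proof (rule C_k_on_cong)
    show "C_k_on k (- {0}) (\<lambda>x::real^'n. ((x - 0) \<bullet> (x - 0) + 0) powr (\<alpha> / 2))"
      by (rule C_k_on_subset[OF C_k_on_regularised_power]) auto
    show "((x - 0) \<bullet> (x - 0) + 0) powr (\<alpha> / 2) = norm x powr \<alpha>" for x :: "real^'n"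
      using powr_powr[of "norm x" 2 "\<alpha> / 2"] by (cases "x = 0") (auto simp: power2_norm_eq_inner)
  qed auto
  have away: "C_k_on k (- {0}) (\<lambda>x. norm x powr \<alpha> * laplacian \<phi> x)"
    by (intro C_k_on_mult pow C_k_on_subset[OF C_k_laplacian[OF K(4), unfolded C_k_on_UNIV[symmetric]]]) auto
  have "C_k_on k (- K) (\<lambda>x. norm x powr \<alpha> * laplacian \<phi> x)"
    by (rule C_k_on_cong[OF _ _ C_k_on_const[of k _ 0]])
       (use laplacian_vanishing[OF K(1,3)] K(1) in \<open>auto simp: compact_imp_closed open_Compl\<close>)
  from C_k_on_Un[OF _ _ away this] have "C_k_on k (- {0} \<union> - K) (\<lambda>x. norm x powr \<alpha> * laplacian \<phi> x)"
    using K(1) by (auto simp: compact_imp_closed open_Compl)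
  moreover have "- {0} \<union> - K = UNIV" using K(2) by auto
  ultimately show ?thesis by (simp add: C_k_on_UNIV)
qed

lemma energy_integrable:
  assumes "\<phi> \<in> V" "\<psi> \<in> V"
  shows "integrable lborel (\<lambda>x. norm x powr \<alpha> * laplacian \<phi> x * laplacian \<psi> x)"
proof -
  obtain K where K: "compact K" "K \<subseteq> \<Omega> - {0}" "\<And>x. x \<notin> K \<Longrightarrow> \<phi> x = 0" "\<And>k. C_k k \<phi>"
    using test_functionsE[OF assms(1)] by blast
  show ?thesis
  proof (rule compactly_supported_integrable[OF K(1)])
    show "norm x powr \<alpha> * laplacian \<phi> x * laplacian \<psi> x = 0" if "x \<notin> K" for x
      using laplacian_vanishing[OF K(1,3) that] by simp
    show "continuous_on UNIV (\<lambda>x. norm x powr \<alpha> * laplacian \<phi> x * laplacian \<psi> x)"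
      using weighted_laplacian_C_k[OF assms(1), of 0] laplacian_continuous[OF V_C2[OF assms(2)]]
      by (auto intro: continuous_on_mult)
  qed
qed

lemma energy_self_nonneg: "energy \<phi> \<phi> \<ge> 0"
  unfolding energy_def by (intro integral_nonneg_AE) (auto simp: mult.assoc)

lemma laplacian_V_vanishing:
  assumes "\<phi> \<in> V" "x \<notin> \<Omega>" shows "laplacian \<phi> x = 0"
proof -
  obtain K where K: "compact K" "K \<subseteq> \<Omega> - {0}" "\<And>x. x \<notin> K \<Longrightarrow> \<phi> x = 0" "\<And>k. C_k k \<phi>"
    using test_functionsE[OF assms(1)] by blast
  from assms(2) K(2) have x: "x \<notin> K" by blast
  show ?thesis by (rule laplacian_vanishing[OF K(1,3) x])
qed

lemma norm2_eq:
  assumes "\<phi> \<in> V" shows "norm2 \<alpha> \<Omega> \<phi> = sqrt (energy \<phi> \<phi>)"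
proof -
  have [measurable]: "laplacian \<phi> \<in> borel_measurable borel" by (rule V_laplacian_measurable[OF assms])
  have "(LINT x|M. norm x powr \<alpha> * \<bar>laplacian \<phi> x\<bar>\<^sup>2) = (LINT x|lebesgue. indicator \<Omega> x *\<^sub>R (norm x powr \<alpha> * \<bar>laplacian \<phi> x\<bar>\<^sup>2))"
    by (rule integral_restrict_space) auto
  also have "\<dots> = (LINT x|lebesgue. norm x powr \<alpha> * laplacian \<phi> x * laplacian \<phi> x)"
    using laplacian_V_vanishing[OF assms]
    by (intro Bochner_Integration.integral_cong) (auto simp: indicator_def power2_eq_square)
  also have "\<dots> = energy \<phi> \<phi>"
    unfolding energy_def by (rule integral_completion) measurable
  finally show ?thesis by (simp add: norm2_def)
qed

lemma norm2_nonneg: "norm2 \<alpha> \<Omega> \<phi> \<ge> 0"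
  unfolding norm2_def by (intro real_sqrt_ge_zero integral_nonneg_AE) auto

lemma energy_nn_integral:
  assumes "\<phi> \<in> V"
  shows "(\<integral>\<^sup>+x. ennreal (norm x powr \<alpha> * \<bar>laplacian \<phi> x\<bar>\<^sup>2) \<partial>lborel) = ennreal ((norm2 \<alpha> \<Omega> \<phi>)\<^sup>2)"
proof -
  have "(\<integral>\<^sup>+x. ennreal (norm x powr \<alpha> * \<bar>laplacian \<phi> x\<bar>\<^sup>2) \<partial>lborel)
    = (\<integral>\<^sup>+x. ennreal (norm x powr \<alpha> * laplacian \<phi> x * laplacian \<phi> x) \<partial>lborel)"
    by (simp add: power2_eq_square mult.assoc)
  also have "\<dots> = ennreal (energy \<phi> \<phi>)"
    unfolding energy_def using energy_integrable[OF assms assms]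
    by (rule nn_integral_eq_integral) (auto simp: mult.assoc)
  finally show ?thesis using energy_self_nonneg by (simp add: norm2_eq[OF assms])
qed

lemma energy_lincomb_left:
  assumes "\<phi> \<in> V" "\<psi> \<in> V" "\<zeta> \<in> V"
  shows "energy (\<lambda>x. \<phi> x + c * \<psi> x) \<zeta> = energy \<phi> \<zeta> + c * energy \<psi> \<zeta>"
proof -
  have "energy (\<lambda>x. \<phi> x + c * \<psi> x) \<zeta> = (\<integral>x. norm x powr \<alpha> * laplacian \<phi> x * laplacian \<zeta> x
      + c * (norm x powr \<alpha> * laplacian \<psi> x * laplacian \<zeta> x) \<partial>lborel)"
    unfolding energy_def laplacian_lincomb[OF V_C2[OF assms(1)] V_C2[OF assms(2)]]
    by (simp add: algebra_simps)
  also have "\<dots> = energy \<phi> \<zeta> + c * energy \<psi> \<zeta>"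
    unfolding energy_def using assms by (simp add: energy_integrable)
  finally show ?thesis .
qed

lemma energy_commute: "energy \<phi> \<psi> = energy \<psi> \<phi>"
  by (simp add: energy_def mult_ac)

lemma energy_lincomb_self:
  assumes "\<phi> \<in> V" "\<psi> \<in> V"
  shows "energy (\<lambda>x. \<phi> x + c * \<psi> x) (\<lambda>x. \<phi> x + c * \<psi> x)
     = energy \<phi> \<phi> + 2 * c * energy \<phi> \<psi> + c\<^sup>2 * energy \<psi> \<psi>"
proof -
  let ?\<zeta> = "\<lambda>x. \<phi> x + c * \<psi> x"
  have \<zeta>: "?\<zeta> \<in> V" by (rule test_functions_lincomb[OF assms])
  have "energy ?\<zeta> ?\<zeta> = energy \<phi> ?\<zeta> + c * energy \<psi> ?\<zeta>" by (rule energy_lincomb_left[OF assms \<zeta>])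
  also have "energy \<phi> ?\<zeta> = energy \<phi> \<phi> + c * energy \<psi> \<phi>"
    unfolding energy_commute[of \<phi> ?\<zeta>] by (rule energy_lincomb_left[OF assms assms(1)])
  also have "energy \<psi> ?\<zeta> = energy \<phi> \<psi> + c * energy \<psi> \<psi>"
    unfolding energy_commute[of \<psi> ?\<zeta>] by (rule energy_lincomb_left[OF assms assms(2)])
  finally show ?thesis by (simp add: energy_commute[of \<psi> \<phi>] power2_eq_square algebra_simps)
qed

lemma energy_Cauchy_Schwarz:
  assumes "\<phi> \<in> V" "\<psi> \<in> V"
  shows "\<bar>energy \<phi> \<psi>\<bar> \<le> norm2 \<alpha> \<Omega> \<phi> * norm2 \<alpha> \<Omega> \<psi>"
proof -
  let ?a = "energy \<phi> \<phi>" and ?b = "energy \<phi> \<psi>" and ?c = "energy \<psi> \<psi>"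
  have q: "0 \<le> ?a + 2 * t * ?b + t\<^sup>2 * ?c" for t
    using energy_self_nonneg[of "\<lambda>x. \<phi> x + t * \<psi> x"] unfolding energy_lincomb_self[OF assms] .
  have "?b\<^sup>2 \<le> ?a * ?c"
  proof (cases "?c = 0")
    case True
    have "?b = 0"
    proof (rule ccontr)
      assume b: "?b \<noteq> 0"
      \<comment> \<open>the polynomial is affine in \<open>t\<close>, and here it takes the value \<open>-1\<close>\<close>
      from q[of "- (?a + 1) / (2 * ?b)"] True b show False by (simp add: field_simps)
    qed
    then show ?thesis using True by simp
  next
    case False
    then have c: "?c > 0" using energy_self_nonneg[of \<psi>] by simp
    \<comment> \<open>the minimum of the quadratic polynomial\<close>
    from q[of "- ?b / ?c"] c have "0 \<le> ?a - ?b\<^sup>2 / ?c" by (simp add: power2_eq_square field_simps)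
    then show ?thesis using c by (simp add: field_simps)
  qed
  then have "sqrt (?b\<^sup>2) \<le> sqrt (?a * ?c)" by (rule real_sqrt_le_mono)
  then show ?thesis by (simp add: norm2_eq assms real_sqrt_mult)
qed

lemma norm2_add:
  assumes "\<phi> \<in> V" "\<psi> \<in> V"
  shows "norm2 \<alpha> \<Omega> (\<lambda>x. \<phi> x + \<psi> x) \<le> norm2 \<alpha> \<Omega> \<phi> + norm2 \<alpha> \<Omega> \<psi>"
proof -
  have sq: "(norm2 \<alpha> \<Omega> \<zeta>)\<^sup>2 = energy \<zeta> \<zeta>" if "\<zeta> \<in> V" for \<zeta>
    using energy_self_nonneg by (simp add: norm2_eq[OF that])
  have "(norm2 \<alpha> \<Omega> (\<lambda>x. \<phi> x + \<psi> x))\<^sup>2 = energy \<phi> \<phi> + 2 * energy \<phi> \<psi> + energy \<psi> \<psi>"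
    using energy_lincomb_self[OF assms, of 1] test_functions_algebra(1)[OF assms] by (simp add: sq)
  also have "\<dots> \<le> (norm2 \<alpha> \<Omega> \<phi> + norm2 \<alpha> \<Omega> \<psi>)\<^sup>2"
    using energy_Cauchy_Schwarz[OF assms] by (simp add: power2_sum sq assms)
  finally show ?thesis by (rule power2_le_imp_le) (simp add: norm2_nonneg)
qed

lemma norm2_scale:
  assumes "\<phi> \<in> V" shows "norm2 \<alpha> \<Omega> (\<lambda>x. c * \<phi> x) = \<bar>c\<bar> * norm2 \<alpha> \<Omega> \<phi>"
proof -
  have "energy (\<lambda>x. c * \<phi> x) (\<lambda>x. c * \<phi> x) = c\<^sup>2 * energy \<phi> \<phi>"
    using energy_lincomb_self[OF assms assms, of "c - 1"] by (simp add: power2_eq_square algebra_simps)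
  then show ?thesis
    by (simp add: norm2_eq assms test_functions_algebra(3)[OF assms assms] real_sqrt_mult)
qed

lemma norm2_minus_commute:
  assumes "\<phi> \<in> V" "\<psi> \<in> V"
  shows "norm2 \<alpha> \<Omega> (\<lambda>x. \<phi> x - \<psi> x) = norm2 \<alpha> \<Omega> (\<lambda>x. \<psi> x - \<phi> x)"
  using norm2_scale[OF test_functions_algebra(2)[OF assms], of "-1"] by (simp add: minus_diff_eq)

lemma norm2_diff_triangle:
  assumes "\<phi> \<in> V" "\<psi> \<in> V" "\<zeta> \<in> V"
  shows "norm2 \<alpha> \<Omega> (\<lambda>x. \<phi> x - \<zeta> x) \<le> norm2 \<alpha> \<Omega> (\<lambda>x. \<phi> x - \<psi> x) + norm2 \<alpha> \<Omega> (\<lambda>x. \<psi> x - \<zeta> x)"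
  using norm2_add[OF test_functions_algebra(2)[OF assms(1,2)] test_functions_algebra(2)[OF assms(2,3)]] by simp

lemma norm2_abs_diff:
  assumes "\<phi> \<in> V" "\<psi> \<in> V"
  shows "\<bar>norm2 \<alpha> \<Omega> \<phi> - norm2 \<alpha> \<Omega> \<psi>\<bar> \<le> norm2 \<alpha> \<Omega> (\<lambda>x. \<phi> x - \<psi> x)"
  using norm2_add[OF test_functions_algebra(2)[OF assms] assms(2)]
    norm2_add[OF test_functions_algebra(2)[OF assms(2,1)] assms(1)] norm2_minus_commute[OF assms] by simp

text \<open>Cauchy-Schwarz with \<open>|x|^(-\<alpha>/2) |x|^(\<alpha>/2) = 1\<close>; the constant comes from the integral of
  \<open>|x|^(-\<alpha>)\<close> over a ball containing \<open>\<Omega>\<close>.\<close>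

lemma laplacian_L1_bound:
  obtains A where "A \<ge> 0" "\<And>\<phi>. \<phi> \<in> V \<Longrightarrow> (\<integral>\<^sup>+x. ennreal \<bar>laplacian \<phi> x\<bar> \<partial>lborel) \<le> ennreal (A * norm2 \<alpha> \<Omega> \<phi>)"
proof -
  obtain R where R: "R > 0" "\<And>x. x \<in> \<Omega> \<Longrightarrow> norm x < R"
    using \<Omega>(2) bounded_pos_less[of \<Omega>] by auto
  obtain C where C: "C \<ge> 0" "\<And>r. r > 0 \<Longrightarrow>
    (\<integral>\<^sup>+x. ennreal (norm x powr - \<alpha>) * indicator (ball 0 r) (x::real^'n) \<partial>lborel) \<le> ennreal (C * r powr (- \<alpha> + real CARD('n)))"
    using nn_integral_norm_powr_ball[where 'n='n and a="- \<alpha>"] \<alpha> by auto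
  define D where "D = C * R powr (- \<alpha> + real CARD('n))"
  have D: "D \<ge> 0" using C by (simp add: D_def)
  show ?thesis
  proof
    show "sqrt D \<ge> 0" using D by simp
    fix \<phi> assume \<phi>: "\<phi> \<in> V"
    have [measurable]: "laplacian \<phi> \<in> borel_measurable borel" by (rule V_laplacian_measurable[OF \<phi>])
    let ?f = "\<lambda>x::real^'n. ennreal (norm x powr (- \<alpha> / 2)) * indicator \<Omega> x"
    let ?g = "\<lambda>x. ennreal (norm x powr (\<alpha> / 2) * \<bar>laplacian \<phi> x\<bar>)"
    have "(\<integral>\<^sup>+x. ennreal \<bar>laplacian \<phi> x\<bar> \<partial>lborel) = (\<integral>\<^sup>+x. ?f x * ?g x \<partial>lborel)"
    proof (rule nn_integral_cong_AE, use AE_lborel_neq[of 0] in eventually_elim)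
      fix x :: "real^'n" assume x: "x \<noteq> 0"
      have "norm x powr (- \<alpha> / 2) * norm x powr (\<alpha> / 2) = 1" using x unfolding powr_add[symmetric] by simp
      then have "norm x powr (- \<alpha> / 2) * (norm x powr (\<alpha> / 2) * \<bar>laplacian \<phi> x\<bar>) = \<bar>laplacian \<phi> x\<bar>"
        by (metis mult.assoc mult.left_neutral)
      then show "ennreal \<bar>laplacian \<phi> x\<bar> = ?f x * ?g x"
        using laplacian_V_vanishing[OF \<phi>, of x] by (cases "x \<in> \<Omega>") (simp_all add: ennreal_mult'[symmetric])
    qed
    moreover have "(\<integral>\<^sup>+x. ?f x * ?g x \<partial>lborel)\<^sup>2 \<le> ennreal (D * (norm2 \<alpha> \<Omega> \<phi>)\<^sup>2)"
    proof -
      have "(\<integral>\<^sup>+x. ?f x * ?g x \<partial>lborel)\<^sup>2 \<le> (\<integral>\<^sup>+x. (?f x)\<^sup>2 \<partial>lborel) * (\<integral>\<^sup>+x. (?g x)\<^sup>2 \<partial>lborel)"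
        by (rule Cauchy_Schwarz_nn_integral) measurable
      also have "(\<integral>\<^sup>+x. (?g x)\<^sup>2 \<partial>lborel) = ennreal ((norm2 \<alpha> \<Omega> \<phi>)\<^sup>2)"
      proof -
        have "(norm x powr (\<alpha> / 2))\<^sup>2 = norm x powr \<alpha>" for x :: "real^'n"
          unfolding power2_eq_square powr_add[symmetric] by simp
        then have "(?g x)\<^sup>2 = ennreal (norm x powr \<alpha> * \<bar>laplacian \<phi> x\<bar>\<^sup>2)" for x
          by (simp add: ennreal_power power_mult_distrib)
        then show ?thesis using energy_nn_integral[OF \<phi>] by simp
      qed
      also have "(\<integral>\<^sup>+x. (?f x)\<^sup>2 \<partial>lborel) \<le> (\<integral>\<^sup>+x. ennreal (norm x powr - \<alpha>) * indicator (ball 0 R) (x::real^'n) \<partial>lborel)"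
      proof (rule nn_integral_mono)
        fix x :: "real^'n"
        have "(norm x powr (- \<alpha> / 2))\<^sup>2 = norm x powr - \<alpha>" unfolding power2_eq_square powr_add[symmetric] by simp
        then show "(?f x)\<^sup>2 \<le> ennreal (norm x powr - \<alpha>) * indicator (ball 0 R) x"
          using R(2)[of x] by (auto simp: power_mult_distrib ennreal_power indicator_def)
      qed
      also have "\<dots> \<le> ennreal D" unfolding D_def by (rule C(2)[OF R(1)])
      finally show ?thesis using D by (simp add: ennreal_mult' mult_right_mono)
    qed
    ultimately have "(\<integral>\<^sup>+x. ennreal \<bar>laplacian \<phi> x\<bar> \<partial>lborel) \<le> ennreal (sqrt (D * (norm2 \<alpha> \<Omega> \<phi>)\<^sup>2))"
      using D by (auto intro!: ennreal_le_sqrt_if_square_le)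
    then show "(\<integral>\<^sup>+x. ennreal \<bar>laplacian \<phi> x\<bar> \<partial>lborel) \<le> ennreal (sqrt D * norm2 \<alpha> \<Omega> \<phi>)"
      using norm2_nonneg by (simp add: real_sqrt_mult)
  qed
qed

lemma V_integrable:
  assumes "\<phi> \<in> V" shows "integrable lborel \<phi>" "integrable M \<phi>"
    "(\<integral>x. \<bar>\<phi> x\<bar> \<partial>M) = (\<integral>x. \<bar>\<phi> x\<bar> \<partial>lborel)"
proof -
  obtain K where K: "compact K" "K \<subseteq> \<Omega> - {0}" "\<And>x. x \<notin> K \<Longrightarrow> \<phi> x = 0" "\<And>k. C_k k \<phi>"
    using test_functionsE[OF assms] by blast
  have [measurable]: "\<phi> \<in> borel_measurable borel" by (rule V_measurable[OF assms])
  show 1: "integrable lborel \<phi>" by (rule compactly_supported_integrable[OF K(1,3) V_continuous[OF assms]])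
  have ind: "indicator \<Omega> x *\<^sub>R \<phi> x = \<phi> x" for x using K(2) K(3)[of x] by (auto simp: indicator_def)
  have "integrable lebesgue \<phi>" using 1 by (simp add: integrable_completion)
  then have "integrable lebesgue (\<lambda>x. indicator \<Omega> x *\<^sub>R \<phi> x)" unfolding ind .
  then show "integrable M \<phi>" by (subst integrable_restrict_space) auto
  have "(\<integral>x. \<bar>\<phi> x\<bar> \<partial>M) = (\<integral>x. indicator \<Omega> x *\<^sub>R \<bar>\<phi> x\<bar> \<partial>lebesgue)"
    by (rule integral_restrict_space) auto
  also have "\<dots> = (\<integral>x. \<bar>\<phi> x\<bar> \<partial>lebesgue)"
    using K(2,3) by (intro Bochner_Integration.integral_cong) (auto simp: indicator_def)
  also have "\<dots> = (\<integral>x. \<bar>\<phi> x\<bar> \<partial>lborel)" by (rule integral_completion) measurable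
  finally show "(\<integral>x. \<bar>\<phi> x\<bar> \<partial>M) = (\<integral>x. \<bar>\<phi> x\<bar> \<partial>lborel)" .
qed

lemma V_nn_integral_abs:
  assumes "\<phi> \<in> V" shows "(\<integral>\<^sup>+x. ennreal \<bar>\<phi> x\<bar> \<partial>lborel) = ennreal (\<integral>x. \<bar>\<phi> x\<bar> \<partial>M)"
  unfolding V_integrable(3)[OF assms]
  using V_integrable(1)[OF assms] by (intro nn_integral_eq_integral) auto

lemma V_L1_bound:
  obtains C where "C \<ge> 0" "\<And>\<phi>. \<phi> \<in> V \<Longrightarrow> (\<integral>x. \<bar>\<phi> x\<bar> \<partial>M) \<le> C * norm2 \<alpha> \<Omega> \<phi>"
proof -
  obtain R where R: "\<And>x. x \<in> \<Omega> \<Longrightarrow> norm x \<le> R" using \<Omega>(2) by (auto simp: bounded_iff)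
  obtain A where A: "A \<ge> 0" "\<And>\<phi>. \<phi> \<in> V \<Longrightarrow> (\<integral>\<^sup>+x. ennreal \<bar>laplacian \<phi> x\<bar> \<partial>lborel) \<le> ennreal (A * norm2 \<alpha> \<Omega> \<phi>)"
    using laplacian_L1_bound by blast
  obtain C where C: "C \<ge> 0" "\<And>(\<phi> :: real^'n \<Rightarrow> real) K. C_k 2 \<phi> \<Longrightarrow> compact K \<Longrightarrow> K \<subseteq> cball 0 R \<Longrightarrow> (\<And>x. x \<notin> K \<Longrightarrow> \<phi> x = 0) \<Longrightarrow>
     (\<integral>\<^sup>+x. ennreal \<bar>\<phi> x\<bar> \<partial>lborel) \<le> ennreal C * (\<integral>\<^sup>+x. ennreal \<bar>laplacian \<phi> x\<bar> \<partial>lborel)"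
    using laplacian_controls_L1[OF dim2] by blast
  show ?thesis
  proof
    show "C * A \<ge> 0" using A C by simp
    fix \<phi> assume \<phi>: "\<phi> \<in> V"
    obtain K where K: "compact K" "K \<subseteq> \<Omega> - {0}" "\<And>x. x \<notin> K \<Longrightarrow> \<phi> x = 0" "\<And>k. C_k k \<phi>"
      using test_functionsE[OF \<phi>] by blast
    have "ennreal (\<integral>x. \<bar>\<phi> x\<bar> \<partial>M) \<le> ennreal C * (\<integral>\<^sup>+x. ennreal \<bar>laplacian \<phi> x\<bar> \<partial>lborel)"
      unfolding V_nn_integral_abs[OF \<phi>, symmetric] by (rule C(2)[OF K(4,1) _ K(3)]) (use K(2) R in auto)
    also have "\<dots> \<le> ennreal C * ennreal (A * norm2 \<alpha> \<Omega> \<phi>)" by (intro mult_left_mono A \<phi>) auto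
    also have "\<dots> = ennreal (C * A * norm2 \<alpha> \<Omega> \<phi>)"
      using C(1) by (simp add: ennreal_mult'[symmetric] mult.assoc)
    finally show "(\<integral>x. \<bar>\<phi> x\<bar> \<partial>M) \<le> C * A * norm2 \<alpha> \<Omega> \<phi>"
      using A C norm2_nonneg by (simp add: ennreal_le_iff)
  qed
qed

text \<open>For a fixed late index \<open>n\<close> write \<open>\<langle>s n, s n\<rangle> = \<langle>s n - s m, s n\<rangle> + \<langle>s m, s n\<rangle>\<close>. The first term is small by the Cauchy
  property. The second tends to 0 as \<open>m\<close> grows: by Green's identity it equals the integral of \<open>s m\<close> against the
  Laplacian of \<open>|x|^\<alpha> \<Delta>(s n)\<close>, a bounded function.\<close>

lemma norm2_closable:
  assumes s: "\<And>n. s n \<in> V"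
    and cauchy: "\<And>e. e > 0 \<Longrightarrow> \<exists>k. \<forall>m\<ge>k. \<forall>n\<ge>k. norm2 \<alpha> \<Omega> (\<lambda>x. s m x - s n x) < e"
    and L1: "(\<lambda>n. \<integral>x. \<bar>s n x\<bar> \<partial>M) \<longlonglongrightarrow> 0"
  shows "(\<lambda>n. norm2 \<alpha> \<Omega> (s n)) \<longlonglongrightarrow> 0"
proof (rule LIMSEQ_I)
  fix e :: real assume e: "e > 0"
  obtain k where k: "\<And>m n. m \<ge> k \<Longrightarrow> n \<ge> k \<Longrightarrow> norm2 \<alpha> \<Omega> (\<lambda>x. s m x - s n x) < e / 2"
    using cauchy[of "e / 2"] e by auto
  have "norm2 \<alpha> \<Omega> (s n) \<le> e / 2" if n: "n \<ge> k" for n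
  proof -
    let ?w = "\<lambda>x. norm x powr \<alpha> * laplacian (s n) x"
    obtain K where K: "compact K" "K \<subseteq> \<Omega> - {0}" "\<And>x. x \<notin> K \<Longrightarrow> s n x = 0" "\<And>k. C_k k (s n)"
      using test_functionsE[OF s] by blast
    have wC: "C_k 2 ?w" by (rule weighted_laplacian_C_k[OF s])
    have w0: "?w x = 0" if "x \<notin> K" for x using laplacian_vanishing[OF K(1,3) that] by simp
    have contL: "continuous_on UNIV (laplacian ?w)" by (rule laplacian_continuous[OF wC])
    obtain B where B: "B > 0" "\<And>x. \<bar>laplacian ?w x\<bar> \<le> B"
      using compactly_supported_bounded[OF K(1) laplacian_vanishing[OF K(1) w0] contL] by blast
    have cross: "\<bar>energy (s n) (s m)\<bar> \<le> B * (\<integral>x. \<bar>s m x\<bar> \<partial>M)" for m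
    proof -
      obtain L where L: "compact L" "L \<subseteq> \<Omega> - {0}" "\<And>x. x \<notin> L \<Longrightarrow> s m x = 0" "\<And>k. C_k k (s m)"
        using test_functionsE[OF s] by blast
      have "energy (s n) (s m) = (\<integral>x. laplacian ?w x * s m x \<partial>lborel)"
        unfolding energy_def by (rule green_identity[OF L(4) wC L(1,3)])
      also have "\<bar>\<dots>\<bar> \<le> (\<integral>x. \<bar>laplacian ?w x * s m x\<bar> \<partial>lborel)" by (rule integral_abs_bound)
      also have "\<dots> \<le> (\<integral>x. B * \<bar>s m x\<bar> \<partial>lborel)"
      proof (rule integral_mono)
        show "integrable lborel (\<lambda>x. \<bar>laplacian ?w x * s m x\<bar>)"
          by (intro integrable_abs compactly_supported_integrable[OF L(1)])
             (use L(3) contL V_continuous[OF s] in \<open>auto intro: continuous_on_mult\<close>)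
        show "integrable lborel (\<lambda>x. B * \<bar>s m x\<bar>)" using V_integrable(1)[OF s] by simp
        show "\<bar>laplacian ?w x * s m x\<bar> \<le> B * \<bar>s m x\<bar>" for x using B(2)[of x] by (simp add: abs_mult mult_right_mono)
      qed
      also have "\<dots> = B * (\<integral>x. \<bar>s m x\<bar> \<partial>M)" by (simp add: V_integrable(3)[OF s])
      finally show ?thesis .
    qed
    have "(norm2 \<alpha> \<Omega> (s n))\<^sup>2 \<le> norm2 \<alpha> \<Omega> (s n) * (e / 2) + B * (\<integral>x. \<bar>s m x\<bar> \<partial>M)" if m: "m \<ge> k" for m
    proof -
      let ?d = "\<lambda>x. s n x - s m x"
      have d: "?d \<in> V" by (rule test_functions_algebra(2)[OF s s])
      have "(norm2 \<alpha> \<Omega> (s n))\<^sup>2 = energy (s n) (s n)" using energy_self_nonneg by (simp add: norm2_eq[OF s])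
      also have "\<dots> = energy ?d (s n) + energy (s m) (s n)"
        using energy_lincomb_left[OF d s[of m] s[of n], of 1] by simp
      also have "energy ?d (s n) \<le> norm2 \<alpha> \<Omega> ?d * norm2 \<alpha> \<Omega> (s n)"
        using energy_Cauchy_Schwarz[OF d s[of n]] by simp
      also have "\<dots> \<le> e / 2 * norm2 \<alpha> \<Omega> (s n)"
        using k[OF n m] by (intro mult_right_mono norm2_nonneg) simp
      also have "energy (s m) (s n) \<le> B * (\<integral>x. \<bar>s m x\<bar> \<partial>M)" using cross[of m] by (simp add: energy_commute)
      finally show ?thesis by (simp add: mult.commute)
    qed
    then have ev: "\<forall>\<^sub>F m in sequentially. (norm2 \<alpha> \<Omega> (s n))\<^sup>2 \<le> norm2 \<alpha> \<Omega> (s n) * (e / 2) + B * (\<integral>x. \<bar>s m x\<bar> \<partial>M)"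
      by (auto simp: eventually_sequentially)
    have "(\<lambda>m. norm2 \<alpha> \<Omega> (s n) * (e / 2) + B * (\<integral>x. \<bar>s m x\<bar> \<partial>M)) \<longlonglongrightarrow> norm2 \<alpha> \<Omega> (s n) * (e / 2) + B * 0"
      by (intro tendsto_intros L1)
    from tendsto_lowerbound[OF this ev] have "norm2 \<alpha> \<Omega> (s n) * norm2 \<alpha> \<Omega> (s n) \<le> norm2 \<alpha> \<Omega> (s n) * (e / 2)"
      by (simp add: power2_eq_square)
    then show ?thesis
      using e norm2_nonneg[of "s n"] by (cases "norm2 \<alpha> \<Omega> (s n) = 0") (auto simp: mult_le_cancel_left)
  qed
  then show "\<exists>k. \<forall>n\<ge>k. norm (norm2 \<alpha> \<Omega> (s n) - 0) < e"
    using e norm2_nonneg by (intro exI[of _ k]) (fastforce intro: le_less_trans)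
qed

end

section \<open>Convergence in mean and higher integrability\<close>

text \<open>Fatou's lemma, with the bound required only for late indices.\<close>

lemma nn_integral_le_of_AE_limit:
  fixes g :: "nat \<Rightarrow> 'a \<Rightarrow> ennreal"
  assumes [measurable]: "\<And>n. g n \<in> borel_measurable M"
    and lim: "AE x in M. (\<lambda>n. g n x) \<longlonglongrightarrow> G x"
    and le: "\<forall>\<^sub>F n in sequentially. (\<integral>\<^sup>+x. g n x \<partial>M) \<le> C"
  shows "(\<integral>\<^sup>+x. G x \<partial>M) \<le> C"
proof -
  have "(\<integral>\<^sup>+x. G x \<partial>M) = (\<integral>\<^sup>+x. liminf (\<lambda>n. g n x) \<partial>M)"
    by (rule nn_integral_cong_AE, use lim in eventually_elim) (simp add: lim_imp_Liminf)
  also have "\<dots> \<le> liminf (\<lambda>n. \<integral>\<^sup>+x. g n x \<partial>M)" by (rule nn_integral_liminf) measurable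
  also have "\<dots> \<le> liminf (\<lambda>n. C)" using le by (rule Liminf_mono)
  finally show ?thesis by (simp add: Liminf_const)
qed

text \<open>Convergence in mean of real functions, kept together with the integrability that makes the integrals
  meaningful.\<close>

definition L1_lim :: "'a measure \<Rightarrow> (nat \<Rightarrow> 'a \<Rightarrow> real) \<Rightarrow> ('a \<Rightarrow> real) \<Rightarrow> bool" where
  "L1_lim M s f \<longleftrightarrow> (\<forall>n. integrable M (s n)) \<and> integrable M f \<and> (\<lambda>n. \<integral>x. \<bar>s n x - f x\<bar> \<partial>M) \<longlonglongrightarrow> 0"

lemma L1_limD:
  assumes "L1_lim M s f"
  shows "integrable M (s n)" "integrable M f" "(\<lambda>n. \<integral>x. \<bar>s n x - f x\<bar> \<partial>M) \<longlonglongrightarrow> 0"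
  using assms by (auto simp: L1_lim_def)

lemma L1_dist_triangle:
  fixes f g h :: "'a \<Rightarrow> real"
  assumes "integrable M f" "integrable M g" "integrable M h"
  shows "(\<integral>x. \<bar>f x - h x\<bar> \<partial>M) \<le> (\<integral>x. \<bar>f x - g x\<bar> \<partial>M) + (\<integral>x. \<bar>g x - h x\<bar> \<partial>M)"
proof -
  have "(\<integral>x. \<bar>f x - h x\<bar> \<partial>M) \<le> (\<integral>x. \<bar>f x - g x\<bar> + \<bar>g x - h x\<bar> \<partial>M)"
    using assms by (intro integral_mono) auto
  then show ?thesis using assms by simp
qed

lemma L1_dist_commute: "(\<integral>x. \<bar>f x - g x\<bar> \<partial>M) = (\<integral>x. \<bar>g x - f x :: real\<bar> \<partial>M)"
  by (simp add: abs_minus_commute)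

lemma tendsto_zero_if_bounded:
  fixes f :: "nat \<Rightarrow> real"
  assumes "g \<longlonglongrightarrow> 0" "\<And>n. 0 \<le> f n" "\<And>n. f n \<le> g n" shows "f \<longlonglongrightarrow> 0"
  by (rule tendsto_sandwich[OF _ _ tendsto_const assms(1)]) (auto simp: assms)

lemma L1_lim_close:
  assumes s: "L1_lim M s f" and t: "\<And>n. integrable M (t n)" and st: "(\<lambda>n. \<integral>x. \<bar>s n x - t n x\<bar> \<partial>M) \<longlonglongrightarrow> 0"
  shows "L1_lim M t f"
  unfolding L1_lim_def
proof (intro conjI allI t L1_limD(2)[OF s])
  have "(\<lambda>n. (\<integral>x. \<bar>s n x - t n x\<bar> \<partial>M) + (\<integral>x. \<bar>s n x - f x\<bar> \<partial>M)) \<longlonglongrightarrow> 0 + 0"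
    by (intro tendsto_add st L1_limD(3)[OF s])
  then have lim: "(\<lambda>n. (\<integral>x. \<bar>s n x - t n x\<bar> \<partial>M) + (\<integral>x. \<bar>s n x - f x\<bar> \<partial>M)) \<longlonglongrightarrow> 0" by simp
  show "(\<lambda>n. \<integral>x. \<bar>t n x - f x\<bar> \<partial>M) \<longlonglongrightarrow> 0"
  proof (rule tendsto_zero_if_bounded[OF lim])
    fix n show "(\<integral>x. \<bar>t n x - f x\<bar> \<partial>M) \<le> (\<integral>x. \<bar>s n x - t n x\<bar> \<partial>M) + (\<integral>x. \<bar>s n x - f x\<bar> \<partial>M)"
      using L1_dist_triangle[OF t[of n] L1_limD(1)[OF s, of n] L1_limD(2)[OF s]] L1_dist_commute[where f="t n" and g="s n" and M=M] by simp
  qed simp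
qed

lemma L1_lim_AE_eq:
  assumes s: "L1_lim M s f" and t: "L1_lim M s g"
  shows "AE x in M. f x = g x"
proof -
  have "(\<lambda>n. (\<integral>x. \<bar>s n x - f x\<bar> \<partial>M) + (\<integral>x. \<bar>s n x - g x\<bar> \<partial>M)) \<longlonglongrightarrow> 0 + 0"
    by (intro tendsto_add L1_limD(3)[OF s] L1_limD(3)[OF t])
  moreover have "(\<integral>x. \<bar>f x - g x\<bar> \<partial>M) \<le> (\<integral>x. \<bar>s n x - f x\<bar> \<partial>M) + (\<integral>x. \<bar>s n x - g x\<bar> \<partial>M)" for n
    using L1_dist_triangle[OF L1_limD(2)[OF s] L1_limD(1)[OF s, of n] L1_limD(2)[OF t]] L1_dist_commute[where f=f and g="s n" and M=M] by simp
  ultimately have "(\<integral>x. \<bar>f x - g x\<bar> \<partial>M) \<le> 0 + 0" by (intro LIMSEQ_le_const) auto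
  moreover have "(\<integral>x. \<bar>f x - g x\<bar> \<partial>M) \<ge> 0" by simp
  ultimately have 0: "(\<integral>x. \<bar>f x - g x\<bar> \<partial>M) = 0" by simp
  have int: "integrable M (\<lambda>x. \<bar>f x - g x\<bar>)" using L1_limD(2)[OF s] L1_limD(2)[OF t] by simp
  have "AE x in M. \<bar>f x - g x\<bar> = 0" using 0 by (subst (asm) integral_nonneg_eq_0_iff_AE[OF int]) auto
  then show ?thesis by eventually_elim simp
qed

lemma L1_lim_dist:
  assumes s: "L1_lim M s f" and t: "L1_lim M t g" and eq: "AE x in M. f x = g x"
  shows "(\<lambda>n. \<integral>x. \<bar>s n x - t n x\<bar> \<partial>M) \<longlonglongrightarrow> 0"
proof (rule tendsto_zero_if_bounded)
  show "(\<lambda>n. (\<integral>x. \<bar>s n x - f x\<bar> \<partial>M) + (\<integral>x. \<bar>t n x - g x\<bar> \<partial>M)) \<longlonglongrightarrow> 0"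
    using tendsto_add[OF L1_limD(3)[OF s] L1_limD(3)[OF t]] by simp
  fix n
  have e: "(\<integral>x. \<bar>f x - t n x\<bar> \<partial>M) = (\<integral>x. \<bar>t n x - g x\<bar> \<partial>M)"
  proof (rule integral_cong_AE)
    show "AE x in M. \<bar>f x - t n x\<bar> = \<bar>t n x - g x\<bar>" using eq by eventually_elim simp
    show "(\<lambda>x. \<bar>f x - t n x\<bar>) \<in> borel_measurable M" "(\<lambda>x. \<bar>t n x - g x\<bar>) \<in> borel_measurable M"
      using borel_measurable_integrable[OF L1_limD(2)[OF s]] borel_measurable_integrable[OF L1_limD(1)[OF t, of n]]
        borel_measurable_integrable[OF L1_limD(2)[OF t]] by measurable
  qed
  show "(\<integral>x. \<bar>s n x - t n x\<bar> \<partial>M) \<le> (\<integral>x. \<bar>s n x - f x\<bar> \<partial>M) + (\<integral>x. \<bar>t n x - g x\<bar> \<partial>M)"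
    using L1_dist_triangle[OF L1_limD(1)[OF s, of n] L1_limD(2)[OF s] L1_limD(1)[OF t, of n]] unfolding e .
qed simp

lemma L1_lim_lincomb:
  assumes s: "L1_lim M s f" and t: "L1_lim M t g"
  shows "L1_lim M (\<lambda>n x. s n x + c * t n x) (\<lambda>x. f x + c * g x)"
  unfolding L1_lim_def
proof (intro conjI allI)
  show "integrable M (\<lambda>x. s n x + c * t n x)" for n using L1_limD(1)[OF s] L1_limD(1)[OF t] by simp
  show "integrable M (\<lambda>x. f x + c * g x)" using L1_limD(2)[OF s] L1_limD(2)[OF t] by simp
  show "(\<lambda>n. \<integral>x. \<bar>s n x + c * t n x - (f x + c * g x)\<bar> \<partial>M) \<longlonglongrightarrow> 0"
  proof (rule tendsto_zero_if_bounded)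
    show "(\<lambda>n. (\<integral>x. \<bar>s n x - f x\<bar> \<partial>M) + \<bar>c\<bar> * (\<integral>x. \<bar>t n x - g x\<bar> \<partial>M)) \<longlonglongrightarrow> 0"
      using tendsto_add[OF L1_limD(3)[OF s] tendsto_mult_left[OF L1_limD(3)[OF t], of "\<bar>c\<bar>"]] by simp
    fix n
    have int: "integrable M (s n)" "integrable M f" "integrable M (t n)" "integrable M g"
      using L1_limD[OF s] L1_limD[OF t] by auto
    have "(\<integral>x. \<bar>s n x + c * t n x - (f x + c * g x)\<bar> \<partial>M) \<le> (\<integral>x. \<bar>s n x - f x\<bar> + \<bar>c\<bar> * \<bar>t n x - g x\<bar> \<partial>M)"
    proof (rule integral_mono)
      fix x
      have "s n x + c * t n x - (f x + c * g x) = (s n x - f x) + c * (t n x - g x)" by (simp add: algebra_simps)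
      then show "\<bar>s n x + c * t n x - (f x + c * g x)\<bar> \<le> \<bar>s n x - f x\<bar> + \<bar>c\<bar> * \<bar>t n x - g x\<bar>"
        using abs_triangle_ineq[of "s n x - f x" "c * (t n x - g x)"] by (simp add: abs_mult)
    qed (use int in auto)
    also have "\<dots> = (\<integral>x. \<bar>s n x - f x\<bar> \<partial>M) + \<bar>c\<bar> * (\<integral>x. \<bar>t n x - g x\<bar> \<partial>M)"
      using int by simp
    finally show "(\<integral>x. \<bar>s n x + c * t n x - (f x + c * g x)\<bar> \<partial>M) \<le> \<dots>" .
  qed simp
qed

lemma L1_lim_const: "integrable M f \<Longrightarrow> L1_lim M (\<lambda>_. f) f"
  by (simp add: L1_lim_def)

lemma L1_lim_AE_subseq:
  assumes "L1_lim M s f"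
  obtains r where "strict_mono (r :: nat \<Rightarrow> nat)" "AE x in M. (\<lambda>n. s (r n) x) \<longlonglongrightarrow> f x"
proof -
  have "\<exists>r. strict_mono (r :: nat \<Rightarrow> nat) \<and> (AE x in M. (\<lambda>n. s (r n) x - f x) \<longlonglongrightarrow> 0)"
    by (rule tendsto_L1_AE_subseq) (use L1_limD[OF assms] in auto)
  then obtain r where r: "strict_mono (r :: nat \<Rightarrow> nat)" "AE x in M. (\<lambda>n. s (r n) x - f x) \<longlonglongrightarrow> 0" by blast
  from r(2) have "AE x in M. (\<lambda>n. s (r n) x) \<longlonglongrightarrow> f x"
    by eventually_elim (simp add: LIM_zero_iff)
  with r(1) show ?thesis by (rule that)
qed

lemma L1_complete:
  fixes s :: "nat \<Rightarrow> 'a \<Rightarrow> real"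
  assumes int: "\<And>n. integrable M (s n)"
    and cauchy: "\<And>e. e > 0 \<Longrightarrow> \<exists>k. \<forall>m\<ge>k. \<forall>n\<ge>k. (\<integral>x. \<bar>s m x - s n x\<bar> \<partial>M) < e"
  shows "\<exists>f. L1_lim M s f"
proof -
  obtain r where r: "strict_mono r" "AE x in M. Cauchy (\<lambda>i. s (r i) x)"
    using cauchy_L1_AE_cauchy_subseq[of M s] int cauchy unfolding real_norm_def by metis
  have [measurable]: "s n \<in> borel_measurable M" for n using int by simp
  define f where "f x = lim (\<lambda>i. s (r i) x)" for x
  have [measurable]: "f \<in> borel_measurable M" unfolding f_def by measurable
  have lim: "AE x in M. (\<lambda>i. s (r i) x) \<longlonglongrightarrow> f x"
    using r(2) by eventually_elim (simp add: f_def Cauchy_convergent_iff convergent_LIMSEQ_iff[symmetric])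
  have key: "\<exists>k. \<forall>n\<ge>k. (\<integral>\<^sup>+x. ennreal \<bar>s n x - f x\<bar> \<partial>M) \<le> ennreal e" if e: "e > 0" for e
  proof -
    obtain k where k: "\<And>m n. m \<ge> k \<Longrightarrow> n \<ge> k \<Longrightarrow> (\<integral>x. \<bar>s m x - s n x\<bar> \<partial>M) < e" using cauchy[OF e] by blast
    show ?thesis
    proof (intro exI[of _ k] allI impI)
      fix n assume n: "n \<ge> k"
      show "(\<integral>\<^sup>+x. ennreal \<bar>s n x - f x\<bar> \<partial>M) \<le> ennreal e"
      proof (rule nn_integral_le_of_AE_limit[where g="\<lambda>i x. ennreal \<bar>s n x - s (r i) x\<bar>"])
        show "AE x in M. (\<lambda>i. ennreal \<bar>s n x - s (r i) x\<bar>) \<longlonglongrightarrow> ennreal \<bar>s n x - f x\<bar>"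
          using lim by eventually_elim (intro tendsto_intros)
        show "\<forall>\<^sub>F i in sequentially. (\<integral>\<^sup>+x. ennreal \<bar>s n x - s (r i) x\<bar> \<partial>M) \<le> ennreal e"
          unfolding eventually_sequentially
        proof (intro exI[of _ k] allI impI)
          fix i assume "k \<le> i"
          then have "k \<le> r i" using seq_suble[OF r(1), of i] by simp
          have "(\<integral>\<^sup>+x. ennreal \<bar>s n x - s (r i) x\<bar> \<partial>M) = ennreal (\<integral>x. \<bar>s n x - s (r i) x\<bar> \<partial>M)"
            using int by (intro nn_integral_eq_integral) auto
          also have "\<dots> \<le> ennreal e" using k[OF n \<open>k \<le> r i\<close>] by (intro ennreal_leI) simp
          finally show "(\<integral>\<^sup>+x. ennreal \<bar>s n x - s (r i) x\<bar> \<partial>M) \<le> ennreal e" .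
        qed
      qed measurable
    qed
  qed
  obtain k where k: "(\<integral>\<^sup>+x. ennreal \<bar>s k x - f x\<bar> \<partial>M) \<le> ennreal 1" using key[of 1] by auto
  have "integrable M (\<lambda>x. s k x - f x)"
    unfolding integrable_iff_bounded using k by (auto intro: le_less_trans)
  from Bochner_Integration.integrable_diff[OF int[of k] this] have intf: "integrable M f" by simp
  have "(\<lambda>n. \<integral>x. \<bar>s n x - f x\<bar> \<partial>M) \<longlonglongrightarrow> 0"
  proof (rule LIMSEQ_I)
    fix e :: real assume e: "e > 0"
    then obtain k where k: "\<And>n. n \<ge> k \<Longrightarrow> (\<integral>\<^sup>+x. ennreal \<bar>s n x - f x\<bar> \<partial>M) \<le> ennreal (e / 2)" using key[of "e / 2"] by auto
    have "(\<integral>x. \<bar>s n x - f x\<bar> \<partial>M) \<le> e / 2" if "n \<ge> k" for n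
    proof -
      have "ennreal (\<integral>x. \<bar>s n x - f x\<bar> \<partial>M) = (\<integral>\<^sup>+x. ennreal \<bar>s n x - f x\<bar> \<partial>M)"
        using int intf by (intro nn_integral_eq_integral[symmetric]) auto
      also have "\<dots> \<le> ennreal (e / 2)" by (rule k[OF that])
      finally show ?thesis using e by (simp add: ennreal_le_iff)
    qed
    then show "\<exists>k. \<forall>n\<ge>k. norm ((\<integral>x. \<bar>s n x - f x\<bar> \<partial>M) - 0) < e"
      using e by (intro exI[of _ k]) (fastforce intro: le_less_trans)
  qed
  then show ?thesis using int intf by (auto simp: L1_lim_def)
qed

text \<open>Vitali's argument. With \<open>h = |g n - f|\<close> and a level \<open>L\<close> one has
  \<open>h^q \<le> min(h,L)^q + L^(q-p) h^p\<close>. The second term is uniformly small for large \<open>L\<close> because \<open>q < p\<close>, and for fixed \<open>L\<close>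
  the first tends to 0 by dominated convergence.\<close>

lemma weighted_Lq_convergence:
  fixes g :: "nat \<Rightarrow> 'a \<Rightarrow> real"
  assumes w: "integrable M w" "\<And>x. 0 \<le> w x"
    and [measurable]: "\<And>n. g n \<in> borel_measurable M" "f \<in> borel_measurable M"
    and lim: "AE x in M. (\<lambda>n. g n x) \<longlonglongrightarrow> f x"
    and X: "X \<ge> 0" "\<And>n. (\<integral>\<^sup>+x. ennreal (w x * \<bar>g n x\<bar> powr p) \<partial>M) \<le> ennreal X"
    and q: "0 < q" "q < p"
  shows "(\<lambda>n. \<integral>x. w x * \<bar>g n x - f x\<bar> powr q \<partial>M) \<longlonglongrightarrow> 0"
proof -
  have [measurable]: "w \<in> borel_measurable M" using w(1) by simp
  define Y where "Y = 2 powr p * (X + X)"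
  have Y: "Y \<ge> 0" using X by (simp add: Y_def)
  define h where "h n x = \<bar>g n x - f x\<bar>" for n x
  have [measurable]: "h n \<in> borel_measurable M" for n unfolding h_def by measurable
  have h0: "h n x \<ge> 0" for n x by (simp add: h_def)
  have fX: "(\<integral>\<^sup>+x. ennreal (w x * \<bar>f x\<bar> powr p) \<partial>M) \<le> ennreal X"
  proof (rule nn_integral_le_of_AE_limit[where g="\<lambda>n x. ennreal (w x * \<bar>g n x\<bar> powr p)"])
    show "AE x in M. (\<lambda>n. ennreal (w x * \<bar>g n x\<bar> powr p)) \<longlonglongrightarrow> ennreal (w x * \<bar>f x\<bar> powr p)"
      using lim
    proof eventually_elim
      case (elim x)
      have "(\<lambda>n. \<bar>g n x\<bar> powr p) \<longlonglongrightarrow> \<bar>f x\<bar> powr p"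
        by (rule tendsto_powr'[OF tendsto_rabs[OF elim] tendsto_const]) (use q in auto)
      then show ?case by (intro tendsto_ennrealI tendsto_mult tendsto_const)
    qed
  qed (use X(2) in auto)
  have hY: "(\<integral>\<^sup>+x. ennreal (w x * h n x powr p) \<partial>M) \<le> ennreal Y" for n
  proof -
    have pw: "w x * h n x powr p \<le> 2 powr p * (w x * \<bar>g n x\<bar> powr p + w x * \<bar>f x\<bar> powr p)" for x
    proof -
      let ?m = "max \<bar>g n x\<bar> \<bar>f x\<bar>"
      have "h n x powr p \<le> (2 * ?m) powr p" using q by (intro powr_mono2) (auto simp: h_def)
      also have "\<dots> = 2 powr p * ?m powr p" by (rule powr_mult)
      also have "?m powr p \<le> \<bar>g n x\<bar> powr p + \<bar>f x\<bar> powr p" by (auto simp: max_def)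
      finally have "h n x powr p \<le> 2 powr p * (\<bar>g n x\<bar> powr p + \<bar>f x\<bar> powr p)" by simp
      from mult_left_mono[OF this w(2)[of x]] show ?thesis by (simp add: algebra_simps)
    qed
    have "(\<integral>\<^sup>+x. ennreal (w x * h n x powr p) \<partial>M) \<le> (\<integral>\<^sup>+x. ennreal (2 powr p) * (ennreal (w x * \<bar>g n x\<bar> powr p) + ennreal (w x * \<bar>f x\<bar> powr p)) \<partial>M)"
      using w(2) ennreal_leI[OF pw] by (intro nn_integral_mono) (simp add: ennreal_mult')
    also have "\<dots> = ennreal (2 powr p) * ((\<integral>\<^sup>+x. ennreal (w x * \<bar>g n x\<bar> powr p) \<partial>M) + (\<integral>\<^sup>+x. ennreal (w x * \<bar>f x\<bar> powr p) \<partial>M))"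
      by (subst nn_integral_cmult, measurable, subst nn_integral_add) auto
    also have "\<dots> \<le> ennreal (2 powr p) * (ennreal X + ennreal X)" by (intro mult_left_mono add_mono X fX) auto
    also have "\<dots> = ennreal Y" using X(1) by (simp add: Y_def ennreal_mult' ennreal_plus[symmetric] del: ennreal_plus)
    finally show ?thesis .
  qed
  have inth: "integrable M (\<lambda>x. w x * h n x powr p)" for n
    unfolding integrable_iff_bounded using hY[of n] w(2) by (auto simp: abs_mult intro: le_less_trans)
  have inthY: "(\<integral>x. w x * h n x powr p \<partial>M) \<le> Y" for n
  proof -
    have "ennreal (\<integral>x. w x * h n x powr p \<partial>M) = (\<integral>\<^sup>+x. ennreal (w x * h n x powr p) \<partial>M)"
      using inth w(2) by (intro nn_integral_eq_integral[symmetric]) auto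
    also have "\<dots> \<le> ennreal Y" by (rule hY)
    finally show ?thesis using Y by (simp add: ennreal_le_iff)
  qed
  show ?thesis
  proof (rule LIMSEQ_I)
    fix e :: real assume e: "e > 0"
    have "((\<lambda>L. L powr (q - p) * Y) \<longlongrightarrow> 0 * Y) at_top"
      using q by (intro tendsto_mult_right tendsto_neg_powr filterlim_ident) auto
    then have "\<forall>\<^sub>F L in at_top. L powr (q - p) * Y < e / 2" by (rule order_tendstoD(2)) (use e in simp)
    then have "\<forall>\<^sub>F L in at_top. L powr (q - p) * Y < e / 2 \<and> L > 0" by (intro eventually_conj eventually_gt_at_top)
    then obtain L :: real where L: "L powr (q - p) * Y < e / 2" "L > 0" by (auto simp: eventually_at_top_linorder)
    have int1: "integrable M (\<lambda>x. w x * L powr q)" using w(1) by simp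
    have dom: "norm (w x * min (h n x) L powr q) \<le> w x * L powr q" for n x
      using w(2)[of x] h0[of n x] L q by (auto simp: abs_mult intro!: mult_left_mono powr_mono2)
    have int2: "integrable M (\<lambda>x. w x * min (h n x) L powr q)" for n
      by (rule Bochner_Integration.integrable_bound[OF int1]) (use dom[of _ n] in \<open>auto intro: order_trans[OF _ abs_ge_self]\<close>)
    have "(\<lambda>n. \<integral>x. w x * min (h n x) L powr q \<partial>M) \<longlonglongrightarrow> (\<integral>x. 0 \<partial>M)"
    proof (rule integral_dominated_convergence[OF _ _ int1])
      show "AE x in M. (\<lambda>n. w x * min (h n x) L powr q) \<longlonglongrightarrow> 0"
        using lim
      proof eventually_elim
        case (elim x)
        have "(\<lambda>n. \<bar>g n x - f x\<bar>) \<longlonglongrightarrow> \<bar>f x - f x\<bar>" by (intro tendsto_intros elim)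
        then have "(\<lambda>n. min (h n x) L) \<longlonglongrightarrow> min 0 L" unfolding h_def by (intro tendsto_min tendsto_const) simp
        then have "(\<lambda>n. min (h n x) L powr q) \<longlonglongrightarrow> min 0 L powr q"
          by (rule tendsto_powr'[OF _ tendsto_const]) (use q h0 L in auto)
        then have "(\<lambda>n. w x * min (h n x) L powr q) \<longlonglongrightarrow> w x * min 0 L powr q"
          by (intro tendsto_mult tendsto_const)
        then show ?case using L by (simp add: min_def)
      qed
    qed (use dom in auto)
    then have "\<forall>\<^sub>F n in sequentially. (\<integral>x. w x * min (h n x) L powr q \<partial>M) < e / 2"
      by (rule order_tendstoD(2)) (use e in simp)
    then obtain k where k: "\<And>n. n \<ge> k \<Longrightarrow> (\<integral>x. w x * min (h n x) L powr q \<partial>M) < e / 2" by (auto simp: eventually_sequentially)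
    have "\<bar>\<integral>x. w x * h n x powr q \<partial>M\<bar> < e" if n: "n \<ge> k" for n
    proof -
      have pw: "w x * h n x powr q \<le> w x * min (h n x) L powr q + L powr (q - p) * (w x * h n x powr p)" for x
      proof (cases "h n x \<le> L")
        case True
        then show ?thesis using w(2)[of x] by (simp add: min_def)
      next
        case False
        then have "h n x powr q = h n x powr (q - p) * h n x powr p" unfolding powr_add[symmetric] by simp
        also have "\<dots> \<le> L powr (q - p) * h n x powr p"
          using False L q by (intro mult_right_mono powr_mono2') auto
        finally have "w x * h n x powr q \<le> w x * (L powr (q - p) * h n x powr p)" using w(2) by (rule mult_left_mono)
        also have "\<dots> \<le> w x * min (h n x) L powr q + L powr (q - p) * (w x * h n x powr p)"
          using w(2)[of x] by (simp add: mult_ac)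
        finally show ?thesis .
      qed
      have int3: "integrable M (\<lambda>x. w x * min (h n x) L powr q + L powr (q - p) * (w x * h n x powr p))"
        using int2 inth by simp
      have int4: "integrable M (\<lambda>x. w x * h n x powr q)"
        by (rule Bochner_Integration.integrable_bound[OF int3])
           (use pw w(2) in \<open>auto simp: abs_mult intro: order_trans[OF _ abs_ge_self]\<close>)
      have "(\<integral>x. w x * h n x powr q \<partial>M) \<le> (\<integral>x. w x * min (h n x) L powr q + L powr (q - p) * (w x * h n x powr p) \<partial>M)"
        by (rule integral_mono[OF int4 int3 pw])
      also have "\<dots> = (\<integral>x. w x * min (h n x) L powr q \<partial>M) + L powr (q - p) * (\<integral>x. w x * h n x powr p \<partial>M)"
        using int2 inth by simp
      also have "\<dots> < e / 2 + e / 2"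
      proof (rule add_less_le_mono[OF k[OF n]])
        have "L powr (q - p) * (\<integral>x. w x * h n x powr p \<partial>M) \<le> L powr (q - p) * Y" by (intro mult_left_mono inthY) simp
        then show "L powr (q - p) * (\<integral>x. w x * h n x powr p \<partial>M) \<le> e / 2" using L(1) by linarith
      qed
      finally have "(\<integral>x. w x * h n x powr q \<partial>M) < e" by simp
      moreover have "(\<integral>x. w x * h n x powr q \<partial>M) \<ge> 0" using w(2) by (intro integral_nonneg_AE) simp
      ultimately show ?thesis by simp
    qed
    then show "\<exists>k. \<forall>n\<ge>k. norm ((\<integral>x. w x * \<bar>g n x - f x\<bar> powr q \<partial>M) - 0) < e"
      by (auto simp: h_def)
  qed
qed

section \<open>The embedding of the completion\<close>

context weighted_domain begin

lemma nn_integral_M_le: "\<phi> \<in> borel_measurable borel \<Longrightarrow> (\<integral>\<^sup>+x. ennreal (\<phi> x) \<partial>M) \<le> (\<integral>\<^sup>+x. ennreal (\<phi> x) \<partial>lborel)"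
  by (subst nn_integral_lebesgue_on) (auto intro!: nn_integral_mono simp: indicator_def)

text \<open>The bound is formulated with an upper bound \<open>\<sigma> > 0\<close> for the norm rather than with the norm itself. It then scales without
  a separate treatment of norm 0, and it passes to limits, where only an upper bound for the norms of the approximating
  functions is at hand.\<close>

definition Lq_bound :: "real \<Rightarrow> real \<Rightarrow> real \<Rightarrow> bool" where
  "Lq_bound l q C \<longleftrightarrow> C \<ge> 0 \<and> (\<forall>\<phi>\<in>V. \<forall>\<sigma>>0. norm2 \<alpha> \<Omega> \<phi> \<le> \<sigma> \<longrightarrow>
     (\<integral>\<^sup>+x. ennreal (norm x powr l * \<bar>\<phi> x\<bar> powr q) \<partial>M) \<le> ennreal (C * \<sigma> powr q))"

lemma Lq_boundD:
  assumes "Lq_bound l q C"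
  shows "C \<ge> 0" "\<phi> \<in> V \<Longrightarrow> \<sigma> > 0 \<Longrightarrow> norm2 \<alpha> \<Omega> \<phi> \<le> \<sigma> \<Longrightarrow>
     (\<integral>\<^sup>+x. ennreal (norm x powr l * \<bar>\<phi> x\<bar> powr q) \<partial>M) \<le> ennreal (C * \<sigma> powr q)"
  using assms unfolding Lq_bound_def by blast+

text \<open>The Stein-Weiss inequality for \<open>|\<phi>| / \<sigma>\<close> and \<open>|\<Delta>\<phi>| / \<sigma>\<close>.\<close>

lemma critical_estimate:
  fixes l p :: real
  assumes l: "l - \<alpha> > - 4" "(real CARD('n) - 4) * (l - \<alpha>) \<le> 4 * \<alpha>"
    and p: "p = 2 * (real CARD('n) + l) / (real CARD('n) + \<alpha> - 4)"
  obtains C where "Lq_bound l p C"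
proof -
  obtain C where C: "C \<ge> 0" and sw: "\<And>f u :: real^'n \<Rightarrow> real. riesz2_majorised u f \<Longrightarrow>
     (\<integral>\<^sup>+x. ennreal (norm x powr \<alpha> * (f x)\<^sup>2) \<partial>lborel) \<le> 1 \<Longrightarrow>
     (\<integral>\<^sup>+x. ennreal (norm x powr l * u x powr p) \<partial>lborel) \<le> ennreal C"
    using stein_weiss_riesz2[OF dim \<alpha> l p] by blast
  define \<kappa> where "\<kappa> = bubble_mass TYPE('n)"
  have \<kappa>: "\<kappa> > 0" unfolding \<kappa>_def by (rule bubble_mass_pos[OF dim2])
  show ?thesis
  proof (rule that[of "C / \<kappa> powr p"], unfold Lq_bound_def, intro conjI ballI allI impI)
    show "C / \<kappa> powr p \<ge> 0" using C by simp
    fix \<phi> and \<sigma> :: real assume \<phi>: "\<phi> \<in> V" and \<sigma>: "\<sigma> > 0" and le: "norm2 \<alpha> \<Omega> \<phi> \<le> \<sigma>"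
    define \<psi> where "\<psi> = (\<lambda>x. (1 / \<sigma>) * \<phi> x)"
    have \<psi>: "\<psi> \<in> V" unfolding \<psi>_def by (rule test_functions_algebra(3)[OF \<phi> \<phi>])
    have "norm2 \<alpha> \<Omega> \<psi> = norm2 \<alpha> \<Omega> \<phi> / \<sigma>"
      unfolding \<psi>_def norm2_scale[OF \<phi>] using \<sigma> by simp
    then have \<psi>1: "norm2 \<alpha> \<Omega> \<psi> \<le> 1" using le \<sigma> by simp
    have [measurable]: "\<psi> \<in> borel_measurable borel" "laplacian \<psi> \<in> borel_measurable borel" "\<phi> \<in> borel_measurable borel"
      using V_measurable[OF \<psi>] V_laplacian_measurable[OF \<psi>] V_measurable[OF \<phi>] by auto
    obtain K where K: "compact K" "K \<subseteq> \<Omega> - {0}" "\<And>x. x \<notin> K \<Longrightarrow> \<psi> x = 0" "\<And>k. C_k k \<psi>"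
      using test_functionsE[OF \<psi>] by blast
    have "(\<integral>\<^sup>+x. ennreal (norm x powr l * (\<kappa> * \<bar>\<psi> x\<bar>) powr p) \<partial>lborel) \<le> ennreal C"
    proof (rule sw)
      have "ennreal (\<kappa> * \<bar>\<psi> x\<bar>) \<le> riesz2 (\<lambda>x. \<bar>laplacian \<psi> x\<bar>) x" for x
        unfolding \<kappa>_def by (rule potential_bound[OF dim2 K(4) K(1,3)])
      then show "riesz2_majorised (\<lambda>x. \<kappa> * \<bar>\<psi> x\<bar>) (\<lambda>x. \<bar>laplacian \<psi> x\<bar>)"
        using \<kappa> by (simp add: riesz2_majorised_def)
      have "(norm2 \<alpha> \<Omega> \<psi>)\<^sup>2 \<le> 1" using \<psi>1 norm2_nonneg[of \<psi>] by (simp add: power_le_one)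
      then show "(\<integral>\<^sup>+x. ennreal (norm x powr \<alpha> * \<bar>laplacian \<psi> x\<bar>\<^sup>2) \<partial>lborel) \<le> 1"
        unfolding energy_nn_integral[OF \<psi>] by simp
    qed
    moreover have "norm x powr l * (\<kappa> * \<bar>\<psi> x\<bar>) powr p = (\<kappa> / \<sigma>) powr p * (norm x powr l * \<bar>\<phi> x\<bar> powr p)" for x
    proof -
      have "\<kappa> * \<bar>\<psi> x\<bar> = (\<kappa> / \<sigma>) * \<bar>\<phi> x\<bar>" using \<sigma> by (simp add: \<psi>_def abs_mult)
      then show ?thesis by (simp only: powr_mult mult_ac)
    qed
    ultimately have "(\<integral>\<^sup>+x. ennreal ((\<kappa> / \<sigma>) powr p) * ennreal (norm x powr l * \<bar>\<phi> x\<bar> powr p) \<partial>lborel) \<le> ennreal C"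
      by (simp only: ennreal_mult'[OF powr_ge_zero])
    then have *: "ennreal ((\<kappa> / \<sigma>) powr p) * (\<integral>\<^sup>+x. ennreal (norm x powr l * \<bar>\<phi> x\<bar> powr p) \<partial>lborel) \<le> ennreal C"
      by (simp add: nn_integral_cmult)
    have inv: "(\<sigma> / \<kappa>) powr p * (\<kappa> / \<sigma>) powr p = 1" using \<sigma> \<kappa> unfolding powr_mult[symmetric] by simp
    have "(\<integral>\<^sup>+x. ennreal (norm x powr l * \<bar>\<phi> x\<bar> powr p) \<partial>M) \<le> (\<integral>\<^sup>+x. ennreal (norm x powr l * \<bar>\<phi> x\<bar> powr p) \<partial>lborel)"
      by (rule nn_integral_M_le) measurable
    also have "\<dots> = ennreal ((\<sigma> / \<kappa>) powr p) * (ennreal ((\<kappa> / \<sigma>) powr p) * (\<integral>\<^sup>+x. ennreal (norm x powr l * \<bar>\<phi> x\<bar> powr p) \<partial>lborel))"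
      using inv by (simp add: mult.assoc[symmetric] ennreal_mult'[symmetric])
    also have "\<dots> \<le> ennreal ((\<sigma> / \<kappa>) powr p) * ennreal C" by (intro mult_left_mono *) auto
    also have "\<dots> = ennreal (C / \<kappa> powr p * \<sigma> powr p)"
      using C by (simp add: ennreal_mult'[symmetric] powr_divide mult.commute)
    finally show "(\<integral>\<^sup>+x. ennreal (norm x powr l * \<bar>\<phi> x\<bar> powr p) \<partial>M) \<le> ennreal (C / \<kappa> powr p * \<sigma> powr p)" .
  qed
qed

lemma weight_integrable:
  assumes l: "l > - real CARD('n)" shows "integrable M (\<lambda>x. norm x powr l)"
proof -
  obtain R where R: "R > 0" "\<And>x. x \<in> \<Omega> \<Longrightarrow> norm x < R"
    using \<Omega>(2) bounded_pos_less[of \<Omega>] by auto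
  obtain C where C: "C \<ge> 0" "\<And>r. r > 0 \<Longrightarrow>
    (\<integral>\<^sup>+x. ennreal (norm x powr l) * indicator (ball 0 r) (x::real^'n) \<partial>lborel) \<le> ennreal (C * r powr (l + real CARD('n)))"
    using nn_integral_norm_powr_ball[where 'n='n and a=l] l by auto
  have "(\<integral>\<^sup>+x. ennreal (norm (norm x powr l)) \<partial>M) = (\<integral>\<^sup>+x. ennreal (norm x powr l) * indicator \<Omega> x \<partial>lborel)"
    by (subst nn_integral_lebesgue_on) auto
  also have "\<dots> \<le> (\<integral>\<^sup>+x. ennreal (norm x powr l) * indicator (ball 0 R) (x::real^'n) \<partial>lborel)"
    using R(2) by (intro nn_integral_mono) (auto simp: indicator_def)
  also have "\<dots> \<le> ennreal (C * R powr (l + real CARD('n)))" by (rule C(2)[OF R(1)])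
  finally have "(\<integral>\<^sup>+x. ennreal (norm (norm x powr l)) \<partial>M) < \<infinity>" by (auto intro: le_less_trans)
  moreover have "(\<lambda>x::real^'n. norm x powr l) \<in> borel_measurable M"
    by (rule measurable_restrict_space1, rule measurable_completion) auto
  ultimately show ?thesis by (simp add: integrable_iff_bounded)
qed

lemma V_measurable_M: "\<phi> \<in> V \<Longrightarrow> \<phi> \<in> borel_measurable M"
  using V_integrable(2) by (rule borel_measurable_integrable)

lemma weight_measurable [measurable]: "(\<lambda>x::real^'n. norm x powr l) \<in> borel_measurable M"
  by (rule measurable_restrict_space1, rule measurable_completion) auto

text \<open>On a set of finite weighted volume the inequality \<open>t^q \<le> 1 + t^p\<close> reduces smaller exponents to the critical
  one.\<close>

lemma subcritical_estimate:
  fixes l p q :: real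
  assumes l: "l > - real CARD('n)" and q: "0 < q" "q \<le> p"
    and C: "Lq_bound l p C"
  obtains D where "Lq_bound l q D"
proof -
  let ?W = "\<integral>x. norm x powr l \<partial>M"
  have W: "?W \<ge> 0" by (intro integral_nonneg_AE) simp
  have nnW: "(\<integral>\<^sup>+x. ennreal (norm x powr l) \<partial>M) = ennreal ?W"
    using weight_integrable[OF l] by (rule nn_integral_eq_integral) simp
  show ?thesis
  proof (rule that[of "?W + C"], unfold Lq_bound_def, intro conjI ballI allI impI)
    show "?W + C \<ge> 0" using Lq_boundD(1)[OF C] W by simp
    fix \<phi> and \<sigma> :: real assume \<phi>: "\<phi> \<in> V" and \<sigma>: "\<sigma> > 0" and le: "norm2 \<alpha> \<Omega> \<phi> \<le> \<sigma>"
    have [measurable]: "\<phi> \<in> borel_measurable M" by (rule V_measurable_M[OF \<phi>])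
    define \<psi> where "\<psi> = (\<lambda>x. (1 / \<sigma>) * \<phi> x)"
    have \<psi>: "\<psi> \<in> V" unfolding \<psi>_def by (rule test_functions_algebra(3)[OF \<phi> \<phi>])
    have [measurable]: "\<psi> \<in> borel_measurable M" by (rule V_measurable_M[OF \<psi>])
    have "norm2 \<alpha> \<Omega> \<psi> = norm2 \<alpha> \<Omega> \<phi> / \<sigma>"
      unfolding \<psi>_def norm2_scale[OF \<phi>] using \<sigma> by simp
    then have \<psi>1: "norm2 \<alpha> \<Omega> \<psi> \<le> 1" using le \<sigma> by simp
    have pw: "\<bar>t\<bar> powr q \<le> 1 + \<bar>t\<bar> powr p" for t :: real
    proof (cases "\<bar>t\<bar> \<le> 1")
      case True
      then have "\<bar>t\<bar> powr q \<le> 1 powr q" using q by (intro powr_mono2) auto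
      also have "\<dots> \<le> 1 + \<bar>t\<bar> powr p" by simp
      finally show ?thesis .
    next
      case False
      then have "\<bar>t\<bar> powr q \<le> \<bar>t\<bar> powr p" using q by (intro powr_mono) auto
      then show ?thesis by simp
    qed
    have "(\<integral>\<^sup>+x. ennreal (norm x powr l * \<bar>\<psi> x\<bar> powr q) \<partial>M) \<le> (\<integral>\<^sup>+x. ennreal (norm x powr l) + ennreal (norm x powr l * \<bar>\<psi> x\<bar> powr p) \<partial>M)"
    proof (rule nn_integral_mono)
      fix x :: "real^'n"
      have "norm x powr l * \<bar>\<psi> x\<bar> powr q \<le> norm x powr l + norm x powr l * \<bar>\<psi> x\<bar> powr p"
        using mult_left_mono[OF pw[of "\<psi> x"], of "norm x powr l"] by (simp add: distrib_left)
      from ennreal_leI[OF this] show "ennreal (norm x powr l * \<bar>\<psi> x\<bar> powr q) \<le> ennreal (norm x powr l) + ennreal (norm x powr l * \<bar>\<psi> x\<bar> powr p)"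
        by simp
    qed
    also have "\<dots> = ennreal ?W + (\<integral>\<^sup>+x. ennreal (norm x powr l * \<bar>\<psi> x\<bar> powr p) \<partial>M)"
      by (subst nn_integral_add, measurable) (simp add: nnW)
    also have "\<dots> \<le> ennreal ?W + ennreal (C * 1 powr p)" by (intro add_left_mono Lq_boundD(2)[OF C] \<psi> \<psi>1) simp
    also have "\<dots> = ennreal (?W + C)" using W Lq_boundD(1)[OF C] by simp
    finally have *: "(\<integral>\<^sup>+x. ennreal (norm x powr l * \<bar>\<psi> x\<bar> powr q) \<partial>M) \<le> ennreal (?W + C)" .
    have scaled: "norm x powr l * \<bar>\<phi> x\<bar> powr q = \<sigma> powr q * (norm x powr l * \<bar>\<psi> x\<bar> powr q)" for x
    proof -
      have "\<bar>\<phi> x\<bar> = \<sigma> * \<bar>\<psi> x\<bar>" using \<sigma> by (simp add: \<psi>_def abs_mult)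
      then show ?thesis by (simp only: powr_mult mult_ac)
    qed
    have "(\<integral>\<^sup>+x. ennreal (norm x powr l * \<bar>\<phi> x\<bar> powr q) \<partial>M) = (\<integral>\<^sup>+x. ennreal (\<sigma> powr q) * ennreal (norm x powr l * \<bar>\<psi> x\<bar> powr q) \<partial>M)"
      unfolding scaled by (simp only: ennreal_mult'[OF powr_ge_zero])
    also have "\<dots> = ennreal (\<sigma> powr q) * (\<integral>\<^sup>+x. ennreal (norm x powr l * \<bar>\<psi> x\<bar> powr q) \<partial>M)"
      by (rule nn_integral_cmult) measurable
    also have "\<dots> \<le> ennreal (\<sigma> powr q) * ennreal (?W + C)" by (intro mult_left_mono *) simp
    also have "\<dots> = ennreal ((?W + C) * \<sigma> powr q)" by (simp only: ennreal_mult'[OF powr_ge_zero, symmetric] mult.commute)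
    finally show "(\<integral>\<^sup>+x. ennreal (norm x powr l * \<bar>\<phi> x\<bar> powr q) \<partial>M) \<le> ennreal ((?W + C) * \<sigma> powr q)" .
  qed
qed

lemma Lw_of_nn_integral_bound:
  assumes [measurable]: "f \<in> borel_measurable M" and q: "q > 0" and X: "X \<ge> 0"
    and le: "(\<integral>\<^sup>+x. ennreal (norm x powr l * \<bar>f x\<bar> powr q) \<partial>M) \<le> ennreal X"
  shows "f \<in> Lw q l \<Omega>" "Lw_norm q l \<Omega> f \<le> X powr (1 / q)"
proof -
  have int: "integrable M (\<lambda>x. norm x powr l * \<bar>f x\<bar> powr q)"
    unfolding integrable_iff_bounded using le by (auto simp: abs_mult intro: le_less_trans)
  have "(norm x powr (l / q) * \<bar>f x\<bar>) powr q = norm x powr l * \<bar>f x\<bar> powr q" for x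
    using q by (simp add: powr_mult powr_powr)
  then show "f \<in> Lw q l \<Omega>" using int by (simp add: Lw_def)
  have "ennreal (\<integral>x. norm x powr l * \<bar>f x\<bar> powr q \<partial>M) = (\<integral>\<^sup>+x. ennreal (norm x powr l * \<bar>f x\<bar> powr q) \<partial>M)"
    using int by (rule nn_integral_eq_integral[symmetric]) simp
  also note le
  finally have "(\<integral>x. norm x powr l * \<bar>f x\<bar> powr q \<partial>M) \<le> X" using X by (simp add: ennreal_le_iff)
  then show "Lw_norm q l \<Omega> f \<le> X powr (1 / q)"
    unfolding Lw_norm_def using q by (intro powr_mono2 integral_nonneg_AE) auto
qed

lemma D2_cauchyD:
  assumes "s \<in> D2_cauchy \<alpha> \<Omega>"
  shows "s n \<in> V" "e > 0 \<Longrightarrow> \<exists>k. \<forall>m\<ge>k. \<forall>n\<ge>k. norm2 \<alpha> \<Omega> (\<lambda>x. s m x - s n x) < e"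
  using assms by (auto simp: D2_cauchy_def)

lemma D2_cauchy_lincomb:
  assumes s: "s \<in> D2_cauchy \<alpha> \<Omega>" and t: "t \<in> D2_cauchy \<alpha> \<Omega>"
  shows "(\<lambda>n x. s n x + c * t n x) \<in> D2_cauchy \<alpha> \<Omega>"
  unfolding D2_cauchy_def
proof (intro CollectI conjI allI impI)
  show "(\<lambda>x. s n x + c * t n x) \<in> V" for n by (rule test_functions_lincomb[OF D2_cauchyD(1)[OF s] D2_cauchyD(1)[OF t]])
  fix e :: real assume e: "e > 0"
  obtain k1 where k1: "\<And>m n. m \<ge> k1 \<Longrightarrow> n \<ge> k1 \<Longrightarrow> norm2 \<alpha> \<Omega> (\<lambda>x. s m x - s n x) < e / 2"
    using D2_cauchyD(2)[OF s, of "e / 2"] e by auto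
  obtain k2 where k2: "\<And>m n. m \<ge> k2 \<Longrightarrow> n \<ge> k2 \<Longrightarrow> norm2 \<alpha> \<Omega> (\<lambda>x. t m x - t n x) < e / (2 * (\<bar>c\<bar> + 1))"
    using D2_cauchyD(2)[OF t, of "e / (2 * (\<bar>c\<bar> + 1))"] e by auto
  show "\<exists>k. \<forall>m\<ge>k. \<forall>n\<ge>k. norm2 \<alpha> \<Omega> (\<lambda>x. s m x + c * t m x - (s n x + c * t n x)) < e"
  proof (intro exI[of _ "max k1 k2"] allI impI)
    fix m n assume mn: "max k1 k2 \<le> m" "max k1 k2 \<le> n"
    have ds: "(\<lambda>x. s m x - s n x) \<in> V" and dt: "(\<lambda>x. t m x - t n x) \<in> V"
      by (intro test_functions_algebra(2) D2_cauchyD(1)[OF s] D2_cauchyD(1)[OF t])+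
    have "(\<lambda>x. s m x + c * t m x - (s n x + c * t n x)) = (\<lambda>x. (s m x - s n x) + c * (t m x - t n x))"
      by (simp add: fun_eq_iff algebra_simps)
    then have "norm2 \<alpha> \<Omega> (\<lambda>x. s m x + c * t m x - (s n x + c * t n x))
      \<le> norm2 \<alpha> \<Omega> (\<lambda>x. s m x - s n x) + \<bar>c\<bar> * norm2 \<alpha> \<Omega> (\<lambda>x. t m x - t n x)"
      using norm2_add[OF ds test_functions_algebra(3)[OF dt dt, of c]] by (simp add: norm2_scale[OF dt])
    also have "\<dots> < e / 2 + e / 2"
    proof (rule add_less_le_mono)
      show "norm2 \<alpha> \<Omega> (\<lambda>x. s m x - s n x) < e / 2" using k1 mn by simp
      have "\<bar>c\<bar> * norm2 \<alpha> \<Omega> (\<lambda>x. t m x - t n x) \<le> (\<bar>c\<bar> + 1) * (e / (2 * (\<bar>c\<bar> + 1)))"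
        using k2[of m n] mn norm2_nonneg by (intro mult_mono) auto
      also have "\<dots> = e / 2" using abs_ge_zero[of c] by (simp add: field_simps)
      finally show "\<bar>c\<bar> * norm2 \<alpha> \<Omega> (\<lambda>x. t m x - t n x) \<le> e / 2" .
    qed
    finally show "norm2 \<alpha> \<Omega> (\<lambda>x. s m x + c * t m x - (s n x + c * t n x)) < e" by simp
  qed
qed

lemma norm2_zero: "norm2 \<alpha> \<Omega> (\<lambda>x. 0) = 0"
proof -
  have "laplacian (\<lambda>x::real^'n. 0) = (\<lambda>x. 0)" by (simp add: laplacian_def partial_deriv_const fun_eq_iff)
  then show ?thesis by (simp add: norm2_def)
qed

lemma equiv_D2_rel: "equiv (D2_cauchy \<alpha> \<Omega>) (D2_rel \<alpha> \<Omega>)"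
proof (rule equivI)
  show "D2_rel \<alpha> \<Omega> \<subseteq> D2_cauchy \<alpha> \<Omega> \<times> D2_cauchy \<alpha> \<Omega>" by (auto simp: D2_rel_def)
  show "refl_on (D2_cauchy \<alpha> \<Omega>) (D2_rel \<alpha> \<Omega>)" by (auto simp: refl_on_def D2_rel_def norm2_zero)
  show "sym (D2_rel \<alpha> \<Omega>)"
  proof (rule symI)
    fix s t assume "(s, t) \<in> D2_rel \<alpha> \<Omega>"
    then have st: "s \<in> D2_cauchy \<alpha> \<Omega>" "t \<in> D2_cauchy \<alpha> \<Omega>" "(\<lambda>n. norm2 \<alpha> \<Omega> (\<lambda>x. s n x - t n x)) \<longlonglongrightarrow> 0"
      by (auto simp: D2_rel_def)
    have "norm2 \<alpha> \<Omega> (\<lambda>x. s n x - t n x) = norm2 \<alpha> \<Omega> (\<lambda>x. t n x - s n x)" for n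
      by (rule norm2_minus_commute[OF D2_cauchyD(1)[OF st(1)] D2_cauchyD(1)[OF st(2)]])
    then show "(t, s) \<in> D2_rel \<alpha> \<Omega>" using st by (simp add: D2_rel_def)
  qed
  show "trans (D2_rel \<alpha> \<Omega>)"
  proof (rule transI)
    fix s t r assume "(s, t) \<in> D2_rel \<alpha> \<Omega>" "(t, r) \<in> D2_rel \<alpha> \<Omega>"
    then have st: "s \<in> D2_cauchy \<alpha> \<Omega>" "t \<in> D2_cauchy \<alpha> \<Omega>" "r \<in> D2_cauchy \<alpha> \<Omega>"
       "(\<lambda>n. norm2 \<alpha> \<Omega> (\<lambda>x. s n x - t n x)) \<longlonglongrightarrow> 0" "(\<lambda>n. norm2 \<alpha> \<Omega> (\<lambda>x. t n x - r n x)) \<longlonglongrightarrow> 0"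
      by (auto simp: D2_rel_def)
    have "(\<lambda>n. norm2 \<alpha> \<Omega> (\<lambda>x. s n x - r n x)) \<longlonglongrightarrow> 0"
    proof (rule tendsto_zero_if_bounded)
      show "(\<lambda>n. norm2 \<alpha> \<Omega> (\<lambda>x. s n x - t n x) + norm2 \<alpha> \<Omega> (\<lambda>x. t n x - r n x)) \<longlonglongrightarrow> 0"
        using tendsto_add[OF st(4,5)] by simp
      show "norm2 \<alpha> \<Omega> (\<lambda>x. s n x - r n x) \<le> norm2 \<alpha> \<Omega> (\<lambda>x. s n x - t n x) + norm2 \<alpha> \<Omega> (\<lambda>x. t n x - r n x)" for n
        by (rule norm2_diff_triangle[OF D2_cauchyD(1)[OF st(1)] D2_cauchyD(1)[OF st(2)] D2_cauchyD(1)[OF st(3)]])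
    qed (rule norm2_nonneg)
    then show "(s, r) \<in> D2_rel \<alpha> \<Omega>" using st by (simp add: D2_rel_def)
  qed
qed

lemma D2_nonempty: "u \<in> D2 \<alpha> \<Omega> \<Longrightarrow> \<exists>s. s \<in> u"
  unfolding D2_def using in_quotient_imp_non_empty[OF equiv_D2_rel] by blast

lemma D2_member:
  assumes "u \<in> D2 \<alpha> \<Omega>" "s \<in> u"
  shows "s \<in> D2_cauchy \<alpha> \<Omega>" "u = D2_rel \<alpha> \<Omega> `` {s}" "t \<in> u \<Longrightarrow> (s, t) \<in> D2_rel \<alpha> \<Omega>"
proof -
  show s: "s \<in> D2_cauchy \<alpha> \<Omega>" using assms in_quotient_imp_subset[OF equiv_D2_rel] unfolding D2_def by blast
  show rel: "(s, t) \<in> D2_rel \<alpha> \<Omega>" if "t \<in> u" for t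
    using assms that in_quotient_imp_in_rel[OF equiv_D2_rel, of u s t] unfolding D2_def by blast
  show "u = D2_rel \<alpha> \<Omega> `` {s}"
    using rel assms in_quotient_imp_closed[OF equiv_D2_rel, of u s] unfolding D2_def by blast
qed

lemma D2_rel_L1_lim:
  assumes rel: "(s, t) \<in> D2_rel \<alpha> \<Omega>" and s: "L1_lim M s f" shows "L1_lim M t f"
proof (rule L1_lim_close[OF s])
  have st: "s n \<in> V" "t n \<in> V" for n using rel by (auto simp: D2_rel_def D2_cauchy_def)
  show "integrable M (t n)" for n by (rule V_integrable(2)[OF st(2)])
  obtain C where C: "C \<ge> 0" "\<And>\<phi>. \<phi> \<in> V \<Longrightarrow> (\<integral>x. \<bar>\<phi> x\<bar> \<partial>M) \<le> C * norm2 \<alpha> \<Omega> \<phi>" using V_L1_bound by blast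
  show "(\<lambda>n. \<integral>x. \<bar>s n x - t n x\<bar> \<partial>M) \<longlonglongrightarrow> 0"
  proof (rule tendsto_zero_if_bounded)
    have "(\<lambda>n. norm2 \<alpha> \<Omega> (\<lambda>x. s n x - t n x)) \<longlonglongrightarrow> 0" using rel by (simp add: D2_rel_def)
    from tendsto_mult_left[OF this, of C] show "(\<lambda>n. C * norm2 \<alpha> \<Omega> (\<lambda>x. s n x - t n x)) \<longlonglongrightarrow> 0" by simp
    show "(\<integral>x. \<bar>s n x - t n x\<bar> \<partial>M) \<le> C * norm2 \<alpha> \<Omega> (\<lambda>x. s n x - t n x)" for n
      by (rule C(2)[OF test_functions_algebra(2)[OF st]])
  qed simp
qed

lemma D2_cauchy_L1_lim:
  assumes s: "s \<in> D2_cauchy \<alpha> \<Omega>" shows "\<exists>f. L1_lim M s f"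
proof (rule L1_complete)
  show "integrable M (s n)" for n by (rule V_integrable(2)[OF D2_cauchyD(1)[OF s]])
  obtain C where C: "C \<ge> 0" "\<And>\<phi>. \<phi> \<in> V \<Longrightarrow> (\<integral>x. \<bar>\<phi> x\<bar> \<partial>M) \<le> C * norm2 \<alpha> \<Omega> \<phi>" using V_L1_bound by blast
  fix e :: real assume e: "e > 0"
  obtain k where k: "\<And>m n. m \<ge> k \<Longrightarrow> n \<ge> k \<Longrightarrow> norm2 \<alpha> \<Omega> (\<lambda>x. s m x - s n x) < e / (C + 1)"
    using D2_cauchyD(2)[OF s, of "e / (C + 1)"] e C(1) by auto
  show "\<exists>k. \<forall>m\<ge>k. \<forall>n\<ge>k. (\<integral>x. \<bar>s m x - s n x\<bar> \<partial>M) < e"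
  proof (intro exI[of _ k] allI impI)
    fix m n assume mn: "k \<le> m" "k \<le> n"
    have "(\<integral>x. \<bar>s m x - s n x\<bar> \<partial>M) \<le> C * norm2 \<alpha> \<Omega> (\<lambda>x. s m x - s n x)"
      by (intro C(2) test_functions_algebra(2) D2_cauchyD(1)[OF s])
    also have "\<dots> \<le> C * (e / (C + 1))" using k[OF mn] C(1) by (intro mult_left_mono) auto
    also have "\<dots> < e" using e C(1) by (simp add: field_simps)
    finally show "(\<integral>x. \<bar>s m x - s n x\<bar> \<partial>M) < e" .
  qed
qed

text \<open>All representatives of a class have the same limit in \<open>L^1(\<Omega>)\<close>, so the choice only fixes a version of this
  limit.\<close>

definition embed :: "'n D2_elem \<Rightarrow> real^'n \<Rightarrow> real" where
  "embed u = (SOME f. \<forall>s\<in>u. L1_lim M s f)"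

lemma embed_AE_eq:
  assumes "s \<in> u" "\<And>s. s \<in> u \<Longrightarrow> L1_lim M s f"
  shows "AE x in M. embed u x = f x"
proof -
  have "\<forall>s\<in>u. L1_lim M s (embed u)" unfolding embed_def by (rule someI[of _ f]) (use assms in blast)
  then show ?thesis using assms L1_lim_AE_eq by blast
qed

lemma embed_L1_lim:
  assumes u: "u \<in> D2 \<alpha> \<Omega>" and s: "s \<in> u" shows "L1_lim M s (embed u)"
proof -
  obtain f where f: "L1_lim M s f" using D2_cauchy_L1_lim[OF D2_member(1)[OF u s]] by blast
  have "\<forall>s\<in>u. L1_lim M s (embed u)" unfolding embed_def
    by (rule someI[of _ f]) (use D2_rel_L1_lim[OF D2_member(3)[OF u s] f] in blast)
  with s show ?thesis by blast
qed

lemma D2_norm_tendsto: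
  assumes u: "u \<in> D2 \<alpha> \<Omega>" and s: "s \<in> u"
  shows "(\<lambda>n. norm2 \<alpha> \<Omega> (s n)) \<longlonglongrightarrow> D2_norm \<alpha> \<Omega> u"
proof -
  have sV: "s n \<in> V" for n by (rule D2_cauchyD(1)[OF D2_member(1)[OF u s]])
  have "Cauchy (\<lambda>n. norm2 \<alpha> \<Omega> (s n))"
    unfolding Cauchy_def
  proof (intro allI impI)
    fix e :: real assume "e > 0"
    then obtain k where k: "\<forall>m\<ge>k. \<forall>n\<ge>k. norm2 \<alpha> \<Omega> (\<lambda>x. s m x - s n x) < e"
      using D2_cauchyD(2)[OF D2_member(1)[OF u s]] by blast
    then show "\<exists>k. \<forall>m\<ge>k. \<forall>n\<ge>k. dist (norm2 \<alpha> \<Omega> (s m)) (norm2 \<alpha> \<Omega> (s n)) < e"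
      using norm2_abs_diff[OF sV sV] unfolding dist_real_def by (meson le_less_trans)
  qed
  then obtain r where r: "(\<lambda>n. norm2 \<alpha> \<Omega> (s n)) \<longlonglongrightarrow> r" by (auto simp: Cauchy_convergent_iff convergent_def)
  have all: "(\<lambda>n. norm2 \<alpha> \<Omega> (t n)) \<longlonglongrightarrow> r" if t: "t \<in> u" for t
  proof -
    have tV: "t n \<in> V" for n by (rule D2_cauchyD(1)[OF D2_member(1)[OF u t]])
    have "(\<lambda>n. norm2 \<alpha> \<Omega> (\<lambda>x. s n x - t n x)) \<longlonglongrightarrow> 0" using D2_member(3)[OF u s t] by (simp add: D2_rel_def)
    then have "(\<lambda>n. \<bar>norm2 \<alpha> \<Omega> (s n) - norm2 \<alpha> \<Omega> (t n)\<bar>) \<longlonglongrightarrow> 0"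
      by (rule tendsto_zero_if_bounded) (use norm2_abs_diff[OF sV tV] in auto)
    then have "(\<lambda>n. norm2 \<alpha> \<Omega> (s n) - norm2 \<alpha> \<Omega> (t n)) \<longlonglongrightarrow> 0" by (simp add: tendsto_rabs_zero_iff)
    from tendsto_diff[OF r this] show ?thesis by simp
  qed
  have "D2_norm \<alpha> \<Omega> u = r"
    unfolding D2_norm_def by (rule the_equality) (use all s r LIMSEQ_unique in blast)+
  then show ?thesis using r by simp
qed

lemma D2_norm_nonneg:
  assumes u: "u \<in> D2 \<alpha> \<Omega>" shows "D2_norm \<alpha> \<Omega> u \<ge> 0"
proof -
  obtain s where "s \<in> u" using D2_nonempty[OF u] by blast
  from D2_norm_tendsto[OF u this] show ?thesis by (rule LIMSEQ_le_const) (auto simp: norm2_nonneg)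
qed

text \<open>A subsequence of a representative converges almost everywhere to the image, and its norms are eventually below
  \<open>\<sigma>\<close>.\<close>

lemma embed_bound:
  assumes u: "u \<in> D2 \<alpha> \<Omega>" and \<sigma>: "D2_norm \<alpha> \<Omega> u < \<sigma>" and q: "q > 0"
    and C: "Lq_bound l q C"
  shows "(\<integral>\<^sup>+x. ennreal (norm x powr l * \<bar>embed u x\<bar> powr q) \<partial>M) \<le> ennreal (C * \<sigma> powr q)"
proof -
  obtain s where s: "s \<in> u" using D2_nonempty[OF u] by blast
  have sV: "s n \<in> V" for n by (rule D2_cauchyD(1)[OF D2_member(1)[OF u s]])
  obtain r where r: "strict_mono (r :: nat \<Rightarrow> nat)" "AE x in M. (\<lambda>n. s (r n) x) \<longlonglongrightarrow> embed u x"
    by (rule L1_lim_AE_subseq[OF embed_L1_lim[OF u s]])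
  have \<sigma>0: "\<sigma> > 0" using D2_norm_nonneg[OF u] \<sigma> by simp
  show ?thesis
  proof (rule nn_integral_le_of_AE_limit[where g="\<lambda>n x. ennreal (norm x powr l * \<bar>s (r n) x\<bar> powr q)"])
    show "(\<lambda>x. ennreal (norm x powr l * \<bar>s (r n) x\<bar> powr q)) \<in> borel_measurable M" for n
      using V_measurable_M[OF sV[of "r n"]] by measurable
    show "AE x in M. (\<lambda>n. ennreal (norm x powr l * \<bar>s (r n) x\<bar> powr q)) \<longlonglongrightarrow> ennreal (norm x powr l * \<bar>embed u x\<bar> powr q)"
      using r(2)
    proof eventually_elim
      case (elim x)
      have "(\<lambda>n. \<bar>s (r n) x\<bar> powr q) \<longlonglongrightarrow> \<bar>embed u x\<bar> powr q"
        by (rule tendsto_powr'[OF tendsto_rabs[OF elim] tendsto_const]) (use q in auto)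
      then show ?case by (intro tendsto_ennrealI tendsto_mult tendsto_const)
    qed
    have "(\<lambda>n. norm2 \<alpha> \<Omega> (s (r n))) \<longlonglongrightarrow> D2_norm \<alpha> \<Omega> u"
      using LIMSEQ_subseq_LIMSEQ[OF D2_norm_tendsto[OF u s] r(1)] by (simp add: comp_def)
    then have "\<forall>\<^sub>F n in sequentially. norm2 \<alpha> \<Omega> (s (r n)) < \<sigma>" using \<sigma> by (rule order_tendstoD(2))
    then show "\<forall>\<^sub>F n in sequentially. (\<integral>\<^sup>+x. ennreal (norm x powr l * \<bar>s (r n) x\<bar> powr q) \<partial>M) \<le> ennreal (C * \<sigma> powr q)"
      by eventually_elim (intro Lq_boundD(2)[OF C] sV \<sigma>0, simp)
  qed
qed

lemma embed_integrable:
  assumes u: "u \<in> D2 \<alpha> \<Omega>" shows "integrable M (embed u)"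
proof -
  obtain s where "s \<in> u" using D2_nonempty[OF u] by blast
  from L1_limD(2)[OF embed_L1_lim[OF u this]] show ?thesis .
qed

lemma embed_measurable: "u \<in> D2 \<alpha> \<Omega> \<Longrightarrow> embed u \<in> borel_measurable M"
  by (rule borel_measurable_integrable[OF embed_integrable])

lemma embed_continuous:
  assumes u: "u \<in> D2 \<alpha> \<Omega>" and q: "q > 0" and C: "Lq_bound l q C"
  shows "embed u \<in> Lw q l \<Omega>" "Lw_norm q l \<Omega> (embed u) \<le> C powr (1 / q) * D2_norm \<alpha> \<Omega> u"
proof -
  let ?D = "D2_norm \<alpha> \<Omega> u"
  have D: "?D \<ge> 0" by (rule D2_norm_nonneg[OF u])
  have step: "embed u \<in> Lw q l \<Omega>" "Lw_norm q l \<Omega> (embed u) \<le> C powr (1 / q) * \<sigma>" if \<sigma>: "?D < \<sigma>" for \<sigma>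
  proof -
    have "\<sigma> > 0" using \<sigma> D by simp
    then have e: "(C * \<sigma> powr q) powr (1 / q) = C powr (1 / q) * \<sigma>" using q by (simp add: powr_mult powr_powr)
    have b: "(\<integral>\<^sup>+x. ennreal (norm x powr l * \<bar>embed u x\<bar> powr q) \<partial>M) \<le> ennreal (C * \<sigma> powr q)"
      by (rule embed_bound[OF u \<sigma> q C])
    have X: "C * \<sigma> powr q \<ge> 0" using Lq_boundD(1)[OF C] by simp
    show "embed u \<in> Lw q l \<Omega>" by (rule Lw_of_nn_integral_bound(1)[OF embed_measurable[OF u] q X b])
    show "Lw_norm q l \<Omega> (embed u) \<le> C powr (1 / q) * \<sigma>"
      unfolding e[symmetric] by (rule Lw_of_nn_integral_bound(2)[OF embed_measurable[OF u] q X b])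
  qed
  show "embed u \<in> Lw q l \<Omega>" by (rule step[of "?D + 1"]) simp
  \<comment> \<open>the estimate holds for every bound above the norm; let the bound decrease to the norm\<close>
  have "(\<lambda>n. C powr (1 / q) * (?D + inverse (real (Suc n)))) \<longlonglongrightarrow> C powr (1 / q) * (?D + 0)"
    by (intro tendsto_intros LIMSEQ_inverse_real_of_nat)
  then show "Lw_norm q l \<Omega> (embed u) \<le> C powr (1 / q) * ?D"
    by (intro LIMSEQ_le_const) (use step(2) in auto)
qed

lemma D2_of_embed:
  assumes \<phi>: "\<phi> \<in> V" shows "AE x in M. embed (D2_of \<alpha> \<Omega> \<phi>) x = \<phi> x"
proof -
  have c: "(\<lambda>_. \<phi>) \<in> D2_cauchy \<alpha> \<Omega>" using \<phi> by (simp add: D2_cauchy_def norm2_zero)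
  show ?thesis
  proof (rule embed_AE_eq)
    show "(\<lambda>_. \<phi>) \<in> D2_of \<alpha> \<Omega> \<phi>" using equiv_class_self[OF equiv_D2_rel c] by (simp add: D2_of_def)
    show "L1_lim M s \<phi>" if "s \<in> D2_of \<alpha> \<Omega> \<phi>" for s
      using that by (intro D2_rel_L1_lim[OF _ L1_lim_const[OF V_integrable(2)[OF \<phi>]]]) (simp add: D2_of_def)
  qed
qed

lemma D2_add_embed:
  assumes u: "u \<in> D2 \<alpha> \<Omega>" and v: "v \<in> D2 \<alpha> \<Omega>"
  shows "AE x in M. embed (D2_add \<alpha> \<Omega> u v) x = embed u x + embed v x"
proof -
  obtain s t where st: "s \<in> u" "t \<in> v" using D2_nonempty[OF u] D2_nonempty[OF v] by blast
  have c: "(\<lambda>n x. s n x + t n x) \<in> D2_cauchy \<alpha> \<Omega>"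
    using D2_cauchy_lincomb[OF D2_member(1)[OF u st(1)] D2_member(1)[OF v st(2)], of 1] by simp
  show ?thesis
  proof (rule embed_AE_eq)
    show "(\<lambda>n x. s n x + t n x) \<in> D2_add \<alpha> \<Omega> u v"
      using equiv_class_self[OF equiv_D2_rel c] st by (auto simp: D2_add_def)
    fix w assume "w \<in> D2_add \<alpha> \<Omega> u v"
    then obtain s t where st: "s \<in> u" "t \<in> v" "((\<lambda>n x. s n x + t n x), w) \<in> D2_rel \<alpha> \<Omega>" by (auto simp: D2_add_def)
    have "L1_lim M (\<lambda>n x. s n x + t n x) (\<lambda>x. embed u x + embed v x)"
      using L1_lim_lincomb[OF embed_L1_lim[OF u st(1)] embed_L1_lim[OF v st(2)], of 1] by simp
    from D2_rel_L1_lim[OF st(3) this] show "L1_lim M w (\<lambda>x. embed u x + embed v x)" .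
  qed
qed

lemma D2_scale_embed:
  assumes u: "u \<in> D2 \<alpha> \<Omega>"
  shows "AE x in M. embed (D2_scale \<alpha> \<Omega> c u) x = c * embed u x"
proof -
  have eq: "(\<lambda>n x. s n x + (c - 1) * s n x) = (\<lambda>n x. c * s n x)" for s :: "nat \<Rightarrow> real^'n \<Rightarrow> real"
    by (simp add: algebra_simps)
  obtain s where s: "s \<in> u" using D2_nonempty[OF u] by blast
  have c: "(\<lambda>n x. c * s n x) \<in> D2_cauchy \<alpha> \<Omega>"
    using D2_cauchy_lincomb[OF D2_member(1)[OF u s] D2_member(1)[OF u s], of "c - 1"] unfolding eq .
  show ?thesis
  proof (rule embed_AE_eq)
    show "(\<lambda>n x. c * s n x) \<in> D2_scale \<alpha> \<Omega> c u"
      using equiv_class_self[OF equiv_D2_rel c] s by (auto simp: D2_scale_def)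
    fix w assume "w \<in> D2_scale \<alpha> \<Omega> c u"
    then obtain s where s: "s \<in> u" "((\<lambda>n x. c * s n x), w) \<in> D2_rel \<alpha> \<Omega>" by (auto simp: D2_scale_def)
    have "(\<lambda>x. embed u x + (c - 1) * embed u x) = (\<lambda>x. c * embed u x)" by (simp add: algebra_simps)
    then have "L1_lim M (\<lambda>n x. c * s n x) (\<lambda>x. c * embed u x)"
      using L1_lim_lincomb[OF embed_L1_lim[OF u s(1)] embed_L1_lim[OF u s(1)], of "c - 1"] unfolding eq by simp
    from D2_rel_L1_lim[OF s(2) this] show "L1_lim M w (\<lambda>x. c * embed u x)" .
  qed
qed

text \<open>If two classes have the same limit, the difference of representatives tends to 0 in \<open>L^1\<close>, and closability turns this
  into equivalence.\<close>

lemma embed_injective: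
  assumes u: "u \<in> D2 \<alpha> \<Omega>" and v: "v \<in> D2 \<alpha> \<Omega>" and eq: "AE x in M. embed u x = embed v x"
  shows "u = v"
proof -
  obtain s t where st: "s \<in> u" "t \<in> v" using D2_nonempty[OF u] D2_nonempty[OF v] by blast
  note sc = D2_member(1)[OF u st(1)] and tc = D2_member(1)[OF v st(2)]
  have dc: "(\<lambda>n x. s n x - t n x) \<in> D2_cauchy \<alpha> \<Omega>" using D2_cauchy_lincomb[OF sc tc, of "-1"] by simp
  have "(\<lambda>n. norm2 \<alpha> \<Omega> (\<lambda>x. s n x - t n x)) \<longlonglongrightarrow> 0"
  proof (rule norm2_closable[where s="\<lambda>n x. s n x - t n x"])
    show "(\<lambda>n. \<integral>x. \<bar>s n x - t n x\<bar> \<partial>M) \<longlonglongrightarrow> 0"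
      by (rule L1_lim_dist[OF embed_L1_lim[OF u st(1)] embed_L1_lim[OF v st(2)] eq])
  qed (use D2_cauchyD[OF dc] in auto)
  then have "(s, t) \<in> D2_rel \<alpha> \<Omega>" using sc tc by (simp add: D2_rel_def)
  then show ?thesis
    using equiv_class_eq[OF equiv_D2_rel] D2_member(2)[OF u st(1)] D2_member(2)[OF v st(2)] by metis
qed

lemma embed_continuous_embedding:
  assumes q: "q > 0" and C: "Lq_bound l q C"
  shows "continuous_embedding \<alpha> q l \<Omega> embed"
  unfolding continuous_embedding_def D2_embedding_def
proof (intro conjI exI[of _ "C powr (1 / q)"] ballI allI impI)
  fix u assume u: "u \<in> D2 \<alpha> \<Omega>"
  show "embed u \<in> Lw q l \<Omega>" "Lw_norm q l \<Omega> (embed u) \<le> C powr (1 / q) * D2_norm \<alpha> \<Omega> u"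
    by (rule embed_continuous[OF u q C]; assumption)+
qed (rule D2_of_embed D2_add_embed D2_scale_embed embed_injective; assumption)+

text \<open>Replace each class by a test function that is close to it in \<open>L^1\<close> and has norm at most \<open>\<sigma>\<close>. Compactness of the test
  functions in \<open>L^1\<close> carries over to the images of the classes, which are bounded in the critical space and hence
  converge at the smaller exponent.\<close>

lemma embed_compact:
  assumes q: "0 < q" "q < p" and l: "l > - real CARD('n)"
    and C: "Lq_bound l p C" and D: "Lq_bound l q D"
    and u: "\<And>n. u n \<in> D2 \<alpha> \<Omega>" "\<And>n. D2_norm \<alpha> \<Omega> (u n) \<le> B"
  shows "\<exists>r f. strict_mono (r :: nat \<Rightarrow> nat) \<and> f \<in> Lw q l \<Omega> \<and>
     (\<lambda>n. Lw_norm q l \<Omega> (\<lambda>x. embed (u (r n)) x - f x)) \<longlonglongrightarrow> 0"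
proof -
  define \<sigma> where "\<sigma> = \<bar>B\<bar> + 1"
  have \<sigma>: "\<sigma> > 0" "D2_norm \<alpha> \<Omega> (u n) < \<sigma>" for n using u(2)[of n] by (auto simp: \<sigma>_def)
  have ex: "\<exists>\<phi>. \<phi> \<in> V \<and> norm2 \<alpha> \<Omega> \<phi> \<le> \<sigma> \<and> (\<integral>x. \<bar>\<phi> x - embed (u n) x\<bar> \<partial>M) < inverse (real (Suc n))" for n
  proof -
    obtain s where s: "s \<in> u n" using D2_nonempty[OF u(1)] by blast
    have "\<forall>\<^sub>F k in sequentially. norm2 \<alpha> \<Omega> (s k) < \<sigma>"
      by (rule order_tendstoD(2)[OF D2_norm_tendsto[OF u(1) s] \<sigma>(2)])
    moreover have "\<forall>\<^sub>F k in sequentially. (\<integral>x. \<bar>s k x - embed (u n) x\<bar> \<partial>M) < inverse (real (Suc n))"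
      by (rule order_tendstoD(2)[OF L1_limD(3)[OF embed_L1_lim[OF u(1) s]]]) simp
    ultimately have "\<forall>\<^sub>F k in sequentially. norm2 \<alpha> \<Omega> (s k) < \<sigma> \<and> (\<integral>x. \<bar>s k x - embed (u n) x\<bar> \<partial>M) < inverse (real (Suc n))"
      by (rule eventually_conj)
    then obtain k where k: "norm2 \<alpha> \<Omega> (s k) < \<sigma>" "(\<integral>x. \<bar>s k x - embed (u n) x\<bar> \<partial>M) < inverse (real (Suc n))"
      unfolding eventually_sequentially by blast
    have "s k \<in> V" by (rule D2_cauchyD(1)[OF D2_member(1)[OF u(1) s]])
    with k show ?thesis by (intro exI[of _ "s k"] conjI less_imp_le)
  qed
  obtain \<phi> where "\<forall>n. \<phi> n \<in> V \<and> norm2 \<alpha> \<Omega> (\<phi> n) \<le> \<sigma> \<and> (\<integral>x. \<bar>\<phi> n x - embed (u n) x\<bar> \<partial>M) < inverse (real (Suc n))"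
    using choice[where Q="\<lambda>n \<phi>. \<phi> \<in> V \<and> norm2 \<alpha> \<Omega> \<phi> \<le> \<sigma> \<and> (\<integral>x. \<bar>\<phi> x - embed (u n) x\<bar> \<partial>M) < inverse (real (Suc n))"] ex
    by blast
  then have \<phi>: "\<And>n. \<phi> n \<in> V" "\<And>n. norm2 \<alpha> \<Omega> (\<phi> n) \<le> \<sigma>"
    "\<And>n. (\<integral>x. \<bar>\<phi> n x - embed (u n) x\<bar> \<partial>M) < inverse (real (Suc n))" by blast+
  obtain R where R: "\<And>x. x \<in> \<Omega> \<Longrightarrow> norm x \<le> R" using \<Omega>(2) by (auto simp: bounded_iff)
  have "\<exists>K. compact K \<and> K \<subseteq> cball 0 R \<and> (\<forall>x. x \<notin> K \<longrightarrow> \<phi> n x = 0)" for n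
  proof -
    obtain K where "compact K" "K \<subseteq> \<Omega> - {0}" "\<And>x. x \<notin> K \<Longrightarrow> \<phi> n x = 0" "\<And>k. C_k k (\<phi> n)"
      using test_functionsE[OF \<phi>(1)] by blast
    then show ?thesis using R by (intro exI[of _ K]) auto
  qed
  then obtain K where K: "\<And>n. compact (K n)" "\<And>n. K n \<subseteq> cball 0 R" "\<And>n x. x \<notin> K n \<Longrightarrow> \<phi> n x = 0" by metis
  obtain A where A: "A \<ge> 0" "\<And>\<phi>. \<phi> \<in> V \<Longrightarrow> (\<integral>\<^sup>+x. ennreal \<bar>laplacian \<phi> x\<bar> \<partial>lborel) \<le> ennreal (A * norm2 \<alpha> \<Omega> \<phi>)"
    using laplacian_L1_bound by blast
  have A\<sigma>: "(\<integral>\<^sup>+x. ennreal \<bar>laplacian (\<phi> n) x\<bar> \<partial>lborel) \<le> ennreal (A * \<sigma>)" for n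
    using A(2)[OF \<phi>(1)[of n]] A(1) \<phi>(2)[of n] by (meson order_trans ennreal_leI mult_left_mono)
  have A\<sigma>0: "A * \<sigma> \<ge> 0" using A(1) \<sigma>(1) by simp
  obtain r where r: "strict_mono (r :: nat \<Rightarrow> nat)"
    "\<And>e. e > 0 \<Longrightarrow> \<exists>M. \<forall>m\<ge>M. \<forall>n\<ge>M. (\<integral>\<^sup>+x. ennreal \<bar>\<phi> (r m) x - \<phi> (r n) x\<bar> \<partial>lborel) \<le> ennreal e"
    by (rule L1_compactness[where \<phi>=\<phi> and K=K, OF dim2 V_C2[OF \<phi>(1)] K A\<sigma>0 A\<sigma>])
       (assumption, rule that, assumption, simp)
  have "\<exists>f. L1_lim M (\<lambda>n. \<phi> (r n)) f"
  proof (rule L1_complete)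
    show "integrable M (\<phi> (r n))" for n by (rule V_integrable(2)[OF \<phi>(1)])
    fix e :: real assume e: "e > 0"
    obtain k where k: "\<And>m n. m \<ge> k \<Longrightarrow> n \<ge> k \<Longrightarrow> (\<integral>\<^sup>+x. ennreal \<bar>\<phi> (r m) x - \<phi> (r n) x\<bar> \<partial>lborel) \<le> ennreal (e / 2)"
      using r(2)[of "e / 2"] e by auto
    show "\<exists>k. \<forall>m\<ge>k. \<forall>n\<ge>k. (\<integral>x. \<bar>\<phi> (r m) x - \<phi> (r n) x\<bar> \<partial>M) < e"
    proof (intro exI[of _ k] allI impI)
      fix m n assume "k \<le> m" "k \<le> n"
      from k[OF this] have "(\<integral>x. \<bar>\<phi> (r m) x - \<phi> (r n) x\<bar> \<partial>M) \<le> e / 2"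
        using e unfolding V_nn_integral_abs[OF test_functions_algebra(2)[OF \<phi>(1) \<phi>(1)]] by (simp add: ennreal_le_iff)
      then show "(\<integral>x. \<bar>\<phi> (r m) x - \<phi> (r n) x\<bar> \<partial>M) < e" using e by simp
    qed
  qed
  then obtain f where f: "L1_lim M (\<lambda>n. \<phi> (r n)) f" by blast
  have intu: "integrable M (embed (u n))" for n by (rule embed_integrable[OF u(1)])
  have "L1_lim M (\<lambda>n. embed (u (r n))) f"
  proof (rule L1_lim_close[OF f intu])
    show "(\<lambda>n. \<integral>x. \<bar>\<phi> (r n) x - embed (u (r n)) x\<bar> \<partial>M) \<longlonglongrightarrow> 0"
    proof (rule tendsto_zero_if_bounded[OF LIMSEQ_inverse_real_of_nat])
      fix n
      have "(\<integral>x. \<bar>\<phi> (r n) x - embed (u (r n)) x\<bar> \<partial>M) \<le> inverse (real (Suc (r n)))" using \<phi>(3)[of "r n"] by simp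
      also have "\<dots> \<le> inverse (real (Suc n))" using seq_suble[OF r(1), of n] by (intro le_imp_inverse_le) auto
      finally show "(\<integral>x. \<bar>\<phi> (r n) x - embed (u (r n)) x\<bar> \<partial>M) \<le> inverse (real (Suc n))" .
    qed simp
  qed
  from L1_lim_AE_subseq[OF this] obtain r' where r': "strict_mono (r' :: nat \<Rightarrow> nat)"
    "AE x in M. (\<lambda>n. embed (u (r (r' n))) x) \<longlonglongrightarrow> f x" by blast
  have [measurable]: "f \<in> borel_measurable M" "embed (u n) \<in> borel_measurable M" for n
    using L1_limD(2)[OF f] intu by auto
  have fq: "(\<integral>\<^sup>+x. ennreal (norm x powr l * \<bar>f x\<bar> powr q) \<partial>M) \<le> ennreal (D * \<sigma> powr q)"
  proof (rule nn_integral_le_of_AE_limit[where g="\<lambda>n x. ennreal (norm x powr l * \<bar>embed (u (r (r' n))) x\<bar> powr q)"])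
    show "AE x in M. (\<lambda>n. ennreal (norm x powr l * \<bar>embed (u (r (r' n))) x\<bar> powr q)) \<longlonglongrightarrow> ennreal (norm x powr l * \<bar>f x\<bar> powr q)"
      using r'(2)
    proof eventually_elim
      case (elim x)
      have "(\<lambda>n. \<bar>embed (u (r (r' n))) x\<bar> powr q) \<longlonglongrightarrow> \<bar>f x\<bar> powr q"
        by (rule tendsto_powr'[OF tendsto_rabs[OF elim] tendsto_const]) (use q in auto)
      then show ?case by (intro tendsto_ennrealI tendsto_mult tendsto_const)
    qed
    show "\<forall>\<^sub>F n in sequentially. (\<integral>\<^sup>+x. ennreal (norm x powr l * \<bar>embed (u (r (r' n))) x\<bar> powr q) \<partial>M) \<le> ennreal (D * \<sigma> powr q)"
      by (intro always_eventually allI embed_bound[OF u(1) \<sigma>(2) q(1) D])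
  qed measurable
  have "(\<lambda>n. \<integral>x. norm x powr l * \<bar>embed (u (r (r' n))) x - f x\<bar> powr q \<partial>M) \<longlonglongrightarrow> 0"
  proof (rule weighted_Lq_convergence[OF weight_integrable[OF l] _ _ _ r'(2) _ _ q])
    show "C * \<sigma> powr p \<ge> 0" using Lq_boundD(1)[OF C] by simp
    show "(\<integral>\<^sup>+x. ennreal (norm x powr l * \<bar>embed (u (r (r' n))) x\<bar> powr p) \<partial>M) \<le> ennreal (C * \<sigma> powr p)" for n
      by (rule embed_bound[OF u(1) \<sigma>(2) _ C]) (use q in auto)
  qed auto
  then have "(\<lambda>n. Lw_norm q l \<Omega> (\<lambda>x. embed (u ((r \<circ> r') n)) x - f x)) \<longlonglongrightarrow> 0 powr (1 / q)"
    unfolding Lw_norm_def comp_def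
    by (rule tendsto_powr'[OF _ tendsto_const]) (use q in \<open>auto intro!: always_eventually integral_nonneg_AE\<close>)
  moreover have "f \<in> Lw q l \<Omega>" by (rule Lw_of_nn_integral_bound(1)[OF _ q(1) _ fq]) (use Lq_boundD(1)[OF D] in auto)
  ultimately show ?thesis using strict_mono_o[OF r(1) r'(1)] by (intro exI[of _ "r \<circ> r'"] exI[of _ f]) simp
qed

end

theorem proposition1p5:
  fixes \<Omega> :: "(real^'n::finite) set"
    and N \<alpha> l N' \<tau> p\<^sub>s :: real
  assumes "N = real CARD('n)" and "N \<ge> 5"
    and "N' = N + \<alpha>" and "\<tau> = l - \<alpha>"
    and "2 * N > N'" and "N' > 4" and "\<tau> > - 4" and "\<alpha> \<ge> (N - 4) / 4 * \<tau>"
    and "p\<^sub>s = (N' + 4 + 2 * \<tau>) / (N' - 4)"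
    and "bounded_C2_domain \<Omega>" and "\<not> (\<exists>a r. \<Omega> = ball a r)" and "0 \<in> \<Omega>"
  shows "\<exists>\<iota>. (\<forall>q\<in>{1..p\<^sub>s + 1}. continuous_embedding \<alpha> q l \<Omega> \<iota>) \<and>
             (\<forall>q\<in>{1..<p\<^sub>s + 1}. compact_embedding \<alpha> q l \<Omega> \<iota>)"
proof -
  interpret weighted_domain \<Omega> \<alpha>
    by unfold_locales (use assms in \<open>auto simp: bounded_C2_domain_def\<close>)
  define p where "p = p\<^sub>s + 1"
  have p: "p = 2 * (real CARD('n) + l) / (real CARD('n) + \<alpha> - 4)"
  proof -
    have "N' - 4 \<noteq> 0" using assms(6) by simp
    then have "p = 2 * (N' + \<tau>) / (N' - 4)" by (simp add: p_def assms(9) field_simps)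
    then show ?thesis by (simp add: assms(1,3,4))
  qed
  have l: "l - \<alpha> > - 4" "l > - real CARD('n)" using assms(1,3,4,6,7) by auto
  have l': "(real CARD('n) - 4) * (l - \<alpha>) \<le> 4 * \<alpha>"
    unfolding assms(1)[symmetric] assms(4)[symmetric] using assms(8) by (simp add: mult.commute)
  obtain C where C: "Lq_bound l p C" by (rule critical_estimate[OF l(1) l' p])
  have sub: "\<exists>D. Lq_bound l q D" if "1 \<le> q" "q \<le> p" for q
  proof -
    have "0 < q" using that(1) by simp
    from subcritical_estimate[OF l(2) this that(2) C] show ?thesis by blast
  qed
  have cont: "continuous_embedding \<alpha> q l \<Omega> embed" if q: "1 \<le> q" "q \<le> p" for q
  proof -
    obtain D where "Lq_bound l q D" using sub[OF q] by blast
    then show ?thesis using q(1) by (intro embed_continuous_embedding) simp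
  qed
  have comp: "compact_embedding \<alpha> q l \<Omega> embed" if q: "1 \<le> q" "q < p" for q
    unfolding compact_embedding_def
  proof (intro conjI allI impI)
    show "continuous_embedding \<alpha> q l \<Omega> embed" using q by (intro cont) auto
    fix u :: "nat \<Rightarrow> 'n D2_elem"
    assume "(\<forall>n. u n \<in> D2 \<alpha> \<Omega>) \<and> (\<exists>B. \<forall>n. D2_norm \<alpha> \<Omega> (u n) \<le> B)"
    then obtain B where u: "\<And>n. u n \<in> D2 \<alpha> \<Omega>" "\<And>n. D2_norm \<alpha> \<Omega> (u n) \<le> B" by blast
    obtain D where D: "Lq_bound l q D" using sub[of q] q by auto
    show "\<exists>r f. strict_mono (r :: nat \<Rightarrow> nat) \<and> f \<in> Lw q l \<Omega> \<and>
       (\<lambda>n. Lw_norm q l \<Omega> (\<lambda>x. embed (u (r n)) x - f x)) \<longlonglongrightarrow> 0"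
      by (rule embed_compact[OF _ q(2) l(2) C D u]) (use q in simp)
  qed
  show ?thesis
    using cont comp by (intro exI[of _ embed]) (auto simp: p_def)
qed

end
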